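(* Let $\xi\ge1$ be a countable ordinal, and let $B\in\Pi^0_{\xi+1}(2^\omega)$ (lightface). Then there are $C\in\Pi^0_1(\omega^\omega)$ (lightface), a partial function $f:\omega^\omega\to2^\omega$ which is recursive on $C$, and a partial function $g:2^\omega\to\omega^\omega$ which is $\Sigma^0_\xi$-recursive on $B$, such that $f$ defines a bijection from $C$ onto $B$ and $g$ coincides with $f^{-1}$ (on $B$).
   Context: Effective notions (recursively presented Polish spaces, recursive functions) are those of Moschovakis' book "Descriptive Set Theory". Each recursively presented Polish space $X$ has its standard effective enumeration $(N(X,k))_{k\in\omega}$ of a neighbourhood basis (possibly with empty sets; $N(X,0)=\emptyset$). $X$ is of type at most $1$ if it is a finite product of spaces equal to $\omega$, $\omega^\omega$ or $2^\omega$. $B\in\Sigma^0_1(X)$ iff $B=\bigcup_{i}N(X,\varepsilon(i))$ for some recursive $\varepsilon:\omega\to\omega$; $\gamma\in\omega^\omega$ is $\Sigma^0_1$ (i.e. recursive) iff $\{k\mid\gamma\in N(\omega^\omega,k)\}\in\Sigma^0_1(\omega)$. Fix a good parametrization: sets $G^X\in\Sigma^0_1(\omega^\omega\times X)$, one for each recursively presented Polish $X$, such that $P\subseteq X$ is open iff $P=G^X_\gamma$ for some $\gamma\in\omega^\omega$, $P$ is $\Sigma^0_1$ iff $P=G^X_\gamma$ for some recursive $\gamma$, and for $X$ of type at most 1 and any $Y$ there is a recursive $S^{X,Y}:\omega^\omega\times X\to\omega^\omega$ with $(\gamma,x,y)\in G^{X\times Y}\Leftrightarrow(S^{X,Y}(\gamma,x),y)\in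 G^Y$. For $\gamma\in\omega^\omega$, $\{\gamma\}^{X,Y}$ is the partial function from $X$ to $Y$ with $\{\gamma\}^{X,Y}(x)$ defined and equal to $y$ iff $y$ is the (unique) point with $\forall k\,[y\in N(Y,k)\Leftrightarrow(\gamma,x,k)\in G^{X\times\omega}]$; write $\{\gamma\}$ when $Y=\omega^\omega$. Borel codes: let $\gamma^*(i):=\gamma(i+1)$. $BC_1:=\{\gamma\in\omega^\omega\mid\gamma(0)=0\}$ and for $2\le\xi<\omega_1$, $BC_\xi:=\{\gamma\in\omega^\omega\mid\gamma(0)=1$ and $\forall i\in\omega$, $\{\gamma^*\}(i)$ is defined and in $\bigcup_{1\le\eta<\xi}BC_\eta\}$; $BC:=\bigcup_{1\le\xi<\omega_1}BC_\xi$. For $\gamma\in BC$, $\rho^X(\gamma):=\bigcup_iN(X,\gamma^*(i))$ if $\gamma\in BC_1$, and $\rho^X(\gamma):=\bigcup_iX\setminus\rho^X(\{\gamma^*\}(i))$ otherwise. For $1\le\xi<\omega_1$ the lightface classes are $\Sigma^0_\xi(X):=\{\rho^X(\gamma)\mid\gamma\in\Sigma^0_1\cap BC_\xi\}$, and $\Pi^0_\xi$ is the class of complements of $\Sigma^0_\xi$ sets. For a partial function $f:X\to Y$ and $D\subseteq\mathrm{Domain}(f)$, a set $P\subseteq X\times\omega$ computes $f$ on $D$ if for all $x\in D$ and $k\in\omega$, $f(x)\in N(Y,k)\Leftrightarrow(x,k)\in P$. For a lightface pointclass $\Gamma$, $f$ is $\Gamma$-recursive on $D$ if some $P\in\Gamma$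 computes $f$ on $D$; "recursive on $D$" means $\Sigma^0_1$-recursive on $D$. *)

theory Defs
  imports "HOL-Analysis.Analysis" "HOL-Computational_Algebra.Primes"
begin

section \<open>Recursive functions on the natural numbers\<close>

text \<open>
  The least class of total functions containing the constants, successor and projections and
  closed under composition, primitive recursion and minimalization of regular functions.
  A function of \<open>n\<close> arguments is a function on lists of which only the values on lists of length
  \<open>n\<close> matter, hence the closure under \<open>ext\<close>.
\<close>

inductive recursive :: "nat \<Rightarrow> (nat list \<Rightarrow> nat) \<Rightarrow> bool" where
  const: "recursive n (\<lambda>_. c)"
| succ: "recursive 1 (\<lambda>xs. Suc (xs ! 0))"
| proj: "i < n \<Longrightarrow> recursive n (\<lambda>xs. xs ! i)"
| comp: "recursive (length fs) g \<Longrightarrow> (\<forall>f \<in> set fs. recursive n f) \<Longrightarrow>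
           recursive n (\<lambda>xs. g (map (\<lambda>f. f xs) fs))"
| prim: "recursive n g \<Longrightarrow> recursive (n + 2) h \<Longrightarrow>
           recursive (n + 1) (\<lambda>xs. rec_nat (g (tl xs)) (\<lambda>k v. h (k # v # tl xs)) (hd xs))"
| mini: "recursive (n + 1) g \<Longrightarrow> (\<forall>xs. length xs = n \<longrightarrow> (\<exists>y. g (y # xs) = 0)) \<Longrightarrow>
           recursive n (\<lambda>xs. LEAST y. g (y # xs) = 0)"
| ext: "recursive n f \<Longrightarrow> (\<forall>xs. length xs = n \<longrightarrow> f xs = f' xs) \<Longrightarrow> recursive n f'"

definition recursive_rel :: "nat \<Rightarrow> (nat list \<Rightarrow> bool) \<Rightarrow> bool" where
  "recursive_rel n R \<longleftrightarrow> recursive n (\<lambda>xs. if R xs then 1 else 0)"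

text \<open>\<open>entry s i\<close> is \<open>(s)\<^sub>i\<close>, the exponent of the \<open>i\<close>-th prime in \<open>s\<close>; note \<open>(0)\<^sub>i = 0\<close>.\<close>

definition entry :: "nat \<Rightarrow> nat \<Rightarrow> nat" where
  "entry s i = multiplicity (enumerate {p. prime p} i) s"


section \<open>Recursively presented Polish spaces\<close>

text \<open>
  All spaces are carried by subsets of one type of points, so that a parametrization (see below)
  can be a family indexed by all spaces and the class of spaces is closed under products.
  A nonempty Polish space has at most continuum many points, so every recursively presented
  Polish space has an isometric copy carried by a set of points of the form \<open>Pt_seq a\<close>.
\<close>

datatype pt = Pt_nat nat | Pt_seq "nat \<Rightarrow> nat" | Pt_pair pt pt

text \<open>A metric space together with a sequence of points, meant to be dense.\<close>

record space =
  points :: "pt set"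
  pdist :: "pt \<Rightarrow> pt \<Rightarrow> real"
  pres :: "nat \<Rightarrow> pt"

abbreviation top_of :: "space \<Rightarrow> pt topology" where
  "top_of X \<equiv> Metric_space.mtopology (points X) (pdist X)"

definition recursively_presented :: "space \<Rightarrow> bool" where
  "recursively_presented X \<longleftrightarrow>
     Metric_space (points X) (pdist X) \<and>
     Metric_space.mcomplete (points X) (pdist X) \<and>
     range (pres X) \<subseteq> points X \<and>
     top_of X closure_of range (pres X) = points X \<and>
     recursive_rel 4 (\<lambda>xs. pdist X (pres X (xs ! 0)) (pres X (xs ! 1))
                             \<le> real (xs ! 2) / (real (xs ! 3) + 1)) \<and>
     recursive_rel 4 (\<lambda>xs. pdist X (pres X (xs ! 0)) (pres X (xs ! 1))
                             < real (xs ! 2) / (real (xs ! 3) + 1))"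

text \<open>The standard effective enumeration \<open>N(X,s)\<close>: a ball of rational radius, possibly zero.\<close>

definition nbhd :: "space \<Rightarrow> nat \<Rightarrow> pt set" where
  "nbhd X s = Metric_space.mball (points X) (pdist X)
                (pres X (entry s 0)) (real (entry s 1) / (real (entry s 2) + 1))"

definition omega :: space where
  "omega = \<lparr>points = range Pt_nat,
            pdist = (\<lambda>x y. if x = y then 0 else 1),
            pres = Pt_nat\<rparr>"

fun seq_dist :: "pt \<Rightarrow> pt \<Rightarrow> real" where
  "seq_dist (Pt_seq a) (Pt_seq b) =
     (if a = b then 0 else 1 / (real (LEAST n. a n \<noteq> b n) + 1))"
| "seq_dist _ _ = 0"

definition baire :: space where
  "baire = \<lparr>points = range Pt_seq, pdist = seq_dist, pres = (\<lambda>i. Pt_seq (entry i))\<rparr>"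

definition cantor :: space where
  "cantor = \<lparr>points = {Pt_seq a | a. \<forall>n. a n \<in> {0, 1}},
             pdist = seq_dist,
             pres = (\<lambda>i. Pt_seq (\<lambda>n. min 1 (entry i n)))\<rparr>"

fun pair_dist :: "(pt \<Rightarrow> pt \<Rightarrow> real) \<Rightarrow> (pt \<Rightarrow> pt \<Rightarrow> real) \<Rightarrow> pt \<Rightarrow> pt \<Rightarrow> real" where
  "pair_dist d e (Pt_pair x y) (Pt_pair x' y') = max (d x x') (e y y')"
| "pair_dist d e _ _ = 0"

definition prod_space :: "space \<Rightarrow> space \<Rightarrow> space" (infixr "\<otimes>" 75) where
  "X \<otimes> Y = \<lparr>points = {Pt_pair x y | x y. x \<in> points X \<and> y \<in> points Y},
             pdist = pair_dist (pdist X) (pdist Y),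
             pres = (\<lambda>i. Pt_pair (pres X (entry i 0)) (pres Y (entry i 1)))\<rparr>"

text \<open>Spaces of type at most 1.\<close>

inductive type_le1 :: "space \<Rightarrow> bool" where
  "type_le1 omega"
| "type_le1 baire"
| "type_le1 cantor"
| "type_le1 X \<Longrightarrow> type_le1 Y \<Longrightarrow> type_le1 (X \<otimes> Y)"


section \<open>Semirecursive sets and recursive functions between spaces\<close>

type_synonym pointclass = "space \<Rightarrow> pt set set"

definition Sigma01 :: pointclass where
  "Sigma01 X = {\<Union>i. nbhd X (\<epsilon> i) | \<epsilon>. recursive 1 (\<lambda>xs. \<epsilon> (xs ! 0))}"

definition recursive_seq :: "(nat \<Rightarrow> nat) \<Rightarrow> bool" where
  "recursive_seq \<gamma> \<longleftrightarrow> {Pt_nat k | k. Pt_seq \<gamma> \<in> nbhd baire k} \<in> Sigma01 omega"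

definition partial_fun :: "space \<Rightarrow> space \<Rightarrow> (pt \<rightharpoonup> pt) \<Rightarrow> bool" where
  "partial_fun X Y f \<longleftrightarrow> dom f \<subseteq> points X \<and> ran f \<subseteq> points Y"

definition computes :: "space \<Rightarrow> space \<Rightarrow> (pt \<rightharpoonup> pt) \<Rightarrow> pt set \<Rightarrow> pt set \<Rightarrow> bool" where
  "computes X Y f D P \<longleftrightarrow> D \<subseteq> dom f \<and> P \<subseteq> points (X \<otimes> omega) \<and>
     (\<forall>x \<in> D. \<forall>k. the (f x) \<in> nbhd Y k \<longleftrightarrow> Pt_pair x (Pt_nat k) \<in> P)"

definition recursive_on_wrt ::
    "pointclass \<Rightarrow> space \<Rightarrow> space \<Rightarrow> (pt \<rightharpoonup> pt) \<Rightarrow> pt set \<Rightarrow> bool" where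
  "recursive_on_wrt \<Gamma> X Y f D \<longleftrightarrow>
     partial_fun X Y f \<and> (\<exists>P \<in> \<Gamma> (X \<otimes> omega). computes X Y f D P)"

abbreviation recursive_on :: "space \<Rightarrow> space \<Rightarrow> (pt \<rightharpoonup> pt) \<Rightarrow> pt set \<Rightarrow> bool" where
  "recursive_on \<equiv> recursive_on_wrt Sigma01"


section \<open>Good parametrizations\<close>

type_synonym parametrization = "space \<Rightarrow> pt set"

definition sect :: "parametrization \<Rightarrow> space \<Rightarrow> (nat \<Rightarrow> nat) \<Rightarrow> pt set" where
  "sect G X \<gamma> = {x. Pt_pair (Pt_seq \<gamma>) x \<in> G X}"

definition good_parametrization :: "parametrization \<Rightarrow> bool" where
  "good_parametrization G \<longleftrightarrow>
     (\<forall>X. recursively_presented X \<longrightarrow>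
        G X \<in> Sigma01 (baire \<otimes> X) \<and>
        (\<forall>P \<subseteq> points X. openin (top_of X) P \<longleftrightarrow> (\<exists>\<gamma>. P = sect G X \<gamma>)) \<and>
        (\<forall>P \<subseteq> points X. P \<in> Sigma01 X \<longleftrightarrow> (\<exists>\<gamma>. recursive_seq \<gamma> \<and> P = sect G X \<gamma>))) \<and>
     (\<forall>X Y. type_le1 X \<and> recursively_presented Y \<longrightarrow>
        (\<exists>S. recursive_on (baire \<otimes> X) baire S (points (baire \<otimes> X)) \<and>
           (\<forall>\<gamma>. \<forall>x \<in> points X. \<forall>y \<in> points Y.
              Pt_pair (Pt_seq \<gamma>) (Pt_pair x y) \<in> G (X \<otimes> Y) \<longleftrightarrow>
              Pt_pair (the (S (Pt_pair (Pt_seq \<gamma>) x))) y \<in> G Y)))"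

text \<open>The partial function \<open>{\<gamma>}\<close> from \<open>X\<close> to \<open>Y\<close>.\<close>

definition named_fun ::
    "parametrization \<Rightarrow> space \<Rightarrow> space \<Rightarrow> (nat \<Rightarrow> nat) \<Rightarrow> (pt \<rightharpoonup> pt)" where
  "named_fun G X Y \<gamma> x =
     (let Q = (\<lambda>y. y \<in> points Y \<and>
                (\<forall>k. y \<in> nbhd Y k \<longleftrightarrow> Pt_pair (Pt_seq \<gamma>) (Pt_pair x (Pt_nat k)) \<in> G (X \<otimes> omega)))
      in if x \<in> points X \<and> (\<exists>!y. Q y) then Some (THE y. Q y) else None)"


section \<open>The countable ordinals\<close>

text \<open>The first uncountable ordinal, as a type; \<open>countable_lessThan\<close> and \<open>uncountable_omega1\<close>
  below characterize it among the well-orders.\<close>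

typedef omega1 = "Field (cardSuc natLeq)"
proof -
  have "Field (cardSuc natLeq) \<noteq> {}"
    using cardSuc_finite[OF natLeq_Card_order] Field_natLeq by auto
  then show ?thesis by blast
qed

lemma omega1_Card_order: "Card_order (cardSuc natLeq)"
  by (simp add: cardSuc_Card_order natLeq_Card_order)

lemma omega1_Well_order: "Well_order (cardSuc natLeq)"
  using omega1_Card_order card_order_on_well_order_on by blast

instantiation omega1 :: wellorder
begin

definition less_eq_omega1 :: "omega1 \<Rightarrow> omega1 \<Rightarrow> bool" where
  "x \<le> y \<longleftrightarrow> (Rep_omega1 x, Rep_omega1 y) \<in> cardSuc natLeq"

definition less_omega1 :: "omega1 \<Rightarrow> omega1 \<Rightarrow> bool" where
  "(x :: omega1) < y \<longleftrightarrow> x \<le> y \<and> x \<noteq> y"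

instance
proof -
  let ?r = "cardSuc natLeq :: nat set rel"
  have ord: "refl_on (Field ?r) ?r" "trans ?r" "antisym ?r" "total_on (Field ?r) ?r"
    and wf: "wf (?r - Id)"
    using omega1_Well_order unfolding order_on_defs by auto
  show "OFCLASS(omega1, wellorder_class)"
  proof
    fix x y z :: omega1
    show refl: "x \<le> x"
      using ord(1) Rep_omega1 unfolding less_eq_omega1_def refl_on_def by blast
    show "x \<le> z" if "x \<le> y" "y \<le> z"
      using that ord(2) unfolding less_eq_omega1_def by (meson transD)
    show anti: "x = y" if "x \<le> y" "y \<le> x"
      using that ord(3) Rep_omega1_inject unfolding less_eq_omega1_def by (meson antisymD)
    show "x < y \<longleftrightarrow> x \<le> y \<and> \<not> y \<le> x"
      using anti refl unfolding less_omega1_def by auto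
    show "x \<le> y \<or> y \<le> x"
      using ord(4) Rep_omega1 Rep_omega1_inject refl
      unfolding less_eq_omega1_def total_on_def by metis
  next
    fix P :: "omega1 \<Rightarrow> bool" and a
    assume step: "\<And>x. (\<And>y. y < x \<Longrightarrow> P y) \<Longrightarrow> P x"
    have "wf {(x, y :: omega1). x < y}"
      by (rule wf_subset[OF wf_inv_image[OF wf, of Rep_omega1]])
        (auto simp: inv_image_def less_omega1_def less_eq_omega1_def Rep_omega1_inject)
    then show "P a"
      by (induction a rule: wf_induct_rule) (use step in blast)
  qed
qed

end

lemma countable_lessThan:
  includes cardinal_syntax
  shows "countable {..<\<xi> :: omega1}"
proof -
  let ?r = "cardSuc natLeq :: nat set rel"
  have "|underS ?r (Rep_omega1 \<xi>)| <o ?r"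
    using card_of_underS[OF omega1_Card_order] Rep_omega1 by blast
  then have "|underS ?r (Rep_omega1 \<xi>)| \<le>o natLeq"
    using cardSuc_ordLeq_ordLess[OF natLeq_Card_order card_of_Card_order] by blast
  then have "countable (underS ?r (Rep_omega1 \<xi>))"
    using card_of_nat ordIso_symmetric ordLeq_ordIso_trans
    by (metis card_of_ordLeq countable_def top_greatest)
  moreover have "Rep_omega1 ` {..<\<xi>} \<subseteq> underS ?r (Rep_omega1 \<xi>)"
    by (auto simp: underS_def less_omega1_def less_eq_omega1_def Rep_omega1_inject)
  ultimately have "countable (Rep_omega1 ` {..<\<xi>})"
    by (rule countable_subset[rotated])
  then show ?thesis
    by (rule countable_image_inj_on) (auto simp: inj_on_def Rep_omega1_inject)
qed

lemma uncountable_omega1: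
  includes cardinal_syntax
  shows "\<not> countable (UNIV :: omega1 set)"
proof
  let ?r = "cardSuc natLeq :: nat set rel"
  assume "countable (UNIV :: omega1 set)"
  then have "countable (range Rep_omega1)" by blast
  then have "countable (Field ?r)"
    using type_definition.Rep_range[OF type_definition_omega1] by simp
  then have "|Field ?r| \<le>o |UNIV :: nat set|"
    by (metis card_of_ordLeq countable_def top_greatest)
  then have "|Field ?r| \<le>o natLeq"
    using card_of_nat ordLeq_ordIso_trans by blast
  then have "?r \<le>o natLeq"
    using card_of_Field_ordIso[OF omega1_Card_order] ordIso_symmetric ordIso_ordLeq_trans by blast
  then show False
    using cardSuc_greater[OF natLeq_Card_order] not_ordLeq_ordLess by blast
qed

definition osuc :: "omega1 \<Rightarrow> omega1" where
  "osuc \<xi> = (LEAST \<eta>. \<xi> < \<eta>)"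

instantiation omega1 :: "{zero, one}"
begin

definition zero_omega1 :: omega1 where "0 = (LEAST \<xi> :: omega1. True)"
definition one_omega1 :: omega1 where "(1 :: omega1) = osuc 0"

instance ..

end

lemma osuc_greater: "\<xi> < osuc \<xi>"
proof -
  have "\<exists>\<eta>. \<xi> < \<eta>"
  proof (rule ccontr)
    assume "\<not> (\<exists>\<eta>. \<xi> < \<eta>)"
    then have "(UNIV :: omega1 set) = insert \<xi> {..<\<xi>}"
      by (auto simp: not_less order.order_iff_strict)
    then show False
      using uncountable_omega1 countable_lessThan by (metis countable_insert)
  qed
  then show ?thesis
    unfolding osuc_def by (rule LeastI_ex)
qed

lemma less_osuc_iff: "\<eta> < osuc \<xi> \<longleftrightarrow> \<eta> \<le> \<xi>"
  using osuc_greater[of \<xi>] not_less_Least[of \<eta> "\<lambda>\<eta>. \<xi> < \<eta>"]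
  unfolding osuc_def[symmetric] by (meson le_less_trans not_le)


section \<open>Borel codes and the lightface hierarchy\<close>

definition star :: "(nat \<Rightarrow> nat) \<Rightarrow> nat \<Rightarrow> nat" where
  "star \<gamma> i = \<gamma> (i + 1)"

text \<open>\<open>code_at G \<gamma> i \<beta>\<close> says that \<open>{\<gamma>\<^sup>*}(i)\<close> is defined and equal to \<open>\<beta>\<close>.\<close>

definition code_at :: "parametrization \<Rightarrow> (nat \<Rightarrow> nat) \<Rightarrow> nat \<Rightarrow> (nat \<Rightarrow> nat) \<Rightarrow> bool" where
  "code_at G \<gamma> i \<beta> \<longleftrightarrow> named_fun G omega baire (star \<gamma>) (Pt_nat i) = Some (Pt_seq \<beta>)"

inductive_set BC_level :: "parametrization \<Rightarrow> (omega1 \<times> (nat \<Rightarrow> nat)) set"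
  for G :: parametrization where
  "\<gamma> 0 = 0 \<Longrightarrow> (1, \<gamma>) \<in> BC_level G"
| "osuc 1 \<le> \<xi> \<Longrightarrow> \<gamma> 0 = 1 \<Longrightarrow>
     \<forall>i. \<exists>\<beta>. code_at G \<gamma> i \<beta> \<and> (\<exists>\<eta>. 1 \<le> \<eta> \<and> \<eta> < \<xi> \<and> (\<eta>, \<beta>) \<in> BC_level G) \<Longrightarrow>
     (\<xi>, \<gamma>) \<in> BC_level G"

definition BC_at :: "parametrization \<Rightarrow> omega1 \<Rightarrow> (nat \<Rightarrow> nat) set" where
  "BC_at G \<xi> = {\<gamma>. (\<xi>, \<gamma>) \<in> BC_level G}"

definition BC :: "parametrization \<Rightarrow> (nat \<Rightarrow> nat) set" where
  "BC G = (\<Union>\<xi> \<in> {1..}. BC_at G \<xi>)"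

text \<open>The graph of \<open>\<rho>\<^sup>X\<close>; the recursion equations are \<open>rho_base\<close> and \<open>rho_step\<close> below.\<close>

inductive rho_graph :: "parametrization \<Rightarrow> space \<Rightarrow> (nat \<Rightarrow> nat) \<Rightarrow> pt set \<Rightarrow> bool"
  for G :: parametrization and X :: space where
  "\<gamma> 0 = 0 \<Longrightarrow> rho_graph G X \<gamma> (\<Union>i. nbhd X (star \<gamma> i))"
| "\<gamma> 0 = 1 \<Longrightarrow> \<forall>i. code_at G \<gamma> i (\<beta> i) \<and> rho_graph G X (\<beta> i) (A i) \<Longrightarrow>
     rho_graph G X \<gamma> (\<Union>i. points X - A i)"

definition rho :: "parametrization \<Rightarrow> space \<Rightarrow> (nat \<Rightarrow> nat) \<Rightarrow> pt set" where
  "rho G X \<gamma> = (THE A. rho_graph G X \<gamma> A)"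

definition Sigma0 :: "parametrization \<Rightarrow> omega1 \<Rightarrow> pointclass" where
  "Sigma0 G \<xi> X = {rho G X \<gamma> | \<gamma>. recursive_seq \<gamma> \<and> \<gamma> \<in> BC_at G \<xi>}"

definition Pi0 :: "parametrization \<Rightarrow> omega1 \<Rightarrow> pointclass" where
  "Pi0 G \<xi> X = {points X - A | A. A \<in> Sigma0 G \<xi> X}"

lemma BC_at_one: "BC_at G 1 = {\<gamma>. \<gamma> 0 = 0}"
proof -
  have "\<not> osuc 1 \<le> (1 :: omega1)"
    using osuc_greater[of 1] by simp
  then show ?thesis
    unfolding BC_at_def by (auto intro: BC_level.intros elim: BC_level.cases)
qed

lemma BC_at_ge_two:
  assumes "osuc 1 \<le> \<xi>"
  shows "BC_at G \<xi> = {\<gamma>. \<gamma> 0 = 1 \<and>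
           (\<forall>i. \<exists>\<beta>. code_at G \<gamma> i \<beta> \<and> \<beta> \<in> (\<Union>\<eta> \<in> {1..<\<xi>}. BC_at G \<eta>))}"
    (is "_ = ?R")
proof (intro equalityI subsetI)
  fix \<gamma> assume "\<gamma> \<in> BC_at G \<xi>"
  then have "(\<xi>, \<gamma>) \<in> BC_level G" by (simp add: BC_at_def)
  then show "\<gamma> \<in> ?R"
  proof cases
    case 1
    then show ?thesis using assms osuc_greater[of 1] by simp
  next
    case 2
    have "\<exists>\<beta>. code_at G \<gamma> i \<beta> \<and> \<beta> \<in> (\<Union>\<eta> \<in> {1..<\<xi>}. BC_at G \<eta>)" for i
    proof -
      obtain \<beta> \<eta> where "code_at G \<gamma> i \<beta>" "1 \<le> \<eta>" "\<eta> < \<xi>" "(\<eta>, \<beta>) \<in> BC_level G"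
        using 2 by meson
      then show ?thesis by (force simp: BC_at_def)
    qed
    then show ?thesis using 2 by simp
  qed
next
  fix \<gamma> assume R: "\<gamma> \<in> ?R"
  have "\<exists>\<beta>. code_at G \<gamma> i \<beta> \<and> (\<exists>\<eta>. 1 \<le> \<eta> \<and> \<eta> < \<xi> \<and> (\<eta>, \<beta>) \<in> BC_level G)" for i
  proof -
    from R obtain \<beta> where "code_at G \<gamma> i \<beta>" "\<beta> \<in> (\<Union>\<eta> \<in> {1..<\<xi>}. BC_at G \<eta>)" by blast
    then show ?thesis by (force simp: BC_at_def)
  qed
  then have "(\<xi>, \<gamma>) \<in> BC_level G"
    using assms R by (intro BC_level.intros(2)) auto
  then show "\<gamma> \<in> BC_at G \<xi>" by (simp add: BC_at_def)
qed

lemma code_at_unique: "code_at G \<gamma> i \<beta> \<Longrightarrow> code_at G \<gamma> i \<beta>' \<Longrightarrow> \<beta> = \<beta>'"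
  by (simp add: code_at_def)

lemma rho_graph_unique: "rho_graph G X \<gamma> A \<Longrightarrow> rho_graph G X \<gamma> A' \<Longrightarrow> A = A'"
proof (induction arbitrary: A' rule: rho_graph.induct)
  case (1 \<gamma>)
  from 1(2) 1(1) show ?case by (cases rule: rho_graph.cases) auto
next
  case (2 \<gamma> \<beta> A)
  from 2(3) show ?case
  proof (cases rule: rho_graph.cases)
    case 1
    then show ?thesis using 2(1) by simp
  next
    case (2 \<beta>' B)
    have "A i = B i" for i
      using "2.IH" 2(3) code_at_unique by metis
    then show ?thesis using 2(1) by simp
  qed
qed

lemma BC_level_rho_graph: "(\<xi>, \<gamma>) \<in> BC_level G \<Longrightarrow> \<exists>A. rho_graph G X \<gamma> A"
proof (induction rule: BC_level.induct)
  case (1 \<gamma>)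
  then show ?case using rho_graph.intros(1) by blast
next
  case (2 \<xi> \<gamma>)
  then have "\<forall>i. \<exists>\<beta> A. code_at G \<gamma> i \<beta> \<and> rho_graph G X \<beta> A" by meson
  then obtain \<beta> A where "\<forall>i. code_at G \<gamma> i (\<beta> i) \<and> rho_graph G X (\<beta> i) (A i)" by metis
  then show ?case using rho_graph.intros(2) 2(2) by blast
qed

lemma rho_eq: "rho_graph G X \<gamma> A \<Longrightarrow> rho G X \<gamma> = A"
  unfolding rho_def by (rule the_equality, assumption) (rule rho_graph_unique)

lemma rho_base: "\<gamma> \<in> BC_at G 1 \<Longrightarrow> rho G X \<gamma> = (\<Union>i. nbhd X (star \<gamma> i))"
  by (rule rho_eq) (simp add: BC_at_one rho_graph.intros(1))

lemma rho_step:
  assumes "\<gamma> \<in> BC G" "\<gamma> \<notin> BC_at G 1" "\<And>i. code_at G \<gamma> i (\<beta> i)"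
  shows "rho G X \<gamma> = (\<Union>i. points X - rho G X (\<beta> i))"
proof -
  obtain \<xi> where "(\<xi>, \<gamma>) \<in> BC_level G"
    using assms(1) by (auto simp: BC_def BC_at_def)
  then show ?thesis
  proof cases
    case 1
    then show ?thesis using assms(2) by (simp add: BC_at_one)
  next
    case 2
    have "rho_graph G X (\<beta> i) (rho G X (\<beta> i))" for i
    proof -
      obtain \<beta>' \<eta> where "code_at G \<gamma> i \<beta>'" "(\<eta>, \<beta>') \<in> BC_level G" using 2 by meson
      then have "(\<eta>, \<beta> i) \<in> BC_level G" using assms(3) code_at_unique by metis
      then show ?thesis using BC_level_rho_graph rho_eq by metis
    qed
    then show ?thesis using 2 assms(3) by (intro rho_eq rho_graph.intros(2)) auto
  qed
qed

end

theory Submission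
  imports Defs "HOL-Library.Nat_Bijection"
begin

text \<open>Let \<open>B\<close> be the complement of the set coded by \<open>\<gamma>\<close>, and let \<open>A\<^sub>s\<close> be the set coded by the node \<open>s\<close> of
  the computable well-founded tree of subcodes of \<open>\<gamma>\<close>. For a point \<open>a\<close> put \<open>w(s) = 0\<close> if \<open>a\<close> is not
  in \<open>A\<^sub>s\<close>; otherwise let \<open>w(s)\<close> be one plus the least index witnessing \<open>a \<in> A\<^sub>s\<close>, that is, the index of
  a basic neighbourhood if \<open>s\<close> is a leaf and of a child of \<open>s\<close> whose set omits \<open>a\<close> otherwise. By induction
  on the level, this is the only \<open>w\<close> that is correct at every node relative to its children, and
  correctness is a \<open>\<Pi>\<^sup>0\<^sub>1\<close> condition. So the pairs \<open>(a, w)\<close> with \<open>w\<close> correct for \<open>a\<close> and \<open>0\<close> at the root form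
  a \<open>\<Pi>\<^sup>0\<^sub>1\<close> set, and \<open>(a, w) \<mapsto> a\<close> maps it bijectively onto \<open>B\<close>.

  For \<open>a\<close> in \<open>B\<close>, finite information about \<open>(a, w)\<close> follows from an open condition on \<open>a\<close> together with
  finitely many facts \<open>a \<notin> A\<^sub>s\<close>, where \<open>s\<close> is at least two steps below the root, so that \<open>A\<^sub>s\<close> has level
  less than \<open>\<xi>\<close>, or is empty if \<open>\<xi> = 1\<close>. Hence the inverse is \<open>\<Sigma>\<^sup>0\<^sub>\<xi>\<close>-recursive. The codes needed to see this refer to
  each other and are obtained from the recursion theorem.\<close>

section \<open>Computable functions between coded types\<close>

text \<open>Least witnesses make the lift unique: membership in a union usually has many witnesses,
  and without a canonical choice the projection would not be injective. The price is that a value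
  w(s) = i + 1 also asserts membership in the sets of the earlier children of an inner node. This
  too is expressed by a non-membership, one step further down, or by an open condition at a leaf.

  The delicate place is depth one, where the sets can have level \<xi> itself and their complements
  would be too complex to consult. Such facts never arise: the set at the root is the union of the
  complements of the sets at depth one, and a point of B lies outside it, hence in all of them, so w
  is nonzero there.

  The subcodes of \<gamma> cannot be reused for subsets of \<open>cantor \<otimes> omega\<close>,
  because the set named by a code depends on the enumeration of neighbourhoods of the space. New
  codes are built for the cylinders over the sets A_s and for finite unions of them; such a union
  stays below level \<xi> because finitely many levels below \<xi> have a maximum below
  \<xi>.\<close>

class coded =
  fixes enc :: "'a \<Rightarrow> nat" and dec :: "nat \<Rightarrow> 'a"
  assumes dec_enc [simp]: "dec (enc x) = x" and enc_dec [simp]: "enc (dec n) = n"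
begin

lemma enc_eq_iff [simp]: "enc x = enc y \<longleftrightarrow> x = y"
  by (metis dec_enc)

text \<open>This turns an unbounded search over a coded type into a search over numbers.\<close>

lemma ex_dec: "(\<exists>n. P (dec n)) \<longleftrightarrow> (\<exists>x. P x)"
  by (metis dec_enc)

end

instantiation nat :: coded
begin
definition [simp]: "enc (n :: nat) = n"
definition [simp]: "dec n = (n :: nat)"
instance by standard auto
end

instantiation prod :: (coded, coded) coded
begin
definition enc_prod: "enc p = prod_encode (enc (fst p), enc (snd p))"
definition dec_prod: "dec n = (dec (fst (prod_decode n)), dec (snd (prod_decode n)))"
instance by standard (auto simp: enc_prod dec_prod)
end

instantiation list :: (coded) coded
begin
definition enc_list: "enc xs = list_encode (map enc xs)"
definition dec_list: "dec n = map dec (list_decode n)"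
instance by standard (auto simp: enc_list dec_list comp_def)
end

section \<open>Closure properties of the recursive functions on lists\<close>

lemma recursive_comp1:
  assumes "recursive 1 (\<lambda>xs. g (xs ! 0))" "recursive n f"
  shows "recursive n (\<lambda>xs. g (f xs))"
  using recursive.comp[of "[f]" "\<lambda>xs. g (xs ! 0)" n] assms by simp

lemma recursive_comp2:
  assumes "recursive 2 (\<lambda>xs. g (xs ! 0) (xs ! 1))" "recursive n f" "recursive n h"
  shows "recursive n (\<lambda>xs. g (f xs) (h xs))"
  using recursive.comp[of "[f, h]" "\<lambda>xs. g (xs ! 0) (xs ! 1)" n] assms
  by (simp add: numeral_2_eq_2)

text \<open>One parameter is enough, because several can be packed by \<open>prod_encode\<close>.
  The recursion variable is at position 0 and the parameter at position 1, as
  \<open>recursive.prim\<close> produces them.\<close>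

lemma recursive_rec:
  fixes g :: "nat \<Rightarrow> nat"
  assumes "recursive 1 (\<lambda>xs. g (xs ! 0))" "recursive 3 (\<lambda>xs. h (xs ! 2) (xs ! 0) (xs ! 1))"
  shows "recursive 2 (\<lambda>xs. rec_nat (g (xs ! 1)) (h (xs ! 1)) (xs ! 0))"
proof -
  have "recursive (1 + 1) (\<lambda>xs. rec_nat (g (tl xs ! 0))
     (\<lambda>k v. h ((k # v # tl xs) ! 2) ((k # v # tl xs) ! 0) ((k # v # tl xs) ! 1)) (hd xs))"
    by (rule recursive.prim[of 1 "\<lambda>xs. g (xs ! 0)" "\<lambda>xs. h (xs ! 2) (xs ! 0) (xs ! 1)"])
      (use assms in \<open>auto simp: numeral_3_eq_3\<close>)
  then have "recursive 2 (\<lambda>xs. rec_nat (g (tl xs ! 0))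
     (\<lambda>k v. h ((k # v # tl xs) ! 2) ((k # v # tl xs) ! 0) ((k # v # tl xs) ! 1)) (hd xs))"
    by (simp add: numeral_2_eq_2)
  then show ?thesis
    by (rule recursive.ext) (auto simp: nth_tl hd_conv_nth length_Suc_conv numeral_2_eq_2)
qed

lemma recursive_Suc: "recursive n f \<Longrightarrow> recursive n (\<lambda>xs. Suc (f xs))"
  using recursive_comp1[of Suc n f] recursive.succ by simp

lemma recursive_nth: "i < n \<Longrightarrow> recursive n (\<lambda>xs. xs ! i)"
  by (rule recursive.proj)

lemma recursive_add2: "recursive 2 (\<lambda>xs. xs ! 0 + xs ! 1)"
proof -
  have "recursive 2 (\<lambda>xs. rec_nat (xs ! 1) (\<lambda>k v. Suc v) (xs ! 0))"
    by (rule recursive_rec[of "\<lambda>x. x" "\<lambda>x k v. Suc v"]) (auto intro!: recursive_Suc recursive_nth)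
  moreover have "rec_nat m (\<lambda>k v. Suc v) n = n + m" for n m
    by (induction n) auto
  ultimately show ?thesis by simp
qed

lemmas recursive_add = recursive_comp2[OF recursive_add2]

lemma recursive_mult2: "recursive 2 (\<lambda>xs. xs ! 0 * xs ! 1)"
proof -
  have "recursive 2 (\<lambda>xs. rec_nat 0 (\<lambda>k v. xs ! 1 + v) (xs ! 0))"
    by (rule recursive_rec[of "\<lambda>x. 0" "\<lambda>x k v. x + v"])
      (auto intro!: recursive_add recursive_nth recursive.const)
  moreover have "rec_nat 0 (\<lambda>k v. m + v) n = n * m" for n m :: nat
    by (induction n) auto
  ultimately show ?thesis by simp
qed

lemma recursive_pred1: "recursive 1 (\<lambda>xs. xs ! 0 - 1)"
proof -
  have "recursive 2 (\<lambda>xs. rec_nat 0 (\<lambda>k v. k) (xs ! 0))"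
    by (rule recursive_rec[of "\<lambda>x. 0" "\<lambda>x k v. k"]) (auto intro!: recursive_nth recursive.const)
  \<comment> \<open>The parameter slot of \<open>recursive_rec\<close> is filled by repeating the
    argument.\<close>
  from recursive_comp2[of "\<lambda>x y. rec_nat 0 (\<lambda>k v. k) x", OF this recursive_nth recursive_nth, of 0 1 0]
  have "recursive 1 (\<lambda>xs. rec_nat 0 (\<lambda>k v. k) (xs ! 0))"
    by simp
  moreover have "rec_nat 0 (\<lambda>k v. k) n = n - 1" for n :: nat
    by (cases n) auto
  ultimately show ?thesis by simp
qed

lemmas recursive_pred = recursive_comp1[OF recursive_pred1]

lemma recursive_diff2: "recursive 2 (\<lambda>xs. xs ! 1 - xs ! 0)"
proof -
  have "recursive 2 (\<lambda>xs. rec_nat (xs ! 1) (\<lambda>k v. v - 1) (xs ! 0))"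
    by (rule recursive_rec[of "\<lambda>x. x" "\<lambda>x k v. v - 1"]; intro recursive_pred recursive_nth; simp)
  moreover have "rec_nat m (\<lambda>k v. v - 1) n = m - n" for n m :: nat
    by (induction n) auto
  ultimately show ?thesis by simp
qed

lemma recursive_diff: "recursive n f \<Longrightarrow> recursive n g \<Longrightarrow> recursive n (\<lambda>xs. f xs - g xs)"
  using recursive_comp2[of "\<lambda>x y. y - x", OF recursive_diff2, of n g f] by simp

lemma recursive_triangle1: "recursive 1 (\<lambda>xs. triangle (xs ! 0))"
proof -
  have "recursive 2 (\<lambda>xs. rec_nat 0 (\<lambda>k v. v + Suc k) (xs ! 0))"
    by (rule recursive_rec[of "\<lambda>x. 0" "\<lambda>x k v. v + Suc k"])
      (intro recursive_add recursive_Suc recursive_nth recursive.const; simp)+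
  from recursive_comp2[of "\<lambda>x y. rec_nat 0 (\<lambda>k v. v + Suc k) x", OF this recursive_nth recursive_nth, of 0 1 0]
  have "recursive 1 (\<lambda>xs. rec_nat 0 (\<lambda>k v. v + Suc k) (xs ! 0))"
    by simp
  moreover have "rec_nat 0 (\<lambda>k v. v + Suc k) n = triangle n" for n :: nat
    by (induction n) auto
  ultimately show ?thesis by simp
qed

lemmas recursive_triangle = recursive_comp1[OF recursive_triangle1]

lemma recursive_prod_encode2: "recursive 2 (\<lambda>xs. prod_encode (xs ! 0, xs ! 1))"
proof -
  have "recursive 2 (\<lambda>xs. triangle (xs ! 0 + xs ! 1) + xs ! 0)"
    by (intro recursive_add recursive_triangle recursive_nth) auto
  then show ?thesis by (simp add: prod_encode_def)
qed

lemma mono_triangle: "m \<le> n \<Longrightarrow> triangle m \<le> triangle n"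
  by (induction n rule: dec_induct) auto

text \<open>In truncated subtraction the condition reads \<open>x < triangle (Suc k)\<close> for
  \<open>x = triangle (m + n) + m\<close>. As m \<le> m + n, the least such k is the diagonal that
  contains x, so the pairing function can be inverted by minimalization.\<close>

lemma Least_triangle: "(LEAST k. Suc (triangle (m + n) + m) - triangle (Suc k) = 0) = m + n"
proof (rule Least_equality)
  fix y assume "Suc (triangle (m + n) + m) - triangle (Suc y) = 0"
  then have "triangle (m + n) < triangle (Suc y)" by (simp del: triangle_Suc)
  then show "m + n \<le> y"
    using mono_triangle[of "Suc y" "m + n"] by (meson not_less_eq_eq leD)
qed simp

lemma recursive_triangle_root:
  "recursive 1 (\<lambda>xs. LEAST k. Suc (xs ! 0) - triangle (Suc k) = 0)"
proof -
  have "recursive (1 + 1) (\<lambda>xs. Suc (xs ! 1) - triangle (Suc (xs ! 0)))"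
    by (intro recursive_diff recursive_triangle recursive_Suc recursive_nth) auto
  moreover have "\<exists>y. Suc n - triangle (Suc y) = 0" for n
    by (rule exI[of _ n]) simp
  ultimately show ?thesis
    using recursive.mini[of 1 "\<lambda>xs. Suc (xs ! 1) - triangle (Suc (xs ! 0))"] by simp
qed

lemma fst_prod_decode:
  "fst (prod_decode n) = n - triangle (LEAST k. Suc n - triangle (Suc k) = 0)"
  and snd_prod_decode:
  "snd (prod_decode n) = (LEAST k. Suc n - triangle (Suc k) = 0) - fst (prod_decode n)"
proof -
  obtain a b where ab: "prod_decode n = (a, b)" by fastforce
  then have n: "n = triangle (a + b) + a"
    using prod_decode_inverse[of n] by (simp add: prod_encode_def)
  have L: "(LEAST k. Suc n - triangle (Suc k) = 0) = a + b"
    unfolding n by (rule Least_triangle)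
  have "n - triangle (a + b) = a"
    unfolding n by simp
  then show "fst (prod_decode n) = n - triangle (LEAST k. Suc n - triangle (Suc k) = 0)"
    "snd (prod_decode n) = (LEAST k. Suc n - triangle (Suc k) = 0) - fst (prod_decode n)"
    unfolding L ab by simp_all
qed

lemma recursive_fst_decode: "recursive 1 (\<lambda>xs. fst (prod_decode (xs ! 0)))"
  by (subst fst_prod_decode, intro recursive_diff recursive_triangle recursive_triangle_root recursive_nth) simp

lemma recursive_snd_decode: "recursive 1 (\<lambda>xs. snd (prod_decode (xs ! 0)))"
  by (subst snd_prod_decode, intro recursive_diff recursive_triangle_root recursive_fst_decode)

text \<open>Arguments are collected in one value of a product type, so a single arity serves for
  everything that follows and composition needs no bookkeeping of positions.\<close>

definition computable :: "('a::coded \<Rightarrow> 'b::coded) \<Rightarrow> bool" where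
  "computable f \<longleftrightarrow> recursive 1 (\<lambda>xs. enc (f (dec (xs ! 0))))"

named_theorems comp_intros

lemma computable_compose:
  assumes "computable h" "computable f"
  shows "computable (\<lambda>x. h (f x))"
  using recursive_comp1[of "\<lambda>n. enc (h (dec n))" 1 "\<lambda>xs. enc (f (dec (xs ! 0)))"] assms
  by (simp add: computable_def)

lemma computable_const [comp_intros]: "computable (\<lambda>x. c)"
  by (simp add: computable_def recursive.const)

lemma computable_ident [comp_intros]: "computable (\<lambda>x. x)"
  by (simp add: computable_def recursive_nth)

lemma computable_Pair [comp_intros]:
  assumes "computable f" "computable g"
  shows "computable (\<lambda>x. (f x, g x))"
  using recursive_comp2[of "\<lambda>a b. prod_encode (a, b)", OF recursive_prod_encode2] assms
  by (simp add: computable_def enc_prod)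

lemma computable_fst [comp_intros]: "computable f \<Longrightarrow> computable (\<lambda>x. fst (f x))"
  by (rule computable_compose[of fst]) (simp_all add: computable_def dec_prod recursive_fst_decode[simplified])

lemma computable_snd [comp_intros]: "computable f \<Longrightarrow> computable (\<lambda>x. snd (f x))"
  by (rule computable_compose[of snd]) (simp_all add: computable_def dec_prod recursive_snd_decode[simplified])

text \<open>On the level of codes both \<open>enc\<close> and \<open>dec\<close> are the identity,
  because they are inverse to each other.\<close>

lemma computable_enc [comp_intros]: "computable f \<Longrightarrow> computable (\<lambda>x. enc (f x))"
  by (simp add: computable_def)

lemma computable_dec [comp_intros]: "computable f \<Longrightarrow> computable (\<lambda>x. dec (f x))"
  by (simp add: computable_def)

lemma computable_compose2:
  assumes "computable (\<lambda>p. h (fst p) (snd p))" "computable f" "computable g"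
  shows "computable (\<lambda>x. h (f x) (g x))"
  using computable_compose[OF assms(1) computable_Pair[OF assms(2,3)]] by simp

lemma computable_compose3:
  assumes "computable (\<lambda>p. h (fst p) (fst (snd p)) (snd (snd p)))"
    "computable f" "computable g" "computable k"
  shows "computable (\<lambda>x. h (f x) (g x) (k x))"
  using computable_compose[OF assms(1) computable_Pair[OF assms(2) computable_Pair[OF assms(3,4)]]]
  by simp

lemma computable_nat2I:
  assumes "recursive 2 (\<lambda>xs. h (xs ! 0) (xs ! 1))" "computable f" "computable g"
  shows "computable (\<lambda>x. h (f x) (g x) :: nat)"
  using recursive_comp2[of h 1 "\<lambda>xs. f (dec (xs ! 0))" "\<lambda>xs. g (dec (xs ! 0))"] assms
  by (simp add: computable_def)

lemma computable_Suc [comp_intros]: "computable f \<Longrightarrow> computable (\<lambda>x. Suc (f x))"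
  by (rule computable_compose[of Suc]) (simp add: computable_def recursive_Suc recursive_nth)

lemma computable_add [comp_intros]:
  "computable f \<Longrightarrow> computable g \<Longrightarrow> computable (\<lambda>x. f x + g x :: nat)"
  by (rule computable_nat2I[of "(+)"]) (rule recursive_add2)

lemma computable_mult [comp_intros]:
  "computable f \<Longrightarrow> computable g \<Longrightarrow> computable (\<lambda>x. f x * g x :: nat)"
  by (rule computable_nat2I[of "(*)"]) (rule recursive_mult2)

lemma computable_diff [comp_intros]:
  "computable f \<Longrightarrow> computable g \<Longrightarrow> computable (\<lambda>x. f x - g x :: nat)"
  by (rule computable_nat2I[of "(-)"]) (intro recursive_diff recursive_nth, auto)

lemma computable_rec_nat [comp_intros]:
  fixes f :: "'a::coded \<Rightarrow> nat" and g :: "'a \<Rightarrow> 'b::coded"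
  assumes f: "computable f" and g: "computable g"
    and h: "computable (\<lambda>p. h (fst p) (fst (snd p)) (snd (snd p)))"
  shows "computable (\<lambda>x. rec_nat (g x) (h x) (f x))"
proof -
  let ?h = "\<lambda>x k v. enc (h (dec x) k (dec v))"
  have "recursive 1 (\<lambda>xs. enc (g (dec (xs ! 0))))" using g by (simp add: computable_def)
  moreover have "recursive 3 (\<lambda>xs. ?h (xs ! 2) (xs ! 0) (xs ! 1))"
  proof -
    have "recursive 3 (\<lambda>xs. prod_encode (xs ! 2, prod_encode (xs ! 0, xs ! 1)))"
      by (intro recursive_comp2[of "\<lambda>a b. prod_encode (a, b)", OF recursive_prod_encode2] recursive_nth) auto
    from recursive_comp1[OF h[unfolded computable_def] this] show ?thesis
      by (simp add: dec_prod)
  qed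
  ultimately have "recursive 2 (\<lambda>xs. rec_nat (enc (g (dec (xs ! 1)))) (?h (xs ! 1)) (xs ! 0))"
    by (rule recursive_rec)
  from recursive_comp2[OF this f[unfolded computable_def] recursive_nth[of 0 1]]
  have "recursive 1 (\<lambda>xs. rec_nat (enc (g (dec (xs ! 0)))) (?h (xs ! 0)) (f (dec (xs ! 0))))"
    by simp
  moreover have "rec_nat (enc (g x)) (\<lambda>k v. enc (h x k (dec v))) n = enc (rec_nat (g x) (h x) n)" for x n
    by (induction n) auto
  ultimately show ?thesis by (simp add: computable_def)
qed

lemma computable_minimization:
  fixes g :: "'a::coded \<times> nat \<Rightarrow> nat"
  assumes "computable g" "\<And>x. \<exists>y. g (x, y) = 0"
  shows "computable (\<lambda>x. LEAST y. g (x, y) = 0)"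
proof -
  have "recursive (1 + 1) (\<lambda>xs. g (dec (prod_encode (xs ! 1, xs ! 0))))"
    using recursive_comp1[OF assms(1)[unfolded computable_def], of 2 "\<lambda>xs. prod_encode (xs ! 1, xs ! 0)"]
      recursive_comp2[of "\<lambda>a b. prod_encode (a, b)", OF recursive_prod_encode2 recursive_nth recursive_nth, of 1 2 0]
    by (simp add: numeral_2_eq_2)
  from recursive.mini[OF this] assms(2) show ?thesis
    by (simp add: computable_def dec_prod)
qed

section \<open>Decidable predicates and bounded quantifiers\<close>

definition decidable :: "('a::coded \<Rightarrow> bool) \<Rightarrow> bool" where
  "decidable P \<longleftrightarrow> computable (\<lambda>x. of_bool (P x) :: nat)"

lemma decidable_compose: "decidable P \<Longrightarrow> computable f \<Longrightarrow> decidable (\<lambda>x. P (f x))"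
  unfolding decidable_def by (rule computable_compose)

lemma decidable_compose2:
  assumes "decidable (\<lambda>p. P (fst p) (snd p))" "computable f" "computable g"
  shows "decidable (\<lambda>x. P (f x) (g x))"
  using decidable_compose[OF assms(1) computable_Pair[OF assms(2,3)]] by simp

lemma decidable_not [comp_intros]:
  assumes "decidable P"
  shows "decidable (\<lambda>x. \<not> P x)"
proof -
  have "computable (\<lambda>x. 1 - of_bool (P x) :: nat)"
    using assms unfolding decidable_def by (intro comp_intros)
  moreover have "of_bool (\<not> b) = (1 - of_bool b :: nat)" for b by simp
  ultimately show ?thesis by (simp only: decidable_def)
qed

lemma decidable_conj [comp_intros]:
  "decidable P \<Longrightarrow> decidable Q \<Longrightarrow> decidable (\<lambda>x. P x \<and> Q x)"
  unfolding decidable_def of_bool_conj by (rule computable_mult)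

lemma decidable_disj [comp_intros]:
  "decidable P \<Longrightarrow> decidable Q \<Longrightarrow> decidable (\<lambda>x. P x \<or> Q x)"
  using decidable_not[OF decidable_conj[OF decidable_not decidable_not], of P Q] by simp

lemma decidable_imp [comp_intros]:
  "decidable P \<Longrightarrow> decidable Q \<Longrightarrow> decidable (\<lambda>x. P x \<longrightarrow> Q x)"
  unfolding imp_conv_disj by (intro comp_intros)

lemma decidable_le [comp_intros]:
  assumes "computable f" "computable g"
  shows "decidable (\<lambda>x. f x \<le> (g x :: nat))"
proof -
  have "computable (\<lambda>x. 1 - (f x - g x))"
    using assms by (intro comp_intros)
  moreover have "of_bool (m \<le> n) = 1 - (m - n)" for m n :: nat by auto
  ultimately show ?thesis by (simp add: decidable_def)
qed

lemma decidable_less [comp_intros]: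
  "computable f \<Longrightarrow> computable g \<Longrightarrow> decidable (\<lambda>x. f x < (g x :: nat))"
  unfolding not_le[symmetric] by (intro comp_intros)

lemma decidable_eq [comp_intros]:
  fixes f g :: "'a::coded \<Rightarrow> 'b::coded"
  assumes "computable f" "computable g"
  shows "decidable (\<lambda>x. f x = g x)"
proof -
  have "decidable (\<lambda>x. enc (f x) \<le> enc (g x) \<and> enc (g x) \<le> enc (f x))"
    using assms by (intro comp_intros)
  then show ?thesis by (simp flip: order.eq_iff)
qed

lemma computable_if [comp_intros]:
  assumes "decidable P" "computable f" "computable g"
  shows "computable (\<lambda>x. if P x then f x else g x)"
proof -
  have "computable (\<lambda>x. dec (of_bool (P x) * enc (f x) + (1 - of_bool (P x)) * enc (g x)))"
    using assms unfolding decidable_def by (intro comp_intros)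
  then show ?thesis
    by (rule back_subst[of computable]) auto
qed

lemma decidable_bex [comp_intros]:
  assumes P: "decidable (\<lambda>p. P (fst p) (snd p))" and f: "computable f"
  shows "decidable (\<lambda>x. \<exists>y<f x. P x (y :: nat))"
proof -
  have "computable (\<lambda>p. if P (fst p) (fst (snd p)) then 1 else snd (snd p))"
    by (intro comp_intros decidable_compose2[OF P])
  then have "computable (\<lambda>x. rec_nat 0 (\<lambda>k v. if P x k then 1 else v :: nat) (f x))"
    using f by (intro comp_intros decidable_compose2[OF P])
  moreover have "rec_nat 0 (\<lambda>k v. if P x k then 1 else v) n = (of_bool (\<exists>y<n. P x y) :: nat)" for x n
    by (induction n) (auto simp: less_Suc_eq)
  ultimately show ?thesis by (simp add: decidable_def)
qed

lemma decidable_ball [comp_intros]: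
  assumes "decidable (\<lambda>p. P (fst p) (snd p))" "computable f"
  shows "decidable (\<lambda>x. \<forall>y<f x. P x (y :: nat))"
  using decidable_not[OF decidable_bex[OF decidable_not[OF assms(1)] assms(2)]] by simp

lemma computable_Least:
  assumes "decidable (\<lambda>p. P (fst p) (snd p))" "\<And>x. \<exists>y. P x y"
  shows "computable (\<lambda>x. LEAST y. P x (y :: nat))"
  using computable_minimization[of "\<lambda>p. of_bool (\<not> P (fst p) (snd p))"] decidable_not[OF assms(1)] assms(2)
  by (simp add: decidable_def)


lemma decidable_bex_le [comp_intros]:
  assumes "decidable (\<lambda>p. P (fst p) (snd p))" "computable f"
  shows "decidable (\<lambda>x. \<exists>y\<le>f x. P x (y :: nat))"
  using decidable_bex[OF assms(1) computable_Suc[OF assms(2)]] by (simp add: less_Suc_eq_le)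

lemma computable_cong:
  assumes "computable f" "\<And>x. f x = g x"
  shows "computable g"
proof -
  have "f = g" by (rule HOL.ext) (rule assms(2))
  with assms(1) show ?thesis by simp
qed

lemma decidable_cong:
  assumes "decidable P" "\<And>x. P x \<longleftrightarrow> Q x"
  shows "decidable Q"
proof -
  have "P = Q" by (rule HOL.ext) (rule assms(2))
  with assms(1) show ?thesis by simp
qed

subsection \<open>Arithmetic, prime exponents and lists\<close>

lemma computable_power [comp_intros]:
  assumes "computable f" "computable g"
  shows "computable (\<lambda>x. (f x :: nat) ^ g x)"
proof -
  have "computable (\<lambda>x. rec_nat 1 (\<lambda>k v. f x * v) (g x))"
    by (intro comp_intros computable_compose[OF assms(1)] assms(2))
  moreover have "rec_nat 1 (\<lambda>k v. m * v) n = m ^ n" for m n :: nat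
    by (induction n) auto
  ultimately show ?thesis by simp
qed

lemma decidable_dvd [comp_intros]:
  assumes "computable f" "computable g"
  shows "decidable (\<lambda>x. f x dvd (g x :: nat))"
proof (rule decidable_cong)
  show "decidable (\<lambda>x. \<exists>k\<le>g x. g x = f x * k)"
    by (intro comp_intros computable_compose[OF assms(1)] computable_compose[OF assms(2)])
  show "(\<exists>k\<le>g x. g x = f x * k) \<longleftrightarrow> f x dvd g x" for x
    by (cases "f x = 0") (auto simp: dvd_def)
qed

lemma computable_div [comp_intros]:
  assumes "computable f" "computable g"
  shows "computable (\<lambda>x. f x div (g x :: nat))"
proof (rule computable_cong)
  show "computable (\<lambda>x. if g x = 0 then 0 else LEAST k. g x = 0 \<or> f x < g x * Suc k)"
    by (intro comp_intros computable_Least computable_compose[OF assms(1)] computable_compose[OF assms(2)])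
      (metis dividend_less_times_div mult_Suc_right bot_nat_0.not_eq_extremum)
  show "(if g x = 0 then 0 else LEAST k. g x = 0 \<or> f x < g x * Suc k) = f x div g x" for x
  proof (cases "g x = 0")
    case False
    have "(LEAST k. f x < g x * Suc k) = f x div g x"
    proof (rule Least_equality)
      show "f x < g x * Suc (f x div g x)"
        using False dividend_less_times_div[of "g x" "f x"] by simp
      show "f x div g x \<le> k" if "f x < g x * Suc k" for k
        using that less_mult_imp_div_less[of "f x" "Suc k" "g x"] by (simp add: mult.commute)
    qed
    with False show ?thesis by simp
  qed simp
qed

lemma decidable_prime [comp_intros]:
  assumes "computable f"
  shows "decidable (\<lambda>x. prime (f x :: nat))"
proof (rule decidable_cong)
  show "decidable (\<lambda>x. 1 < f x \<and> (\<forall>m<Suc (f x). m dvd f x \<longrightarrow> m = 1 \<or> m = f x))"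
    by (intro comp_intros computable_compose[OF assms])
  show "1 < f x \<and> (\<forall>m<Suc (f x). m dvd f x \<longrightarrow> m = 1 \<or> m = f x) \<longleftrightarrow> prime (f x)" for x
    unfolding prime_nat_iff by (metis dvd_imp_le less_Suc_eq_le less_trans zero_less_one)
qed

lemma enumerate_primes_rec:
  "enumerate {p :: nat. prime p} i = rec_nat (LEAST q. prime q) (\<lambda>k v. LEAST q. prime q \<and> v < q) i"
proof (induction i)
  case 0
  then show ?case by (simp add: enumerate_0)
next
  case (Suc i)
  then show ?case
    by (simp add: enumerate_Suc''[OF primes_infinite] del: enumerate_Suc)
qed

lemma computable_nth_prime [comp_intros]:
  assumes "computable f"
  shows "computable (\<lambda>x. enumerate {p :: nat. prime p} (f x))"
proof -
  have "\<exists>q. prime q \<and> v < q" for v :: nat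
    using bigger_prime by auto
  then show ?thesis
    unfolding enumerate_primes_rec by (intro comp_intros computable_Least assms)
qed

lemma prime_enumerate: "prime (enumerate {p :: nat. prime p} i)"
  using enumerate_in_set[OF primes_infinite] by simp

lemma entry_0 [simp]: "entry 0 i = 0"
  by (simp add: entry_def)

text \<open>The disjunct \<open>s = 0\<close> keeps the search total and gives the number 0 its
  default entry 0.\<close>

lemma entry_eq_Least:
  "entry s i = (LEAST k. s = 0 \<or> \<not> enumerate {p. prime p} i ^ Suc k dvd s)"
proof (cases "s = 0")
  case False
  let ?p = "enumerate {p :: nat. prime p} i"
  have *: "?p ^ k dvd s \<longleftrightarrow> k \<le> multiplicity ?p s" for k
    using False prime_enumerate[of i] by (intro power_dvd_iff_le_multiplicity) auto
  have "(LEAST k. \<not> ?p ^ Suc k dvd s) = multiplicity ?p s"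
    unfolding * by (rule Least_equality) auto
  with False show ?thesis by (simp add: entry_def)
qed simp

lemma computable_entry [comp_intros]:
  assumes "computable f" "computable g"
  shows "computable (\<lambda>x. entry (f x) (g x))"
proof -
  have "\<exists>k. s = 0 \<or> \<not> enumerate {p. prime p} i ^ Suc k dvd s" for s i :: nat
  proof -
    have "s < enumerate {p. prime p} i ^ Suc s"
      using power_gt_expt[of "enumerate {p. prime p} i" "Suc s"] prime_gt_1_nat[OF prime_enumerate[of i]]
      by linarith
    then show ?thesis
      by (intro exI[of _ s]) (auto dest!: dvd_imp_le)
  qed
  then show ?thesis
    unfolding entry_eq_Least
    by (intro comp_intros computable_Least computable_compose[OF assms(1)] computable_compose[OF assms(2)])
qed

text \<open>The product of the powers of the i-th primes with exponents \<open>f i\<close>, for i <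
  L, has exactly these exponents, and exponent 0 at every other prime. Any finite table is thus a
  number, which is used wherever finitely many values or search results are packed.\<close>

lemma exists_entry: "\<exists>c. \<forall>n. entry c n = (if n < L then f n else 0)"
proof -
  let ?p = "enumerate {p :: nat. prime p}"
  let ?c = "\<Prod>i<L. ?p i ^ f i"
  have inj: "inj ?p"
    using primes_infinite strict_mono_enumerate strict_mono_imp_inj_on by blast
  have "entry ?c n = (if n < L then f n else 0)" for n
  proof -
    have "multiplicity (?p n) ?c = (\<Sum>i<L. multiplicity (?p n) (?p i ^ f i))"
    proof (rule prime_elem_multiplicity_prod_distrib)
      show "0 \<notin> (\<lambda>i. ?p i ^ f i) ` {..<L}"
      proof
        assume "0 \<in> (\<lambda>i. ?p i ^ f i) ` {..<L}"
        then obtain i where "0 = ?p i ^ f i" by (rule imageE)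
        then show False
          using prime_gt_0_nat[OF prime_enumerate, of i] by simp
      qed
    qed (use prime_enumerate[of n] in auto)
    also have "\<dots> = (\<Sum>i<L. if i = n then f n else 0)"
    proof (rule sum.cong)
      fix i
      show "multiplicity (?p n) (?p i ^ f i) = (if i = n then f n else 0)"
      proof (cases "i = n")
        case True
        then show ?thesis using prime_enumerate[of n] by (simp add: multiplicity_same_power)
      next
        case False
        then have "?p i \<noteq> ?p n" using inj by (auto dest: injD)
        then show ?thesis using False prime_enumerate by (simp add: multiplicity_distinct_prime_power)
      qed
    qed simp
    finally show ?thesis by (simp add: entry_def)
  qed
  then show ?thesis by blast
qed

lemma exists_entry_prefix: "\<exists>c. \<forall>n<L. entry c n = f n"
proof -
  obtain c where "\<forall>n. entry c n = (if n < L then f n else 0)"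
    using exists_entry by blast
  then show ?thesis by (intro exI[of _ c]) simp
qed

text \<open>The n-th prime, counted from 0, exceeds n, so it cannot divide a positive s \<le> n.
  This bounds the support of \<open>entry s\<close> and reduces the comparison of two dense points
  of \<open>baire\<close> to finitely many places.\<close>

lemma entry_eq_0: "s \<le> n \<Longrightarrow> entry s n = 0"
proof (cases "s = 0")
  case False
  assume "s \<le> n"
  have "n < enumerate {p :: nat. prime p} n"
  proof (induction n)
    case 0
    then show ?case using prime_gt_0_nat[OF prime_enumerate[of 0]] by simp
  next
    case (Suc n)
    then show ?case using enumerate_step[OF primes_infinite, of n] by simp
  qed
  with \<open>s \<le> n\<close> have "\<not> enumerate {p. prime p} n dvd s"
    using False by (auto dest: dvd_imp_le)
  then show ?thesis by (simp add: entry_def not_dvd_imp_multiplicity_0)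
qed simp

text \<open>Numbers serve as names of points of product spaces and of balls through their entries.\<close>

definition tuple2 :: "nat \<Rightarrow> nat \<Rightarrow> nat" where
  "tuple2 a b = (LEAST s. entry s 0 = a \<and> entry s 1 = b)"

definition tuple3 :: "nat \<Rightarrow> nat \<Rightarrow> nat \<Rightarrow> nat" where
  "tuple3 a b c = (LEAST s. entry s 0 = a \<and> entry s 1 = b \<and> entry s 2 = c)"

lemma exists_tuple3: "\<exists>s. entry s 0 = a \<and> entry s 1 = b \<and> entry s 2 = c"
proof -
  obtain s where "\<forall>n<3. entry s n = (if n = 0 then a else if n = 1 then b else c)"
    using exists_entry_prefix[of 3 "\<lambda>n. if n = 0 then a else if n = 1 then b else c"] by blast
  then show ?thesis by (intro exI[of _ s]) simp
qed

lemma exists_tuple2: "\<exists>s. entry s 0 = a \<and> entry s 1 = b"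
  using exists_tuple3 by blast

lemma entry_tuple2 [simp]: "entry (tuple2 a b) 0 = a" "entry (tuple2 a b) (Suc 0) = b"
  using LeastI_ex[OF exists_tuple2[of a b]] unfolding tuple2_def by auto

lemma entry_tuple3 [simp]: "entry (tuple3 a b c) 0 = a" "entry (tuple3 a b c) (Suc 0) = b"
  "entry (tuple3 a b c) 2 = c"
  using LeastI_ex[OF exists_tuple3[of a b c]] unfolding tuple3_def by auto

lemma computable_tuple2 [comp_intros]:
  "computable f \<Longrightarrow> computable g \<Longrightarrow> computable (\<lambda>x. tuple2 (f x) (g x))"
  unfolding tuple2_def
  by (rule computable_compose2) (intro computable_Least exists_tuple2 comp_intros)

lemma computable_tuple3 [comp_intros]:
  "computable f \<Longrightarrow> computable g \<Longrightarrow> computable h \<Longrightarrow> computable (\<lambda>x. tuple3 (f x) (g x) (h x))"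
  unfolding tuple3_def
  by (rule computable_compose3) (intro computable_Least exists_tuple3 comp_intros)

section \<open>Lists through their codes\<close>

lemma enc_Nil [simp]: "enc [] = 0"
  and enc_Cons: "enc (x # xs) = Suc (enc (x, enc xs))"
  by (simp_all add: enc_list enc_prod)

lemma computable_Cons [comp_intros]:
  assumes "computable f" "computable g"
  shows "computable (\<lambda>x. f x # g x)"
proof (rule computable_cong)
  show "computable (\<lambda>x. dec (Suc (enc (f x, enc (g x)))))"
    using assms by (intro comp_intros)
qed (simp flip: enc_Cons)

lemma computable_hd [comp_intros]:
  fixes f :: "'a::coded \<Rightarrow> 'b::coded list"
  assumes "computable f"
  shows "computable (\<lambda>x. hd (f x))"
proof (rule computable_cong)
  show "computable (\<lambda>x. if f x = [] then hd [] else fst (dec (enc (f x) - 1) :: 'b \<times> nat))"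
    using assms by (intro comp_intros)
  show "(if f x = [] then hd [] else fst (dec (enc (f x) - 1) :: 'b \<times> nat)) = hd (f x)" for x
    by (cases "f x") (auto simp: enc_Cons)
qed

lemma computable_tl [comp_intros]:
  fixes f :: "'a::coded \<Rightarrow> 'b::coded list"
  assumes "computable f"
  shows "computable (\<lambda>x. tl (f x))"
proof (rule computable_cong)
  show "computable (\<lambda>x. if f x = [] then [] else dec (snd (dec (enc (f x) - 1) :: 'b \<times> nat)))"
    using assms by (intro comp_intros)
  show "(if f x = [] then [] else dec (snd (dec (enc (f x) - 1) :: 'b \<times> nat))) = tl (f x)" for x
    by (cases "f x") (auto simp: enc_Cons)
qed

lemma computable_drop [comp_intros]:
  fixes f :: "'a::coded \<Rightarrow> nat" and g :: "'a \<Rightarrow> 'b::coded list"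
  assumes "computable f" "computable g"
  shows "computable (\<lambda>x. drop (f x) (g x))"
proof -
  have "computable (\<lambda>x. rec_nat (g x) (\<lambda>k v. tl v) (f x))"
    using assms by (intro comp_intros)
  moreover have "rec_nat xs (\<lambda>k v. tl v) n = drop n xs" for n and xs :: "'b list"
    by (induction n) (auto simp: drop_Suc tl_drop)
  ultimately show ?thesis by simp
qed

lemma computable_length [comp_intros]:
  assumes "computable (f :: 'a::coded \<Rightarrow> 'b::coded list)"
  shows "computable (\<lambda>x. length (f x))"
proof -
  have "computable (\<lambda>x. LEAST n. drop n (f x) = [])"
    by (intro computable_Least comp_intros computable_compose[OF assms]) auto
  moreover have "(LEAST n. drop n xs = []) = length xs" for xs :: "'b list"
    by (rule Least_equality) auto
  ultimately show ?thesis by simp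
qed

subsection \<open>Semirecursive relations\<close>

definition semirec :: "('a::coded \<Rightarrow> bool) \<Rightarrow> bool" where
  "semirec P \<longleftrightarrow> (\<exists>Q :: 'a \<times> nat \<Rightarrow> bool. decidable Q \<and> (\<forall>x. P x \<longleftrightarrow> (\<exists>n. Q (x, n))))"

named_theorems semirec_intros

lemma semirec_cong:
  assumes "semirec P" "\<And>x. P x \<longleftrightarrow> Q x"
  shows "semirec Q"
proof -
  have "P = Q" by (rule HOL.ext) (rule assms(2))
  with assms(1) show ?thesis by simp
qed

lemma semirecI: "decidable Q \<Longrightarrow> (\<And>x. P x \<longleftrightarrow> (\<exists>n :: nat. Q (x, n))) \<Longrightarrow> semirec P"
  unfolding semirec_def by blast

lemma decidable_semirec: "decidable P \<Longrightarrow> semirec P"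
  by (rule semirecI[of "\<lambda>p. P (fst p)"]) (simp_all add: decidable_compose comp_intros)

lemma semirec_compose: 
  assumes "semirec P" "computable f"
  shows "semirec (\<lambda>x. P (f x))"
proof -
  obtain Q where Q: "decidable Q" "\<And>x. P x \<longleftrightarrow> (\<exists>n :: nat. Q (x, n))"
    using assms(1) unfolding semirec_def by blast
  have "decidable (\<lambda>p. Q (f (fst p), snd p))"
    by (intro decidable_compose[OF Q(1)] comp_intros computable_compose[OF assms(2)])
  then show ?thesis
    by (rule semirecI) (simp add: Q(2))
qed

lemma semirec_compose2:
  assumes "semirec (\<lambda>p. P (fst p) (snd p))" "computable f" "computable g"
  shows "semirec (\<lambda>x. P (f x) (g x))"
  using semirec_compose[OF assms(1) computable_Pair[OF assms(2,3)]] by simp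

lemma semirec_ex [semirec_intros]:
  fixes P :: "'a::coded \<Rightarrow> 'b::coded \<Rightarrow> bool"
  assumes "semirec (\<lambda>p. P (fst p) (snd p))"
  shows "semirec (\<lambda>x. \<exists>y. P x y)"
proof -
  obtain Q where Q: "decidable Q" "\<And>x. P (fst x) (snd x) \<longleftrightarrow> (\<exists>n :: nat. Q (x, n))"
    using assms(1) unfolding semirec_def by blast
  let ?Q = "\<lambda>p. Q ((fst p, fst (dec (snd p) :: 'b \<times> nat)), snd (dec (snd p) :: 'b \<times> nat))"
  have "decidable ?Q"
    by (intro decidable_compose[OF Q(1)] comp_intros)
  moreover have "(\<exists>y. P x y) \<longleftrightarrow> (\<exists>n. ?Q (x, n))" for x
    using ex_dec[of "\<lambda>p :: 'b \<times> nat. Q ((x, fst p), snd p)"] Q(2)[of "(x, _)"] by simp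
  ultimately show ?thesis
    by (rule semirecI)
qed

lemma semirec_conj [semirec_intros]:
  assumes "semirec P" "semirec P'"
  shows "semirec (\<lambda>x. P x \<and> P' x)"
proof -
  obtain Q where Q: "decidable Q" "\<And>x. P x \<longleftrightarrow> (\<exists>n :: nat. Q (x, n))"
    using assms(1) unfolding semirec_def by blast
  obtain Q' where Q': "decidable Q'" "\<And>x. P' x \<longleftrightarrow> (\<exists>n :: nat. Q' (x, n))"
    using assms(2) unfolding semirec_def by blast
  have "semirec (\<lambda>x. \<exists>n m. Q (x, n) \<and> Q' (x, m))"
    by (intro semirec_ex decidable_semirec comp_intros decidable_compose[OF Q(1)] decidable_compose[OF Q'(1)])
  then show ?thesis
    by (rule semirec_cong) (auto simp: Q(2) Q'(2))
qed

lemma semirec_disj [semirec_intros]: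
  assumes "semirec P" "semirec P'"
  shows "semirec (\<lambda>x. P x \<or> P' x)"
proof -
  obtain Q where Q: "decidable Q" "\<And>x. P x \<longleftrightarrow> (\<exists>n :: nat. Q (x, n))"
    using assms(1) unfolding semirec_def by blast
  obtain Q' where Q': "decidable Q'" "\<And>x. P' x \<longleftrightarrow> (\<exists>n :: nat. Q' (x, n))"
    using assms(2) unfolding semirec_def by blast
  have "semirec (\<lambda>x. \<exists>n m. Q (x, n) \<or> Q' (x, m))"
    by (intro semirec_ex decidable_semirec comp_intros decidable_compose[OF Q(1)] decidable_compose[OF Q'(1)])
  then show ?thesis
    by (rule semirec_cong) (auto simp: Q(2) Q'(2))
qed

text \<open>The finitely many search results, one for each y < f x, are packed as the entries of a
  single number w.\<close>

lemma semirec_ball [semirec_intros]: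
  assumes "semirec (\<lambda>p. P (fst p) (snd p))" "computable f"
  shows "semirec (\<lambda>x. \<forall>y<f x. P x (y :: nat))"
proof -
  obtain Q where "decidable Q" "\<And>x. P (fst x) (snd x) \<longleftrightarrow> (\<exists>n :: nat. Q (x, n))"
    using assms(1) unfolding semirec_def by blast
  from this(1) this(2)[of "(_, _)"]
  have Q: "decidable Q" "\<And>x y. P x y \<longleftrightarrow> (\<exists>n. Q ((x, y), n))" by simp_all
  have "semirec (\<lambda>x. \<exists>w. \<forall>y<f x. Q ((x, y), entry w y))"
    by (intro semirec_ex decidable_semirec comp_intros decidable_compose[OF Q(1)] computable_compose[OF assms(2)])
  moreover have "(\<exists>w. \<forall>y<f x. Q ((x, y), entry w y)) \<longleftrightarrow> (\<forall>y<f x. P x y)" for x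
  proof
    assume "\<forall>y<f x. P x y"
    then obtain n where "\<And>y. y < f x \<Longrightarrow> Q ((x, y), n y)"
      unfolding Q(2) by metis
    then show "\<exists>w. \<forall>y<f x. Q ((x, y), entry w y)"
      using exists_entry_prefix[of "f x" n] by metis
  qed (auto simp: Q(2))
  ultimately show ?thesis by simp
qed

text \<open>The search runs over pairs of a value and a step that confirms it. It ends because f is
  total, and only the value is kept.\<close>

lemma computable_graph:
  fixes f :: "'a::coded \<Rightarrow> 'b::coded"
  assumes "semirec (\<lambda>p. f (fst p) = snd p)"
  shows "computable f"
proof -
  obtain Q where "decidable Q" "\<And>x. f (fst x) = snd x \<longleftrightarrow> (\<exists>n :: nat. Q (x, n))"
    using assms unfolding semirec_def by blast
  from this(1) this(2)[of "(_, _)"]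
  have Q: "decidable Q" "\<And>x y. f x = y \<longleftrightarrow> (\<exists>n. Q ((x, y), n))" by simp_all
  let ?Q = "\<lambda>x m. Q ((x, fst (dec m :: 'b \<times> nat)), snd (dec m :: 'b \<times> nat))"
  have ex: "\<exists>m. ?Q x m" for x
    using ex_dec[of "\<lambda>p :: 'b \<times> nat. Q ((x, fst p), snd p)"] Q(2)[of x "f x"] by auto
  have "computable (\<lambda>x. fst (dec (LEAST m. ?Q x m) :: 'b \<times> nat))"
    by (intro comp_intros computable_Least ex decidable_compose[OF Q(1)])
  moreover have "fst (dec (LEAST m. ?Q x m) :: 'b \<times> nat) = f x" for x
    using LeastI_ex[OF ex[of x]] Q(2)[of x "fst (dec (LEAST m. ?Q x m))"] by auto
  ultimately show ?thesis by simp
qed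

text \<open>A run along the list is recorded in one number w: \<open>entry w 0\<close> codes a value
  for the whole list and \<open>entry w i\<close> one for \<open>drop i s\<close>, down to the empty
  list. K is a relation rather than a function so that u can range over the finite segments of an
  infinite object.\<close>

lemma semirec_list_iteration:
  fixes K :: "'a::coded list \<Rightarrow> 'b::coded \<Rightarrow> bool"
  assumes K0: "semirec (K [])" and T: "semirec T"
    and step: "\<And>j s u. K (j # s) u \<longleftrightarrow> (\<exists>v. K s v \<and> T (v, j, u))"
  shows "semirec (\<lambda>p. K (fst p) (snd p))"
proof -
  let ?R = "\<lambda>s u w. K [] (dec (entry w (length s))) \<and> dec (entry w 0) = u \<and>
      (\<forall>i<length s. T (dec (entry w (Suc i)), hd (drop i s), dec (entry w i)))"
  have K_eq: "K s u \<longleftrightarrow> (\<exists>w. ?R s u w)" for s u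
  proof (induction s arbitrary: u)
    case Nil
    have "\<exists>w. entry w 0 = enc u"
      using exists_entry_prefix[of 1 "\<lambda>_. enc u"] by auto
    then show ?case by (auto, metis dec_enc)
  next
    case (Cons j s)
    show ?case
    proof
      assume "K (j # s) u"
      then obtain v w where v: "?R s v w" "T (v, j, u)"
        unfolding step Cons by blast
      obtain w' where w': "\<forall>i<Suc (Suc (length s)). entry w' i = (case i of 0 \<Rightarrow> enc u | Suc i \<Rightarrow> entry w i)"
        using exists_entry_prefix[of "Suc (Suc (length s))" "\<lambda>i. case i of 0 \<Rightarrow> enc u | Suc i \<Rightarrow> entry w i"]
        by blast
      have "entry w' 0 = enc u" "\<And>i. i \<le> length s \<Longrightarrow> entry w' (Suc i) = entry w i"
        using w' by auto
      then have "?R (j # s) u w'"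
        using v by (auto simp: less_Suc_eq_0_disj simp del: ex_simps all_simps)
      then show "\<exists>w. ?R (j # s) u w" by blast
    next
      assume "\<exists>w. ?R (j # s) u w"
      then obtain w where w: "?R (j # s) u w" by blast
      obtain w' where w': "\<forall>i<Suc (length s). entry w' i = entry w (Suc i)"
        using exists_entry_prefix[of "Suc (length s)" "\<lambda>i. entry w (Suc i)"] by blast
      have T: "T (dec (entry w (Suc i)), hd (drop i (j # s)), dec (entry w i))" if "i < length (j # s)" for i
        using w that by blast
      have w'_eq: "entry w' i = entry w (Suc i)" if "i \<le> length s" for i
        using w' that by auto
      have "T (dec (entry w' (Suc i)), hd (drop i s), dec (entry w' i))" if "i < length s" for i
        using T[of "Suc i"] that w'_eq[of i] w'_eq[of "Suc i"] by simp
      moreover have "K [] (dec (entry w' (length s)))"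
        using w w'_eq[of "length s"] by simp
      ultimately have "?R s (dec (entry w 1)) w'"
        using w'_eq[of 0] by simp
      moreover have "T (dec (entry w 1), j, u)"
        using T[of 0] w by auto
      ultimately
      show "K (j # s) u"
        unfolding step Cons by blast
    qed
  qed
  have "semirec (\<lambda>p. \<exists>w. ?R (fst p) (snd p) w)"
    by (intro semirec_intros semirec_compose[OF K0] semirec_compose[OF T] comp_intros decidable_semirec)
  then show ?thesis
    by (rule semirec_cong) (rule K_eq[symmetric])
qed


subsection \<open>Effectively open relations on Baire space\<close>

definition agrees :: "(nat \<Rightarrow> nat) \<Rightarrow> nat \<Rightarrow> nat \<Rightarrow> bool" where
  "agrees y c L \<longleftrightarrow> (\<forall>n<L. y n = entry c n)"

text \<open>This plays the part of \<open>Sigma01\<close> on products of \<open>baire\<close> with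
  discrete data, free of metrics: y is a bare sequence and x has any coded type. The translations
  are \<open>eopen_Sigma01\<close> and \<open>Sigma01_cylinders\<close>.\<close>

definition eopen :: "((nat \<Rightarrow> nat) \<Rightarrow> 'a::coded \<Rightarrow> bool) \<Rightarrow> bool" where
  "eopen P \<longleftrightarrow> (\<exists>T :: nat \<times> nat \<times> 'a \<Rightarrow> bool. semirec T \<and>
     (\<forall>y x. P y x \<longleftrightarrow> (\<exists>c L. agrees y c L \<and> T (c, L, x))))"

named_theorems eopen_intros

lemma eopenI:
  assumes "semirec T" "\<And>y x. P y x \<longleftrightarrow> (\<exists>c L. agrees y c L \<and> T (c, L, x))"
  shows "eopen P"
  using assms unfolding eopen_def by blast

lemma eopen_cong:
  assumes "eopen P" "\<And>y x. P y x \<longleftrightarrow> Q y x"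
  shows "eopen Q"
proof -
  have "P = Q" by (intro HOL.ext) (rule assms(2))
  with assms(1) show ?thesis by simp
qed

lemma exists_agrees: "\<exists>c. agrees y c L"
  unfolding agrees_def using exists_entry_prefix[of L y] by (simp add: eq_commute)

lemma agrees_weaken: "agrees y c L \<Longrightarrow> L' \<le> L \<Longrightarrow> agrees (entry c) c' L' \<longleftrightarrow> agrees y c' L'"
  by (auto simp: agrees_def)

lemma decidable_agrees [comp_intros]:
  assumes "computable f" "computable g" "computable (\<lambda>p. h (fst p) (snd p))"
  shows "decidable (\<lambda>x. agrees (h x) (f x) (g x))"
  unfolding agrees_def
  by (intro comp_intros assms computable_compose[OF assms(1)])

lemma eopen_semirec: "semirec P \<Longrightarrow> eopen (\<lambda>y. P)"
proof (rule eopenI)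
  show "semirec (\<lambda>p. P (snd (snd p)))" if "semirec P"
    by (intro semirec_compose[OF that] comp_intros)
qed (auto simp: agrees_def)

lemmas eopen_decidable = eopen_semirec[OF decidable_semirec]

lemma eopen_value [eopen_intros]:
  assumes "computable f" "computable g"
  shows "eopen (\<lambda>y x. y (f x) = g x)"
proof (rule eopenI)
  show "semirec (\<lambda>p. f (snd (snd p)) < fst (snd p) \<and> entry (fst p) (f (snd (snd p))) = g (snd (snd p)))"
    by (intro decidable_semirec comp_intros computable_compose[OF assms(1)] computable_compose[OF assms(2)])
  fix y x
  obtain c where "agrees y c (Suc (f x))" using exists_agrees by blast
  moreover from this have "y (f x) = entry c (f x)" by (simp add: agrees_def)
  ultimately have "\<exists>c L. agrees y c L \<and> f x < L \<and> entry c (f x) = g x" if "y (f x) = g x"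
    using that by (metis lessI)
  then show "y (f x) = g x \<longleftrightarrow> (\<exists>c L. agrees y c L \<and>
      f (snd (snd (c, L, x))) < fst (snd (c, L, x)) \<and>
      entry (fst (c, L, x)) (f (snd (snd (c, L, x)))) = g (snd (snd (c, L, x))))"
    by (auto simp: agrees_def)
qed

lemma eopen_compose:
  assumes "eopen P" "computable h"
  shows "eopen (\<lambda>y x. P y (h x))"
proof -
  obtain T where T: "semirec T" "\<And>y x. P y x \<longleftrightarrow> (\<exists>c L. agrees y c L \<and> T (c, L, x))"
    using assms(1) unfolding eopen_def by blast
  show ?thesis
    by (rule eopenI[of "\<lambda>p. T (fst p, fst (snd p), h (snd (snd p)))"])
      (intro semirec_compose[OF T(1)] comp_intros computable_compose[OF assms(2)], simp add: T(2))
qed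

lemma eopen_compose2:
  assumes "eopen (\<lambda>y p. P y (fst p) (snd p))" "computable f" "computable g"
  shows "eopen (\<lambda>y x. P y (f x) (g x))"
  using eopen_compose[OF assms(1) computable_Pair[OF assms(2,3)]] by simp

lemma eopen_ex [eopen_intros]:
  fixes P :: "(nat \<Rightarrow> nat) \<Rightarrow> 'a::coded \<Rightarrow> 'b::coded \<Rightarrow> bool"
  assumes "eopen (\<lambda>y p. P y (fst p) (snd p))"
  shows "eopen (\<lambda>y x. \<exists>z. P y x z)"
proof -
  obtain T where T: "semirec T"
    "\<And>y p. P y (fst p) (snd p) \<longleftrightarrow> (\<exists>c L. agrees y c L \<and> T (c, L, p))"
    using assms unfolding eopen_def by blast
  have "semirec (\<lambda>p. \<exists>z. T (fst p, fst (snd p), (snd (snd p), z)))"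
    by (intro semirec_intros semirec_compose[OF T(1)] comp_intros)
  then show ?thesis
  proof (rule eopenI)
    show "(\<exists>z. P y x z) \<longleftrightarrow> (\<exists>c L. agrees y c L \<and>
       (\<exists>z. T (fst (c, L, x), fst (snd (c, L, x)), (snd (snd (c, L, x)), z))))" for y x
      using T(2)[of y "(x, _)"] by auto
  qed
qed

lemma eopen_disj [eopen_intros]:
  fixes P Q :: "(nat \<Rightarrow> nat) \<Rightarrow> 'a::coded \<Rightarrow> bool"
  assumes "eopen P" "eopen Q"
  shows "eopen (\<lambda>y x. P y x \<or> Q y x)"
proof -
  obtain T where T: "semirec T" "\<And>y x. P y x \<longleftrightarrow> (\<exists>c L. agrees y c L \<and> T (c, L, x))"
    using assms(1) unfolding eopen_def by blast
  obtain U where U: "semirec U" "\<And>y x. Q y x \<longleftrightarrow> (\<exists>c L. agrees y c L \<and> U (c, L, x))"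
    using assms(2) unfolding eopen_def by blast
  show ?thesis
    by (rule eopenI[of "\<lambda>p. T p \<or> U p"]) (intro semirec_intros T(1) U(1), auto simp: T(2) U(2))
qed

lemma eopen_ball [eopen_intros]:
  fixes P :: "(nat \<Rightarrow> nat) \<Rightarrow> 'a::coded \<Rightarrow> nat \<Rightarrow> bool"
  assumes "eopen (\<lambda>y p. P y (fst p) (snd p))" "computable f"
  shows "eopen (\<lambda>y x. \<forall>z<f x. P y x z)"
proof -
  obtain T where T: "semirec T"
    "\<And>y p. P y (fst p) (snd p) \<longleftrightarrow> (\<exists>c L. agrees y c L \<and> T (c, L, p))"
    using assms unfolding eopen_def by blast
  let ?T = "\<lambda>p. \<forall>z<f (snd (snd p)). \<exists>c L. L \<le> fst (snd p) \<and> agrees (entry (fst p)) c L \<and>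
      T (c, L, (snd (snd p), z))"
  have "semirec ?T"
    by (intro semirec_intros semirec_compose[OF T(1)] comp_intros computable_compose[OF assms(2)]
        decidable_semirec)
  then show ?thesis
  proof (rule eopenI)
    fix y x
    show "(\<forall>z<f x. P y x z) \<longleftrightarrow> (\<exists>c L. agrees y c L \<and> ?T (c, L, x))"
    proof
      assume "\<forall>z<f x. P y x z"
      then have "\<forall>z<f x. \<exists>c L. agrees y c L \<and> T (c, L, (x, z))"
        using T(2)[of y "(x, _)"] by simp
      then obtain c L where cL: "\<And>z. z < f x \<Longrightarrow> agrees y (c z) (L z) \<and> T (c z, L z, (x, z))"
        by metis
      \<comment> \<open>A common length for the segments used by all z < f x; the sum is merely a
        convenient upper bound.\<close>
      define M where "M = (\<Sum>z<f x. L z)"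
      have M: "L z \<le> M" if "z < f x" for z
        unfolding M_def using that by (intro member_le_sum) auto
      obtain d where d: "agrees y d M" using exists_agrees by blast
      have "\<exists>c L. L \<le> M \<and> agrees (entry d) c L \<and> T (c, L, (x, z))" if "z < f x" for z
        using cL[OF that] M[OF that] agrees_weaken[OF d M[OF that], of "c z"] by blast
      then have "?T (d, M, x)" by simp
      with d show "\<exists>c L. agrees y c L \<and> ?T (c, L, x)" by blast
    next
      assume "\<exists>c L. agrees y c L \<and> ?T (c, L, x)"
      then obtain d M where d: "agrees y d M" "?T (d, M, x)" by blast
      show "\<forall>z<f x. P y x z"
      proof (intro allI impI)
        fix z assume "z < f x"
        then obtain c L where "L \<le> M" "agrees (entry d) c L" "T (c, L, (x, z))"
          using d(2) by auto
        then show "P y x z"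
          using T(2)[of y "(x, z)"] agrees_weaken[OF d(1), of L c] by auto
      qed
    qed
  qed
qed

text \<open>A conjunction is a universal quantifier over two indices, so the merging of segments
  need not be repeated.\<close>

lemma eopen_conj [eopen_intros]:
  fixes P Q :: "(nat \<Rightarrow> nat) \<Rightarrow> 'a::coded \<Rightarrow> bool"
  assumes "eopen P" "eopen Q"
  shows "eopen (\<lambda>y x. P y x \<and> Q y x)"
proof (rule eopen_cong)
  show "eopen (\<lambda>y x. \<forall>z<2 :: nat. z = 0 \<and> P y x \<or> z = 1 \<and> Q y x)"
  proof (rule eopen_ball)
    \<comment> \<open>A condition on the discrete argument alone can be added to T directly, without
      merging segments.\<close>
    have *: "eopen (\<lambda>y (p :: 'a \<times> nat). snd p = k \<and> R y (fst p))"
      if R: "eopen R" for R :: "(nat \<Rightarrow> nat) \<Rightarrow> 'a \<Rightarrow> bool" and k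
    proof -
      obtain T where T: "semirec T" "\<And>y x. R y x \<longleftrightarrow> (\<exists>c L. agrees y c L \<and> T (c, L, x))"
        using R unfolding eopen_def by blast
      show ?thesis
        by (rule eopenI[of "\<lambda>p. snd (snd (snd p)) = k \<and> T (fst p, fst (snd p), fst (snd (snd p)))"])
          (intro semirec_intros semirec_compose[OF T(1)] comp_intros decidable_semirec, auto simp: T(2))
    qed
    show "eopen (\<lambda>y (p :: 'a \<times> nat). snd p = 0 \<and> P y (fst p) \<or> snd p = 1 \<and> Q y (fst p))"
      by (intro eopen_disj * assms)
  qed (rule computable_const)
qed (auto simp: numeral_2_eq_2 less_Suc_eq all_conj_distrib)

lemma eopen_bex [eopen_intros]:
  fixes P :: "(nat \<Rightarrow> nat) \<Rightarrow> 'a::coded \<Rightarrow> nat \<Rightarrow> bool"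
  assumes "eopen (\<lambda>y p. P y (fst p) (snd p))" "computable f"
  shows "eopen (\<lambda>y x. \<exists>z<f x. P y x z)"
  by (intro eopen_intros eopen_decidable comp_intros assms computable_compose[OF assms(2)])

text \<open>An open condition on the sequence \<open>F y x\<close> inspects only finitely many of
  its values, and each value is an open condition on y.\<close>

lemma eopen_subst:
  fixes P :: "(nat \<Rightarrow> nat) \<Rightarrow> 'a::coded \<Rightarrow> bool"
  assumes "eopen P" "eopen (\<lambda>y p. F y (fst p) (fst (snd p)) = snd (snd p))"
  shows "eopen (\<lambda>y x. P (F y x) x)"
proof -
  obtain T where T: "semirec T" "\<And>y x. P y x \<longleftrightarrow> (\<exists>c L. agrees y c L \<and> T (c, L, x))"
    using assms(1) unfolding eopen_def by blast
  have *: "eopen (\<lambda>y z. F y (f z) (g z) = h z)"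
    if "computable f" "computable g" "computable h" for f :: "'b::coded \<Rightarrow> 'a" and g h
    using eopen_compose[OF assms(2) computable_Pair[OF that(1) computable_Pair[OF that(2,3)]]] by simp
  show ?thesis
    unfolding T(2) agrees_def
    by (intro eopen_intros * comp_intros eopen_semirec[OF semirec_compose[OF T(1)]])
qed

lemma semirec_subst:
  assumes "eopen P" "computable (\<lambda>p. a (fst p) (snd p))"
  shows "semirec (\<lambda>x. P (a x) x)"
proof -
  obtain T where T: "semirec T" "\<And>y x. P y x \<longleftrightarrow> (\<exists>c L. agrees y c L \<and> T (c, L, x))"
    using assms(1) unfolding eopen_def by blast
  show ?thesis
    unfolding T(2) 
    by (intro semirec_intros semirec_compose[OF T(1)] comp_intros decidable_semirec
       computable_compose2[OF assms(2)])
qed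

text \<open>Segments get positive length because the ball of \<open>baire\<close> with index
  \<open>tuple3 c 1 L\<close> has radius \<open>1 / (L + 1)\<close> and fixes \<open>Suc L\<close>
  values.\<close>

lemma eopenE_Suc:
  fixes P :: "(nat \<Rightarrow> nat) \<Rightarrow> 'a::coded \<Rightarrow> bool"
  assumes "eopen P"
  obtains T :: "nat \<times> nat \<times> 'a \<Rightarrow> bool" where "semirec T"
    "\<And>y x. P y x \<longleftrightarrow> (\<exists>c L. agrees y c (Suc L) \<and> T (c, L, x))"
proof -
  obtain T where T: "semirec T" "\<And>y x. P y x \<longleftrightarrow> (\<exists>c L. agrees y c L \<and> T (c, L, x))"
    using assms(1) unfolding eopen_def by blast
  let ?T = "\<lambda>p. \<exists>c L. L \<le> Suc (fst (snd p)) \<and> agrees (entry (fst p)) c L \<and> T (c, L, snd (snd p))"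
  show thesis
  proof (rule that)
    show "semirec ?T"
      by (intro semirec_intros semirec_compose[OF T(1)] comp_intros decidable_semirec)
    fix y x
    show "P y x \<longleftrightarrow> (\<exists>c L. agrees y c (Suc L) \<and> ?T (c, L, x))"
    proof
      assume "P y x"
      then obtain c L where cL: "agrees y c L" "T (c, L, x)" unfolding T(2) by blast
      obtain d where d: "agrees y d (Suc L)" using exists_agrees by blast
      then have "agrees (entry d) c L"
        using cL(1) by (simp add: agrees_weaken)
      with cL(2) have "L \<le> Suc L \<and> agrees (entry d) c L \<and> T (c, L, x)" by simp
      then have "\<exists>c M. M \<le> Suc L \<and> agrees (entry d) c M \<and> T (c, M, x)" by blast
      then have "?T (d, L, x)" by simp
      with d show "\<exists>c L. agrees y c (Suc L) \<and> ?T (c, L, x)" by blast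
    next
      assume "\<exists>c L. agrees y c (Suc L) \<and> ?T (c, L, x)"
      then obtain d M c L where d: "agrees y d (Suc M)" "L \<le> Suc M"
        and c: "agrees (entry d) c L" "T (c, L, x)"
        by auto
      from c show "P y x"
        unfolding T(2) agrees_weaken[OF d] by blast
    qed
  qed
qed

section \<open>Effectively clopen relations, which negation preserves\<close>

definition edec :: "((nat \<Rightarrow> nat) \<Rightarrow> 'a::coded \<Rightarrow> bool) \<Rightarrow> bool" where
  "edec P \<longleftrightarrow> eopen P \<and> eopen (\<lambda>y x. \<not> P y x)"

named_theorems edec_intros

lemma edec_eopen: "edec P \<Longrightarrow> eopen P"
  by (simp add: edec_def)

lemma edec_not [edec_intros]: "edec P \<Longrightarrow> edec (\<lambda>y x. \<not> P y x)"
  by (simp add: edec_def)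

lemma edec_decidable: "decidable P \<Longrightarrow> edec (\<lambda>y. P)"
  unfolding edec_def by (intro conjI eopen_decidable comp_intros)

lemma edec_value [edec_intros]:
  assumes "computable f" "computable g"
  shows "edec (\<lambda>y x. y (f x) = g x)"
proof -
  have "eopen (\<lambda>y x. \<exists>v. y (f x) = v \<and> v \<noteq> g x)"
    by (intro eopen_intros eopen_decidable comp_intros computable_compose[OF assms(1)] computable_compose[OF assms(2)])
  moreover have "eopen (\<lambda>y x. y (f x) = g x)"
    using assms by (intro eopen_intros)
  ultimately show ?thesis by (simp add: edec_def)
qed

lemma edec_conj [edec_intros]: "edec P \<Longrightarrow> edec Q \<Longrightarrow> edec (\<lambda>y x. P y x \<and> Q y x)"
  unfolding edec_def de_Morgan_conj by (intro conjI eopen_intros) simp_all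

lemma edec_disj [edec_intros]: "edec P \<Longrightarrow> edec Q \<Longrightarrow> edec (\<lambda>y x. P y x \<or> Q y x)"
  unfolding edec_def de_Morgan_disj by (intro conjI eopen_intros) simp_all

lemma edec_imp [edec_intros]: "edec P \<Longrightarrow> edec Q \<Longrightarrow> edec (\<lambda>y x. P y x \<longrightarrow> Q y x)"
  unfolding imp_conv_disj by (intro edec_intros)

lemma edec_ball [edec_intros]:
  fixes P :: "(nat \<Rightarrow> nat) \<Rightarrow> 'a::coded \<Rightarrow> nat \<Rightarrow> bool"
  assumes "edec (\<lambda>y p. P y (fst p) (snd p))" "computable f"
  shows "edec (\<lambda>y x. \<forall>z<f x. P y x z)"
proof -
  from assms(1) have P: "eopen (\<lambda>y p. P y (fst p) (snd p))" "eopen (\<lambda>y p. \<not> P y (fst p) (snd p))"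
    by (simp_all add: edec_def)
  show ?thesis
    using eopen_ball[OF P(1) assms(2)] eopen_bex[OF P(2) assms(2)] by (simp add: edec_def)
qed


section \<open>The basic spaces\<close>

lemma seq_dist_self [simp]: "seq_dist (Pt_seq a) (Pt_seq a) = 0"
  by simp

lemma seq_dist_ge:
  assumes "a N \<noteq> b N"
  shows "1 / (real N + 1) \<le> seq_dist (Pt_seq a) (Pt_seq b)"
proof -
  have "(LEAST n. a n \<noteq> b n) \<le> N" using assms by (rule Least_le)
  then show ?thesis using assms by (auto simp: frac_le)
qed

lemma seq_dist_attained:
  assumes "a \<noteq> b"
  shows "\<exists>N. a N \<noteq> b N \<and> seq_dist (Pt_seq a) (Pt_seq b) = 1 / (real N + 1)"
proof -
  have "\<exists>n. a n \<noteq> b n" using assms by auto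
  then have "a (LEAST n. a n \<noteq> b n) \<noteq> b (LEAST n. a n \<noteq> b n)" by (rule LeastI_ex)
  then show ?thesis using assms by (intro exI[of _ "LEAST n. a n \<noteq> b n"]) simp
qed

lemma seq_dist_less_iff:
  "seq_dist (Pt_seq a) (Pt_seq b) < r \<longleftrightarrow> 0 < r \<and> (\<forall>N. r \<le> 1 / (real N + 1) \<longrightarrow> a N = b N)"
proof (cases "a = b")
  case False
  then obtain N where "a N \<noteq> b N" "seq_dist (Pt_seq a) (Pt_seq b) = 1 / (real N + 1)"
    using seq_dist_attained by blast
  moreover have "0 < 1 / (real N + 1)" by simp
  ultimately show ?thesis
    using seq_dist_ge[of a _ b] by (metis less_le_trans not_le order.strict_trans)
qed auto

lemma seq_dist_le_iff:
  "seq_dist (Pt_seq a) (Pt_seq b) \<le> r \<longleftrightarrow> 0 \<le> r \<and> (\<forall>N. r < 1 / (real N + 1) \<longrightarrow> a N = b N)"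
proof (cases "a = b")
  case False
  then obtain N where "a N \<noteq> b N" "seq_dist (Pt_seq a) (Pt_seq b) = 1 / (real N + 1)"
    using seq_dist_attained by blast
  moreover have "0 < 1 / (real N + 1)" by simp
  ultimately show ?thesis
    using seq_dist_ge[of a _ b] by (metis le_less_trans less_imp_le not_le)
qed auto

text \<open>Clearing denominators gives \<open>(N + 1) * p \<le> q + 1\<close>. This is the origin
  of the number \<open>(q + 1) div p\<close> of values fixed by a ball around a sequence.\<close>

lemma frac_le_inverse_iff:
  "0 < p \<Longrightarrow> real p / (real q + 1) \<le> 1 / (real N + 1) \<longleftrightarrow> N < (q + 1) div p"
proof -
  assume p: "0 < p"
  have "real p / (real q + 1) \<le> 1 / (real N + 1) \<longleftrightarrow> real p * (real N + 1) \<le> real q + 1"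
    by (simp add: field_simps)
  also have "\<dots> \<longleftrightarrow> real ((N + 1) * p) \<le> real (q + 1)"
    by (simp add: algebra_simps)
  also have "\<dots> \<longleftrightarrow> (N + 1) * p \<le> q + 1"
    by (rule of_nat_le_iff)
  also have "\<dots> \<longleftrightarrow> N < (q + 1) div p"
    using p by (simp add: less_eq_div_iff_mult_less_eq flip: Suc_le_eq)
  finally show ?thesis .
qed

lemma frac_less_inverse_iff:
  "real p / (real q + 1) < 1 / (real N + 1) \<longleftrightarrow> p * (N + 1) < q + 1"
proof -
  have "real p / (real q + 1) < 1 / (real N + 1) \<longleftrightarrow> real p * (real N + 1) < real q + 1"
    by (simp add: field_simps)
  also have "\<dots> \<longleftrightarrow> real (p * (N + 1)) < real (q + 1)"
    by (simp add: algebra_simps)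
  also have "\<dots> \<longleftrightarrow> p * (N + 1) < q + 1"
    by (rule of_nat_less_iff)
  finally show ?thesis .
qed

lemma seq_dist_commute: "seq_dist x y = seq_dist y x"
  by (cases x; cases y) (auto simp: eq_commute)

lemma seq_dist_nonneg: "0 \<le> seq_dist x y"
  by (cases x; cases y) auto

text \<open>At the first place where a and c differ, b differs from one of them.\<close>

lemma seq_dist_ultra:
  "seq_dist (Pt_seq a) (Pt_seq c) \<le> max (seq_dist (Pt_seq a) (Pt_seq b)) (seq_dist (Pt_seq b) (Pt_seq c))"
proof (cases "a = c")
  case False
  then obtain N where N: "a N \<noteq> c N" "seq_dist (Pt_seq a) (Pt_seq c) = 1 / (real N + 1)"
    using seq_dist_attained by blast
  then have "a N \<noteq> b N \<or> b N \<noteq> c N" by auto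
  then show ?thesis
    unfolding N(2) using seq_dist_ge[of a N b] seq_dist_ge[of b N c] by (auto simp: le_max_iff_disj)
qed (simp add: le_max_iff_disj del: seq_dist.simps, simp add: seq_dist_nonneg del: seq_dist.simps)

lemma seq_dist_eq_0: "seq_dist (Pt_seq a) (Pt_seq b) = 0 \<longleftrightarrow> a = b"
  using seq_dist_attained[of a b] by auto

lemma Metric_space_seq_dist: "M \<subseteq> range Pt_seq \<Longrightarrow> Metric_space M seq_dist"
proof
  assume M: "M \<subseteq> range Pt_seq"
  show "0 \<le> seq_dist x y" "seq_dist x y = seq_dist y x" for x y
    by (rule seq_dist_nonneg seq_dist_commute)+
  show "seq_dist x y = 0 \<longleftrightarrow> x = y" if "x \<in> M" "y \<in> M" for x y
  proof -
    obtain a b where "x = Pt_seq a" "y = Pt_seq b"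
      using \<open>x \<in> M\<close> \<open>y \<in> M\<close> M by blast
    then show ?thesis using seq_dist_eq_0 by simp
  qed
  show "seq_dist x z \<le> seq_dist x y + seq_dist y z" if "x \<in> M" "y \<in> M" "z \<in> M" for x y z
  proof -
    obtain a b c where xyz: "x = Pt_seq a" "y = Pt_seq b" "z = Pt_seq c"
      using \<open>x \<in> M\<close> \<open>y \<in> M\<close> \<open>z \<in> M\<close> M by blast
    show ?thesis
      unfolding xyz
      using seq_dist_ultra[of a c b] seq_dist_nonneg[of "Pt_seq a" "Pt_seq b"]
        seq_dist_nonneg[of "Pt_seq b" "Pt_seq c"] by linarith
  qed
qed

lemma points_simps [simp]:
  "points omega = range Pt_nat" "points baire = range Pt_seq"
  "points cantor = {Pt_seq a | a. \<forall>n. a n \<in> {0, 1}}"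
  "points (X \<otimes> Y) = {Pt_pair x y | x y. x \<in> points X \<and> y \<in> points Y}"
  by (simp_all add: omega_def baire_def cantor_def prod_space_def)

lemma pres_simps [simp]:
  "pres omega i = Pt_nat i" "pres baire i = Pt_seq (entry i)"
  "pres cantor i = Pt_seq (\<lambda>n. min 1 (entry i n))"
  "pres (X \<otimes> Y) i = Pt_pair (pres X (entry i 0)) (pres Y (entry i 1))"
  by (simp_all add: omega_def baire_def cantor_def prod_space_def)

lemma pdist_simps:
  "pdist omega = (\<lambda>x y. if x = y then 0 else 1)" "pdist baire = seq_dist" "pdist cantor = seq_dist"
  "pdist (X \<otimes> Y) = pair_dist (pdist X) (pdist Y)"
  by (simp_all add: omega_def baire_def cantor_def prod_space_def)

section \<open>Metric axioms and balls of the basic spaces and products\<close>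

abbreviation met_space :: "space \<Rightarrow> bool" where
  "met_space X \<equiv> Metric_space (points X) (pdist X)"

lemma metric_omega: "met_space omega"
  by unfold_locales (auto simp: pdist_simps)

lemma metric_baire: "met_space baire"
  unfolding pdist_simps by (rule Metric_space_seq_dist) simp

lemma metric_cantor: "met_space cantor"
  unfolding pdist_simps by (rule Metric_space_seq_dist) auto

lemma metric_prod:
  assumes "met_space X" "met_space Y"
  shows "met_space (X \<otimes> Y)"
proof -
  interpret X: Metric_space "points X" "pdist X" by fact
  interpret Y: Metric_space "points Y" "pdist Y" by fact
  show ?thesis
  proof
    fix x y z
    show "0 \<le> pdist (X \<otimes> Y) x y"
      by (cases x; cases y) (auto simp: pdist_simps le_max_iff_disj)
    show "pdist (X \<otimes> Y) x y = pdist (X \<otimes> Y) y x"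
      by (cases x; cases y) (auto simp: pdist_simps X.commute Y.commute)
    show "pdist (X \<otimes> Y) x y = 0 \<longleftrightarrow> x = y" if "x \<in> points (X \<otimes> Y)" "y \<in> points (X \<otimes> Y)"
    proof -
      have "\<exists>x1 x2 y1 y2. x = Pt_pair x1 x2 \<and> y = Pt_pair y1 y2 \<and>
          x1 \<in> points X \<and> x2 \<in> points Y \<and> y1 \<in> points X \<and> y2 \<in> points Y"
        using that by auto
      then obtain x1 x2 y1 y2 where "x = Pt_pair x1 x2" "y = Pt_pair y1 y2"
        "x1 \<in> points X" "x2 \<in> points Y" "y1 \<in> points X" "y2 \<in> points Y"
        by blast
      moreover have "max a b = 0 \<longleftrightarrow> a = 0 \<and> b = 0" if "0 \<le> a" "0 \<le> b" for a b :: real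
        using that by (auto simp: max_def)
      ultimately show ?thesis by (simp add: pdist_simps)
    qed
    show "pdist (X \<otimes> Y) x z \<le> pdist (X \<otimes> Y) x y + pdist (X \<otimes> Y) y z"
      if "x \<in> points (X \<otimes> Y)" "y \<in> points (X \<otimes> Y)" "z \<in> points (X \<otimes> Y)"
    proof -
      have *: "\<exists>u v. w = Pt_pair u v \<and> u \<in> points X \<and> v \<in> points Y" if "w \<in> points (X \<otimes> Y)" for w
        using that by auto
      obtain x1 x2 y1 y2 z1 z2 where "x = Pt_pair x1 x2" "y = Pt_pair y1 y2" "z = Pt_pair z1 z2"
        and p: "x1 \<in> points X" "x2 \<in> points Y" "y1 \<in> points X" "y2 \<in> points Y" "z1 \<in> points X" "z2 \<in> points Y"
        using *[OF \<open>x \<in> _\<close>] *[OF \<open>y \<in> _\<close>] *[OF \<open>z \<in> _\<close>] by blast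
      then show ?thesis
        using X.triangle[OF p(1,3,5)] Y.triangle[OF p(2,4,6)] by (auto simp: pdist_simps max_def)
    qed
  qed
qed

text \<open>The factors of a product ball share the radius but have their own centres, so centre and
  radius are separate arguments.\<close>

definition rball :: "space \<Rightarrow> nat \<Rightarrow> nat \<Rightarrow> nat \<Rightarrow> pt set" where
  "rball X i p q = Metric_space.mball (points X) (pdist X) (pres X i) (real p / (real q + 1))"

lemma nbhd_rball: "nbhd X s = rball X (entry s 0) (entry s 1) (entry s 2)"
  by (simp add: nbhd_def rball_def)

lemma rball_iff:
  assumes "met_space X"
  shows "x \<in> rball X i p q \<longleftrightarrow>
    pres X i \<in> points X \<and> x \<in> points X \<and> pdist X (pres X i) x < real p / (real q + 1)"
proof -
  interpret Metric_space "points X" "pdist X" by fact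
  show ?thesis by (simp add: rball_def)
qed

text \<open>Distances are 0 or 1: a positive radius of at most 1 isolates the centre, and a larger
  one gives the whole space.\<close>

lemma rball_omega: "rball omega i p q = {Pt_nat m | m. 0 < p \<and> (p \<le> q + 1 \<longrightarrow> m = i)}"
proof -
  have "x \<in> rball omega i p q \<longleftrightarrow> x \<in> {Pt_nat m | m. 0 < p \<and> (p \<le> q + 1 \<longrightarrow> m = i)}" for x
    unfolding rball_iff[OF metric_omega] by (auto simp: pdist_simps field_simps)
  then show ?thesis by blast
qed

lemma seq_dist_frac_less_iff:
  "seq_dist (Pt_seq a) (Pt_seq b) < real p / (real q + 1) \<longleftrightarrow>
    0 < p \<and> (\<forall>n<(q + 1) div p. a n = b n)"
  unfolding seq_dist_less_iff using frac_le_inverse_iff[of p q]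
  by (cases "0 < p") (auto simp: divide_simps)

lemma rball_baire:
  "rball baire i p q = {Pt_seq a | a. 0 < p \<and> (\<forall>n<(q + 1) div p. a n = entry i n)}"
proof -
  have "x \<in> rball baire i p q \<longleftrightarrow>
      x \<in> {Pt_seq a | a. 0 < p \<and> (\<forall>n<(q + 1) div p. a n = entry i n)}" for x
    unfolding rball_iff[OF metric_baire]
    by (auto simp: pdist_simps seq_dist_frac_less_iff simp del: seq_dist.simps)
  then show ?thesis by blast
qed

lemma rball_cantor:
  "rball cantor i p q = {Pt_seq a | a. (\<forall>n. a n \<in> {0, 1}) \<and>
     0 < p \<and> (\<forall>n<(q + 1) div p. a n = min 1 (entry i n))}"
proof -
  have "pres cantor i \<in> points cantor" by (auto simp: min_def)
  then have "x \<in> rball cantor i p q \<longleftrightarrow> x \<in> {Pt_seq a | a. (\<forall>n. a n \<in> {0, 1}) \<and>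
     0 < p \<and> (\<forall>n<(q + 1) div p. a n = min 1 (entry i n))}" for x
    unfolding rball_iff[OF metric_cantor]
    by (auto simp: pdist_simps seq_dist_frac_less_iff simp del: seq_dist.simps)
  then show ?thesis by blast
qed

lemma rball_prod:
  assumes "met_space X" "met_space Y"
  shows "rball (X \<otimes> Y) i p q =
    {Pt_pair x y | x y. x \<in> rball X (entry i 0) p q \<and> y \<in> rball Y (entry i 1) p q}"
proof -
  have "x \<in> rball (X \<otimes> Y) i p q \<longleftrightarrow> x \<in> {Pt_pair x y | x y.
      x \<in> rball X (entry i 0) p q \<and> y \<in> rball Y (entry i 1) p q}" for x
    by (cases x) (auto simp: rball_iff[OF metric_prod[OF assms]] rball_iff[OF assms(1)]
        rball_iff[OF assms(2)] pdist_simps)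
  then show ?thesis by blast
qed


subsection \<open>Recursive presentations\<close>

lemma recursive_rel4_iff:
  "recursive_rel 4 (\<lambda>xs. R (xs ! 0) (xs ! 1) (xs ! 2) (xs ! 3)) \<longleftrightarrow>
    decidable (\<lambda>p. R (fst p) (fst (snd p)) (fst (snd (snd p))) (snd (snd (snd p))))"
    (is "?l \<longleftrightarrow> ?r")
proof
  assume ?r
  then have r: "recursive 1 (\<lambda>xs. enc (of_bool ((\<lambda>p. R (fst p) (fst (snd p)) (fst (snd (snd p))) (snd (snd (snd p))))
      (dec (xs ! 0))) :: nat))"
    by (simp only: decidable_def computable_def)
  have "recursive 4 (\<lambda>xs. prod_encode (xs ! 0, prod_encode (xs ! 1, prod_encode (xs ! 2, xs ! 3))))"
    by (intro recursive_comp2[of "\<lambda>a b. prod_encode (a, b)", OF recursive_prod_encode2] recursive_nth) auto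
  from recursive_comp1[OF r this] show ?l
    by (simp add: recursive_rel_def dec_prod of_bool_def)
next
  assume l: ?l
  let ?d = "\<lambda>xs :: nat list. dec (xs ! 0) :: nat \<times> nat \<times> nat \<times> nat"
  let ?fs = "[\<lambda>xs. fst (?d xs), \<lambda>xs. fst (snd (?d xs)), \<lambda>xs. fst (snd (snd (?d xs))),
    \<lambda>xs. snd (snd (snd (?d xs)))]"
  have "computable (\<lambda>p :: nat \<times> nat \<times> nat \<times> nat. fst p)"
    "computable (\<lambda>p :: nat \<times> nat \<times> nat \<times> nat. fst (snd p))"
    "computable (\<lambda>p :: nat \<times> nat \<times> nat \<times> nat. fst (snd (snd p)))"
    "computable (\<lambda>p :: nat \<times> nat \<times> nat \<times> nat. snd (snd (snd p)))"
    by (intro comp_intros)+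
  then have "\<forall>f \<in> set ?fs. recursive 1 f"
    by (simp add: computable_def)
  moreover have "recursive (length ?fs) (\<lambda>xs. if R (xs ! 0) (xs ! 1) (xs ! 2) (xs ! 3) then 1 else 0)"
    using l by (simp add: recursive_rel_def numeral_eq_Suc)
  ultimately have "recursive 1 (\<lambda>xs. (\<lambda>xs. if R (xs ! 0) (xs ! 1) (xs ! 2) (xs ! 3) then 1 else 0)
      (map (\<lambda>f. f xs) ?fs))"
    by (intro recursive.comp)
  then show ?r
    by (simp add: decidable_def computable_def of_bool_def numeral_eq_Suc)
qed

lemma mcomplete_iff:
  assumes "met_space X"
  shows "Metric_space.mcomplete (points X) (pdist X) \<longleftrightarrow>
    (\<forall>\<sigma> :: nat \<Rightarrow> pt. range \<sigma> \<subseteq> points X \<and>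
         (\<forall>\<epsilon>>0. \<exists>N. \<forall>m n. N \<le> m \<longrightarrow> N \<le> n \<longrightarrow> pdist X (\<sigma> m) (\<sigma> n) < \<epsilon>) \<longrightarrow>
       (\<exists>x\<in>points X. \<forall>\<epsilon>>0. \<exists>N. \<forall>n\<ge>N. pdist X (\<sigma> n) x < \<epsilon>))"
proof -
  interpret Metric_space "points X" "pdist X" by fact
  have lim: "(\<exists>x. limitin mtopology \<sigma> x sequentially) \<longleftrightarrow>
      (\<exists>x\<in>points X. \<forall>\<epsilon>>0. \<exists>N. \<forall>n\<ge>N. pdist X (\<sigma> n) x < \<epsilon>)"
    if "range \<sigma> \<subseteq> points X" for \<sigma> :: "nat \<Rightarrow> pt"
  proof -
    have "\<sigma> n \<in> points X" for n using that by auto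
    then show ?thesis
      by (simp add: limit_metric_sequentially Bex_def)
  qed
  show ?thesis
    unfolding mcomplete_def MCauchy_def
    by (rule all_cong1, rule imp_cong[OF refl], rule lim) blast
qed

lemma dense_iff:
  assumes "met_space X" "range (pres X) \<subseteq> points X"
  shows "top_of X closure_of range (pres X) = points X \<longleftrightarrow>
    (\<forall>x\<in>points X. \<forall>r>0. \<exists>i. pdist X x (pres X i) < r)"
proof -
  interpret Metric_space "points X" "pdist X" by fact
  have "pres X i \<in> points X" for i using assms(2) by auto
  then show ?thesis
    unfolding metric_closure_of by auto
qed

definition dist_le :: "space \<Rightarrow> nat \<Rightarrow> nat \<Rightarrow> nat \<Rightarrow> nat \<Rightarrow> bool" where
  "dist_le X i j p q \<longleftrightarrow> pdist X (pres X i) (pres X j) \<le> real p / (real q + 1)"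

definition dist_less :: "space \<Rightarrow> nat \<Rightarrow> nat \<Rightarrow> nat \<Rightarrow> nat \<Rightarrow> bool" where
  "dist_less X i j p q \<longleftrightarrow> pdist X (pres X i) (pres X j) < real p / (real q + 1)"

lemma recursively_presented_iff:
  "recursively_presented X \<longleftrightarrow>
    met_space X \<and>
    (\<forall>\<sigma> :: nat \<Rightarrow> pt. range \<sigma> \<subseteq> points X \<and>
         (\<forall>\<epsilon>>0. \<exists>N. \<forall>m n. N \<le> m \<longrightarrow> N \<le> n \<longrightarrow> pdist X (\<sigma> m) (\<sigma> n) < \<epsilon>) \<longrightarrow>
       (\<exists>x\<in>points X. \<forall>\<epsilon>>0. \<exists>N. \<forall>n\<ge>N. pdist X (\<sigma> n) x < \<epsilon>)) \<and>
    range (pres X) \<subseteq> points X \<and>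
    (\<forall>x\<in>points X. \<forall>r>0. \<exists>i. pdist X x (pres X i) < r) \<and>
    decidable (\<lambda>p. dist_le X (fst p) (fst (snd p)) (fst (snd (snd p))) (snd (snd (snd p)))) \<and>
    decidable (\<lambda>p. dist_less X (fst p) (fst (snd p)) (fst (snd (snd p))) (snd (snd (snd p))))"
  unfolding recursively_presented_def dist_le_def[symmetric] dist_less_def[symmetric] recursive_rel4_iff
  using mcomplete_iff[of X] dense_iff[of X] by blast

lemma
  assumes "recursively_presented X"
  shows recursively_presented_metric: "met_space X"
    and recursively_presented_complete: "\<And>\<sigma> :: nat \<Rightarrow> pt. range \<sigma> \<subseteq> points X \<Longrightarrow>
      \<forall>\<epsilon>>0. \<exists>N. \<forall>m n. N \<le> m \<longrightarrow> N \<le> n \<longrightarrow> pdist X (\<sigma> m) (\<sigma> n) < \<epsilon> \<Longrightarrow>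
      \<exists>x\<in>points X. \<forall>\<epsilon>>0. \<exists>N. \<forall>n\<ge>N. pdist X (\<sigma> n) x < \<epsilon>"
    and recursively_presented_pres: "\<And>i. pres X i \<in> points X"
    and recursively_presented_dense: "\<And>x r. x \<in> points X \<Longrightarrow> 0 < r \<Longrightarrow> \<exists>i. pdist X x (pres X i) < r"
    and recursively_presented_dist_le:
      "decidable (\<lambda>p. dist_le X (fst p) (fst (snd p)) (fst (snd (snd p))) (snd (snd (snd p))))"
    and recursively_presented_dist_less:
      "decidable (\<lambda>p. dist_less X (fst p) (fst (snd p)) (fst (snd (snd p))) (snd (snd (snd p))))"
proof -
  note * = assms[unfolded recursively_presented_iff]
  note 1 = conjunct1[OF *] and 2 = conjunct2[OF *]
  note 21 = conjunct1[OF 2] and 22 = conjunct2[OF 2]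
  note 31 = conjunct1[OF 22] and 32 = conjunct2[OF 22]
  note 41 = conjunct1[OF 32] and 42 = conjunct2[OF 32]
  show "met_space X" by (rule 1)
  show "\<exists>x\<in>points X. \<forall>\<epsilon>>0. \<exists>N. \<forall>n\<ge>N. pdist X (\<sigma> n) x < \<epsilon>"
    if "range \<sigma> \<subseteq> points X" "\<forall>\<epsilon>>0. \<exists>N. \<forall>m n. N \<le> m \<longrightarrow> N \<le> n \<longrightarrow> pdist X (\<sigma> m) (\<sigma> n) < \<epsilon>"
    for \<sigma> :: "nat \<Rightarrow> pt"
    by (rule 21[rule_format, OF conjI[OF that]])
  show "pres X i \<in> points X" for i using 31 by blast
  show "\<exists>i. pdist X x (pres X i) < r" if "x \<in> points X" "0 < r" for x r
    using 41 that by blast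
qed (use assms in \<open>simp_all add: recursively_presented_iff\<close>)

lemma recursively_presented_omega: "recursively_presented omega"
  unfolding recursively_presented_iff
proof (intro conjI allI impI ballI)
  show "met_space omega" by (rule metric_omega)
  show "range (pres omega) \<subseteq> points omega" by simp
  show "\<exists>i. pdist omega x (pres omega i) < r" if "x \<in> points omega" "0 < r" for x r
    using that by (auto simp: pdist_simps)
  show "\<exists>x\<in>points omega. \<forall>\<epsilon>>0. \<exists>N. \<forall>n\<ge>N. pdist omega (\<sigma> n) x < \<epsilon>"
    if \<sigma>: "range \<sigma> \<subseteq> points omega \<and>
      (\<forall>\<epsilon>>0. \<exists>N. \<forall>m n. N \<le> m \<longrightarrow> N \<le> n \<longrightarrow> pdist omega (\<sigma> m) (\<sigma> n) < \<epsilon>)" for \<sigma> :: "nat \<Rightarrow> pt"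
  proof -
    obtain N where N: "\<forall>m n. N \<le> m \<longrightarrow> N \<le> n \<longrightarrow> pdist omega (\<sigma> m) (\<sigma> n) < 1"
      using \<sigma> zero_less_one by blast
    \<comment> \<open>Distances below 1 vanish in a discrete metric, so the sequence is constant
      from N on.\<close>
    have const: "\<sigma> n = \<sigma> N" if "N \<le> n" for n
    proof (rule ccontr)
      assume "\<sigma> n \<noteq> \<sigma> N"
      then have "pdist omega (\<sigma> n) (\<sigma> N) = 1" by (simp only: pdist_simps if_False)
      moreover have "pdist omega (\<sigma> n) (\<sigma> N) < 1" by (rule N[rule_format, OF that order_refl])
      ultimately show False by linarith
    qed
    have "pdist omega (\<sigma> n) (\<sigma> N) = 0" if "N \<le> n" for n
      unfolding const[OF that] by (simp add: pdist_simps)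
    then have "\<exists>M. \<forall>n\<ge>M. pdist omega (\<sigma> n) (\<sigma> N) < \<epsilon>" if "0 < \<epsilon>" for \<epsilon>
      using that by (intro exI[of _ N]) simp
    moreover have "\<sigma> N \<in> points omega" using \<sigma> by blast
    ultimately show ?thesis by blast
  qed
  have "dist_le omega i j p q \<longleftrightarrow> i = j \<or> q + 1 \<le> p" for i j p q
    by (auto simp: dist_le_def pdist_simps field_simps)
  then show "decidable (\<lambda>p. dist_le omega (fst p) (fst (snd p)) (fst (snd (snd p))) (snd (snd (snd p))))"
    by (simp only:) (intro comp_intros)
  have "dist_less omega i j p q \<longleftrightarrow> i = j \<and> 0 < p \<or> q + 1 < p" for i j p q
    by (auto simp: dist_less_def pdist_simps field_simps)
  then show "decidable (\<lambda>p. dist_less omega (fst p) (fst (snd p)) (fst (snd (snd p))) (snd (snd (snd p))))"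
    by (simp only:) (intro comp_intros)
qed

lemma exists_inverse_less: "0 < r \<Longrightarrow> \<exists>K. 1 / (real K + 1) < r"
  using reals_Archimedean[of r] by (auto simp: inverse_eq_divide add.commute)

lemma recursively_presented_baire: "recursively_presented baire"
  unfolding recursively_presented_iff
proof (intro conjI allI impI ballI)
  show "met_space baire" by (rule metric_baire)
  show "range (pres baire) \<subseteq> points baire" by auto
  show "\<exists>i. pdist baire x (pres baire i) < r" if x: "x \<in> points baire" and r: "0 < r" for x r
  proof -
    obtain a where a: "x = Pt_seq a" using x by auto
    obtain K where K: "1 / (real K + 1) < r" using exists_inverse_less[OF r] by blast
    obtain c where c: "agrees a c K" using exists_agrees by blast
    have "a N = entry c N" if "r \<le> 1 / (real N + 1)" for N
    proof -
      have "1 / (real K + 1) < 1 / (real N + 1)" using that K by simp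
      then have "N < K" by (simp add: field_simps)
      then show ?thesis using c by (simp add: agrees_def)
    qed
    then show ?thesis
      unfolding a pdist_simps pres_simps seq_dist_less_iff using r by blast
  qed
  show "\<exists>x\<in>points baire. \<forall>\<epsilon>>0. \<exists>N. \<forall>n\<ge>N. pdist baire (\<sigma> n) x < \<epsilon>"
    if "range \<sigma> \<subseteq> points baire \<and>
      (\<forall>\<epsilon>>0. \<exists>N. \<forall>m n. N \<le> m \<longrightarrow> N \<le> n \<longrightarrow> pdist baire (\<sigma> m) (\<sigma> n) < \<epsilon>)" for \<sigma> :: "nat \<Rightarrow> pt"
  proof -
    have "\<sigma> n \<in> points baire" for n using that by blast
    then have "\<forall>n. \<exists>b. \<sigma> n = Pt_seq b" by auto
    then obtain a where a: "\<And>n. \<sigma> n = Pt_seq (a n)" by metis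
    have cauchy: "\<exists>N. \<forall>m n k. N \<le> m \<longrightarrow> N \<le> n \<longrightarrow> \<epsilon> \<le> 1 / (real k + 1) \<longrightarrow> a m k = a n k" if "0 < \<epsilon>" for \<epsilon>
    proof -
      have "\<exists>N. \<forall>m n. N \<le> m \<longrightarrow> N \<le> n \<longrightarrow> seq_dist (Pt_seq (a m)) (Pt_seq (a n)) < \<epsilon>"
        using \<open>range \<sigma> \<subseteq> points baire \<and> _\<close> \<open>0 < \<epsilon>\<close> unfolding a pdist_simps by blast
      then show ?thesis unfolding seq_dist_less_iff by blast
    qed
    have "\<forall>k. \<exists>N. \<forall>m n. N \<le> m \<longrightarrow> N \<le> n \<longrightarrow> a m k = a n k"
    proof
      fix k
      show "\<exists>N. \<forall>m n. N \<le> m \<longrightarrow> N \<le> n \<longrightarrow> a m k = a n k"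
        using cauchy[of "1 / (real k + 1)"] by auto
    qed
    then obtain N where N: "\<And>k m n. N k \<le> m \<Longrightarrow> N k \<le> n \<Longrightarrow> a m k = a n k" by metis
    \<comment> \<open>Place k is stable from stage \<open>N k\<close> on, and the limit is read off
      there.\<close>
    define x where "x k = a (N k) k" for k
    have "\<exists>M. \<forall>n\<ge>M. pdist baire (\<sigma> n) (Pt_seq x) < \<epsilon>" if \<epsilon>: "0 < \<epsilon>" for \<epsilon>
    proof -
      obtain M where M: "\<And>m n k. M \<le> m \<Longrightarrow> M \<le> n \<Longrightarrow> \<epsilon> \<le> 1 / (real k + 1) \<Longrightarrow> a m k = a n k"
        using cauchy[OF \<epsilon>] by blast
      have "a n k = x k" if "M \<le> n" "\<epsilon> \<le> 1 / (real k + 1)" for n k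
      proof -
        \<comment> \<open>The two moduli are unrelated, so the values are compared at an index
          beyond both.\<close>
        have "a n k = a (max M (N k)) k" by (rule M[OF that(1) _ that(2)]) simp
        also have "\<dots> = a (N k) k" by (rule N) simp_all
        finally show ?thesis by (simp add: x_def)
      qed
      then show ?thesis
        unfolding a pdist_simps seq_dist_less_iff using \<epsilon> by blast
    qed
    then show ?thesis by (intro bexI[of _ "Pt_seq x"]) auto
  qed
  \<comment> \<open>Both dense points vanish from place \<open>i + j\<close> on by
    \<open>entry_eq_0\<close>, so a bounded comparison decides the inequality.\<close>
  have "dist_le baire i j p q \<longleftrightarrow> (\<forall>N<i + j. p * (N + 1) < q + 1 \<longrightarrow> entry i N = entry j N)" for i j p q
  proof -
    have "entry i N = entry j N" if "\<not> N < i + j" for N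
      using that entry_eq_0[of i N] entry_eq_0[of j N] by simp
    then show ?thesis
      unfolding dist_le_def pdist_simps pres_simps seq_dist_le_iff frac_less_inverse_iff by auto
  qed
  then show "decidable (\<lambda>p. dist_le baire (fst p) (fst (snd p)) (fst (snd (snd p))) (snd (snd (snd p))))"
    by (simp only:) (intro comp_intros)
  have "dist_less baire i j p q \<longleftrightarrow> 0 < p \<and> (\<forall>n<(q + 1) div p. entry i n = entry j n)" for i j p q
    unfolding dist_less_def pdist_simps pres_simps seq_dist_frac_less_iff ..
  then show "decidable (\<lambda>p. dist_less baire (fst p) (fst (snd p)) (fst (snd (snd p))) (snd (snd (snd p))))"
    by (simp only:) (intro comp_intros)
qed

lemma recursively_presented_prod:
  assumes X: "recursively_presented X" and Y: "recursively_presented Y"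
  shows "recursively_presented (X \<otimes> Y)"
proof -
  note mX = recursively_presented_metric[OF X] and mY = recursively_presented_metric[OF Y]
  note cX = recursively_presented_complete[OF X] and cY = recursively_presented_complete[OF Y]
  note pX = recursively_presented_pres[OF X] and pY = recursively_presented_pres[OF Y]
  show ?thesis
    unfolding recursively_presented_iff
  proof (intro conjI allI impI ballI)
    show "met_space (X \<otimes> Y)" by (rule metric_prod[OF mX mY])
    show "range (pres (X \<otimes> Y)) \<subseteq> points (X \<otimes> Y)" using pX pY by auto
    show "\<exists>i. pdist (X \<otimes> Y) z (pres (X \<otimes> Y) i) < r" if z: "z \<in> points (X \<otimes> Y)" and r: "0 < r" for z r
    proof -
      obtain x y where xy: "z = Pt_pair x y" "x \<in> points X" "y \<in> points Y" using z by auto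
      obtain i where i: "pdist X x (pres X i) < r"
        using recursively_presented_dense[OF X xy(2) r] by blast
      obtain j where j: "pdist Y y (pres Y j) < r"
        using recursively_presented_dense[OF Y xy(3) r] by blast
      show ?thesis
        using i j by (intro exI[of _ "tuple2 i j"]) (simp add: xy pdist_simps)
    qed
    show "\<exists>z\<in>points (X \<otimes> Y). \<forall>\<epsilon>>0. \<exists>N. \<forall>n\<ge>N. pdist (X \<otimes> Y) (\<sigma> n) z < \<epsilon>"
      if \<sigma>: "range \<sigma> \<subseteq> points (X \<otimes> Y) \<and> (\<forall>\<epsilon>>0. \<exists>N. \<forall>m n. N \<le> m \<longrightarrow> N \<le> n \<longrightarrow> pdist (X \<otimes> Y) (\<sigma> m) (\<sigma> n) < \<epsilon>)"
      for \<sigma> :: "nat \<Rightarrow> pt"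
    proof -
      have "\<sigma> n \<in> points (X \<otimes> Y)" for n using \<sigma> by blast
      then have "\<exists>x y. \<sigma> n = Pt_pair x y \<and> x \<in> points X \<and> y \<in> points Y" for n by auto
      then have "\<exists>a. \<forall>n. \<exists>y. \<sigma> n = Pt_pair (a n) y \<and> a n \<in> points X \<and> y \<in> points Y"
        by (intro choice) blast
      then obtain a where "\<forall>n. \<exists>y. \<sigma> n = Pt_pair (a n) y \<and> a n \<in> points X \<and> y \<in> points Y" by blast
      then obtain b where "\<forall>n. \<sigma> n = Pt_pair (a n) (b n) \<and> a n \<in> points X \<and> b n \<in> points Y"
        using choice[of "\<lambda>n y. \<sigma> n = Pt_pair (a n) y \<and> a n \<in> points X \<and> y \<in> points Y"] by blast
      then have ab: "\<And>n. \<sigma> n = Pt_pair (a n) (b n)" "\<And>n. a n \<in> points X" "\<And>n. b n \<in> points Y"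
        by simp_all
      have c: "\<exists>N. \<forall>m n. N \<le> m \<longrightarrow> N \<le> n \<longrightarrow> pdist X (a m) (a n) < \<epsilon> \<and> pdist Y (b m) (b n) < \<epsilon>"
        if "0 < \<epsilon>" for \<epsilon>
      proof -
        obtain N where "\<forall>m n. N \<le> m \<longrightarrow> N \<le> n \<longrightarrow> pdist (X \<otimes> Y) (\<sigma> m) (\<sigma> n) < \<epsilon>"
          using \<sigma> \<open>0 < \<epsilon>\<close> by blast
        then show ?thesis by (intro exI[of _ N]) (simp add: ab(1) pdist_simps)
      qed
      have "range a \<subseteq> points X" using ab(2) by auto
      moreover have "\<forall>\<epsilon>>0. \<exists>N. \<forall>m n. N \<le> m \<longrightarrow> N \<le> n \<longrightarrow> pdist X (a m) (a n) < \<epsilon>"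
        using c by blast
      ultimately obtain x where x: "x \<in> points X" "\<forall>\<epsilon>>0. \<exists>N. \<forall>n\<ge>N. pdist X (a n) x < \<epsilon>"
        using cX by blast
      have "range b \<subseteq> points Y" using ab(3) by auto
      moreover have "\<forall>\<epsilon>>0. \<exists>N. \<forall>m n. N \<le> m \<longrightarrow> N \<le> n \<longrightarrow> pdist Y (b m) (b n) < \<epsilon>"
        using c by blast
      ultimately obtain y where y: "y \<in> points Y" "\<forall>\<epsilon>>0. \<exists>N. \<forall>n\<ge>N. pdist Y (b n) y < \<epsilon>"
        using cY by blast
      have "\<exists>N. \<forall>n\<ge>N. pdist (X \<otimes> Y) (\<sigma> n) (Pt_pair x y) < \<epsilon>" if "0 < \<epsilon>" for \<epsilon>
      proof -
        obtain N M where "\<forall>n\<ge>N. pdist X (a n) x < \<epsilon>" "\<forall>n\<ge>M. pdist Y (b n) y < \<epsilon>"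
          using x(2) y(2) \<open>0 < \<epsilon>\<close> by blast
        then show ?thesis by (intro exI[of _ "max N M"]) (simp add: ab(1) pdist_simps)
      qed
      then show ?thesis using x(1) y(1) by (intro bexI[of _ "Pt_pair x y"]) auto
    qed
    have dX: "decidable (\<lambda>x. dist_le X (f x) (g x) (h x) (k x))" "decidable (\<lambda>x. dist_less X (f x) (g x) (h x) (k x))"
      if "computable f" "computable g" "computable h" "computable k" for f g h k :: "'a::coded \<Rightarrow> nat"
      using decidable_compose[OF recursively_presented_dist_le[OF X], of "\<lambda>x. (f x, g x, h x, k x)"]
        decidable_compose[OF recursively_presented_dist_less[OF X], of "\<lambda>x. (f x, g x, h x, k x)"] that
      by (simp_all add: computable_Pair)
    have dY: "decidable (\<lambda>x. dist_le Y (f x) (g x) (h x) (k x))" "decidable (\<lambda>x. dist_less Y (f x) (g x) (h x) (k x))"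
      if "computable f" "computable g" "computable h" "computable k" for f g h k :: "'a::coded \<Rightarrow> nat"
      using decidable_compose[OF recursively_presented_dist_le[OF Y], of "\<lambda>x. (f x, g x, h x, k x)"]
        decidable_compose[OF recursively_presented_dist_less[OF Y], of "\<lambda>x. (f x, g x, h x, k x)"] that
      by (simp_all add: computable_Pair)
    have "dist_le (X \<otimes> Y) i j p q \<longleftrightarrow>
        dist_le X (entry i 0) (entry j 0) p q \<and> dist_le Y (entry i 1) (entry j 1) p q" for i j p q
      by (simp add: dist_le_def pdist_simps)
    then show "decidable (\<lambda>p. dist_le (X \<otimes> Y) (fst p) (fst (snd p)) (fst (snd (snd p))) (snd (snd (snd p))))"
      by (simp only:) (intro comp_intros dX dY)
    have "dist_less (X \<otimes> Y) i j p q \<longleftrightarrow>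
        dist_less X (entry i 0) (entry j 0) p q \<and> dist_less Y (entry i 1) (entry j 1) p q" for i j p q
      by (simp add: dist_less_def pdist_simps)
    then show "decidable (\<lambda>p. dist_less (X \<otimes> Y) (fst p) (fst (snd p)) (fst (snd (snd p))) (snd (snd (snd p))))"
      by (simp only:) (intro comp_intros dX dY)
  qed
qed


section \<open>Semirecursive sets and effectively open relations\<close>

lemmas met_intros = metric_omega metric_baire metric_cantor metric_prod

lemma mem_rball_omega: "Pt_nat m \<in> rball omega i p q \<longleftrightarrow> 0 < p \<and> (p \<le> q + 1 \<longrightarrow> m = i)"
  by (simp add: rball_omega)

lemma mem_rball_baire:
  "Pt_seq a \<in> rball baire i p q \<longleftrightarrow> 0 < p \<and> (\<forall>n<(q + 1) div p. a n = entry i n)"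
  by (simp add: rball_baire)

lemma mem_rball_cantor:
  "Pt_seq a \<in> rball cantor i p q \<longleftrightarrow>
    (\<forall>n. a n \<in> {0, 1}) \<and> 0 < p \<and> (\<forall>n<(q + 1) div p. a n = min 1 (entry i n))"
  by (simp add: rball_cantor)

lemma mem_rball_prod:
  assumes "met_space X" "met_space Y"
  shows "Pt_pair x y \<in> rball (X \<otimes> Y) i p q \<longleftrightarrow>
    x \<in> rball X (entry i 0) p q \<and> y \<in> rball Y (entry i 1) p q"
  by (simp add: rball_prod[OF assms])

lemmas mem_rball = mem_rball_omega mem_rball_baire mem_rball_cantor mem_rball_prod met_intros

lemma nbhd_0: "met_space X \<Longrightarrow> nbhd X 0 = {}"
proof -
  assume X: "met_space X"
  interpret Metric_space "points X" "pdist X" by fact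
  have "\<not> pdist X x y < 0" for x y by (simp add: not_less)
  then have "y \<notin> nbhd X 0" for y
    unfolding nbhd_rball rball_iff[OF X] entry_0 by simp
  then show ?thesis by blast
qed

lemma computable_nat_iff: "computable (f :: nat \<Rightarrow> nat) \<longleftrightarrow> recursive 1 (\<lambda>xs. f (xs ! 0))"
  by (simp add: computable_def)

text \<open>A semirecursive set of indices has a total recursive enumeration once there is a
  harmless index to output at stages that find nothing. The index 0 is harmless, as it names the
  empty set.\<close>

lemma Sigma01_iff:
  assumes "met_space X"
  shows "A \<in> Sigma01 X \<longleftrightarrow> (\<exists>E. semirec E \<and> A = (\<Union>s\<in>Collect E. nbhd X s))"
proof
  assume "A \<in> Sigma01 X"
  then obtain \<epsilon> :: "nat \<Rightarrow> nat" where \<epsilon>: "computable \<epsilon>" "A = (\<Union>i. nbhd X (\<epsilon> i))"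
    unfolding Sigma01_def computable_nat_iff by blast
  have "semirec (\<lambda>s. \<exists>i. \<epsilon> i = s)"
    by (intro semirec_intros decidable_semirec comp_intros computable_compose[OF \<epsilon>(1)])
  moreover have "A = (\<Union>s\<in>Collect (\<lambda>s. \<exists>i. \<epsilon> i = s). nbhd X s)"
    unfolding \<epsilon>(2) by auto
  ultimately show "\<exists>E. semirec E \<and> A = (\<Union>s\<in>Collect E. nbhd X s)" by blast
next
  assume "\<exists>E. semirec E \<and> A = (\<Union>s\<in>Collect E. nbhd X s)"
  then obtain E where E: "semirec E" "A = (\<Union>s\<in>Collect E. nbhd X s)" by blast
  obtain Q where Q: "decidable Q" "\<And>s. E s \<longleftrightarrow> (\<exists>n :: nat. Q (s, n))"
    using E(1) unfolding semirec_def by blast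
  define \<epsilon> where "\<epsilon> m = (if Q (dec m) then fst (dec m :: nat \<times> nat) else 0)" for m :: nat
  have "computable \<epsilon>"
    unfolding \<epsilon>_def by (intro comp_intros decidable_compose[OF Q(1)])
  moreover have "A = (\<Union>i. nbhd X (\<epsilon> i))"
  proof (intro equalityI subsetI)
    fix x assume "x \<in> A"
    then obtain s n where sn: "Q (s, n)" "x \<in> nbhd X s" unfolding E(2) Q(2) by auto
    then have "x \<in> nbhd X (\<epsilon> (enc (s, n)))" by (simp add: \<epsilon>_def)
    then show "x \<in> (\<Union>i. nbhd X (\<epsilon> i))" by blast
  next
    fix x assume "x \<in> (\<Union>i. nbhd X (\<epsilon> i))"
    then obtain m where m: "x \<in> nbhd X (\<epsilon> m)" by blast
    obtain s n where sn: "(dec m :: nat \<times> nat) = (s, n)" by fastforce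
    have "Q (s, n)" "x \<in> nbhd X s"
      using m nbhd_0[OF assms] unfolding \<epsilon>_def sn by (auto split: if_splits)
    then show "x \<in> A" unfolding E(2) Q(2) by auto
  qed
  ultimately show "A \<in> Sigma01 X"
    unfolding Sigma01_def computable_nat_iff by auto
qed

text \<open>Only basic neighbourhoods of X have to be examined, because an effective union of open
  conditions is open.\<close>

lemma eopen_Sigma01:
  assumes "A \<in> Sigma01 X" "met_space X" "eopen (\<lambda>y p. \<phi> y (fst p) \<in> nbhd X (snd p))"
  shows "eopen (\<lambda>y x. \<phi> y x \<in> A)"
proof -
  obtain E where E: "semirec E" "A = (\<Union>s\<in>Collect E. nbhd X s)"
    using assms(1) Sigma01_iff[OF assms(2)] by blast
  have "eopen (\<lambda>y x. \<exists>s. E s \<and> \<phi> y x \<in> nbhd X s)"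
    by (intro eopen_intros assms(3) eopen_semirec[OF semirec_compose[OF E(1)]] comp_intros)
  then show ?thesis
    by (rule eopen_cong) (auto simp: E(2))
qed

text \<open>A partial converse, for maps \<phi> that carry every cylinder of positive length onto a
  basic neighbourhood. The cylinders accepted by T then yield a semirecursive set of indices through
  \<open>code\<close>.\<close>

lemma Sigma01_cylinders:
  assumes "met_space X" "eopen P" "computable code"
    and "\<And>c L x. nbhd X (code (c, L, x)) = {\<phi> y x | y. agrees y c (Suc L)}"
  shows "{\<phi> y x | y x. P y x} \<in> Sigma01 X"
proof -
  obtain T where T: "semirec T" "\<And>y x. P y x \<longleftrightarrow> (\<exists>c L. agrees y c (Suc L) \<and> T (c, L, x))"
    using eopenE_Suc[OF assms(2)] by blast
  have "semirec (\<lambda>s. \<exists>q. T q \<and> s = code q)"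
    by (intro semirec_intros semirec_compose[OF T(1)] decidable_semirec comp_intros
        computable_compose[OF assms(3)])
  moreover have "{\<phi> y x | y x. P y x} = (\<Union>s\<in>{s. \<exists>q. T q \<and> s = code q}. nbhd X s)"
  proof (intro equalityI subsetI)
    fix z assume "z \<in> {\<phi> y x | y x. P y x}"
    then obtain y x c L where "z = \<phi> y x" "agrees y c (Suc L)" "T (c, L, x)"
      unfolding T(2) by blast
    then have "T (c, L, x)" "z \<in> nbhd X (code (c, L, x))"
      unfolding assms(4) by blast+
    then show "z \<in> (\<Union>s\<in>{s. \<exists>q. T q \<and> s = code q}. nbhd X s)" by blast
  next
    fix z assume "z \<in> (\<Union>s\<in>{s. \<exists>q. T q \<and> s = code q}. nbhd X s)"
    then obtain c L x where "T (c, L, x)" "z \<in> nbhd X (code (c, L, x))" by auto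
    then show "z \<in> {\<phi> y x | y x. P y x}"
      unfolding assms(4) T(2) by blast
  qed
  ultimately show ?thesis
    unfolding Sigma01_iff[OF assms(1)] by (intro exI[of _ "\<lambda>s. \<exists>q. T q \<and> s = code q"]) simp
qed

section \<open>Values and neighbourhoods of sequences\<close>

lemma edec_rball_baire [edec_intros]:
  assumes "computable i" "computable p" "computable q"
  shows "edec (\<lambda>y x. Pt_seq y \<in> rball baire (i x) (p x) (q x))"
  unfolding mem_rball
  by (intro edec_intros edec_decidable comp_intros assms computable_compose[OF assms(1)])

lemma decidable_rball_omega [comp_intros]:
  assumes "computable m" "computable i" "computable p" "computable q"
  shows "decidable (\<lambda>x. Pt_nat (m x) \<in> rball omega (i x) (p x) (q x))"
  unfolding mem_rball by (intro comp_intros assms)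

lemma mem_nbhd_cylinder: "Pt_seq a \<in> nbhd baire (tuple3 c 1 L) \<longleftrightarrow> agrees a c (Suc L)"
  by (simp add: nbhd_rball mem_rball agrees_def)

lemma agrees_ex: "agrees a c (Suc n) \<Longrightarrow> entry c n = a n"
  by (simp add: agrees_def)

text \<open>The number c guesses the first \<open>Suc n\<close> values. Values are thereby reduced
  to positive facts about neighbourhoods, the form in which functions into \<open>baire\<close> are
  computed.\<close>

lemma value_iff_nbhd:
  "a n = v \<longleftrightarrow> (\<exists>c. entry c n = v \<and> Pt_seq a \<in> nbhd baire (tuple3 c 1 n))"
  unfolding mem_nbhd_cylinder
proof
  obtain c where "agrees a c (Suc n)" using exists_agrees by blast
  moreover assume "a n = v"
  ultimately show "\<exists>c. entry c n = v \<and> agrees a c (Suc n)"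
    using agrees_ex by blast
qed (auto dest: agrees_ex)

lemma nbhd_baire_unique:
  assumes "\<And>k. Pt_seq a \<in> nbhd baire k \<longleftrightarrow> Pt_seq b \<in> nbhd baire k"
  shows "a = b"
proof
  show "a n = b n" for n
    using value_iff_nbhd[of a n "b n"] value_iff_nbhd[of b n "b n"] assms by blast
qed

lemma eopen_value_of_nbhd:
  assumes "eopen (\<lambda>y p. Pt_seq (F y (fst p)) \<in> nbhd baire (snd p))"
  shows "eopen (\<lambda>y p. F y (fst p) (fst (snd p)) = snd (snd p))"
  by (subst value_iff_nbhd)
    (intro eopen_intros eopen_decidable comp_intros eopen_compose2[OF assms])

lemma computable_of_nbhd:
  assumes "semirec (\<lambda>p. Pt_seq (a (fst p)) \<in> nbhd baire (snd p))"
  shows "computable (\<lambda>p. a (fst p) (snd p))"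
proof (rule computable_graph)
  show "semirec (\<lambda>p. a (fst (fst p)) (snd (fst p)) = snd p)"
    by (subst value_iff_nbhd)
      (intro semirec_intros decidable_semirec comp_intros semirec_compose2[OF assms])
qed

lemma eopen_nbhd_baire:
  assumes "computable f"
  shows "eopen (\<lambda>y x. Pt_seq y \<in> nbhd baire (f x))"
  unfolding nbhd_rball by (intro edec_eopen edec_intros comp_intros assms)

text \<open>The neighbourhoods of a sequence enumerate its values, and conversely finitely many
  values decide a neighbourhood.\<close>

lemma recursive_seq_iff: "recursive_seq \<gamma> \<longleftrightarrow> computable \<gamma>"
proof
  assume "recursive_seq \<gamma>"
  then have "{Pt_nat k | k. Pt_seq \<gamma> \<in> nbhd baire k} \<in> Sigma01 omega"
    by (simp add: recursive_seq_def)
  then have "eopen (\<lambda>(y :: nat \<Rightarrow> nat) x. Pt_nat x \<in> {Pt_nat k | k. Pt_seq \<gamma> \<in> nbhd baire k})"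
    by (rule eopen_Sigma01[OF _ metric_omega])
      (unfold nbhd_rball, intro eopen_decidable comp_intros)
  then have "eopen (\<lambda>(y :: nat \<Rightarrow> nat) k. Pt_seq \<gamma> \<in> nbhd baire k)"
    by simp
  then have "semirec (\<lambda>k. Pt_seq \<gamma> \<in> nbhd baire k)"
    by (rule semirec_subst[of _ "\<lambda>_ _. 0"]) (rule computable_const)
  \<comment> \<open>A dummy argument is added, since \<open>computable_of_nbhd\<close> treats
    families of sequences.\<close>
  then have "semirec (\<lambda>p :: nat \<times> nat. Pt_seq \<gamma> \<in> nbhd baire (snd p))"
    by (rule semirec_compose) (intro comp_intros)
  then have "computable (\<lambda>p :: nat \<times> nat. \<gamma> (snd p))"
    by (rule computable_of_nbhd)
  then have "computable (\<lambda>k. \<gamma> (snd (0 :: nat, k)))"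
    by (rule computable_compose) (intro comp_intros)
  then show "computable \<gamma>" by simp
next
  assume \<gamma>: "computable \<gamma>"
  have N: "semirec (\<lambda>k. Pt_seq \<gamma> \<in> nbhd baire k)"
    using semirec_subst[OF eopen_nbhd_baire[OF computable_ident], of "\<lambda>_. \<gamma>"] \<gamma>
    by (simp add: computable_compose computable_snd computable_ident)
  \<comment> \<open>The index \<open>tuple3 k 1 0\<close> names the ball of radius 1 around k in
    \<open>omega\<close>, which is the singleton of k.\<close>
  have "semirec (\<lambda>s. \<exists>k. Pt_seq \<gamma> \<in> nbhd baire k \<and> s = tuple3 k 1 0)"
    by (intro semirec_intros semirec_compose[OF N] decidable_semirec comp_intros)
  moreover have "{Pt_nat k | k. Pt_seq \<gamma> \<in> nbhd baire k} =
      (\<Union>s\<in>{s. \<exists>k. Pt_seq \<gamma> \<in> nbhd baire k \<and> s = tuple3 k 1 0}. nbhd omega s)"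
    by (auto simp: nbhd_rball[of omega] rball_omega)
  ultimately show "recursive_seq \<gamma>"
    unfolding recursive_seq_def Sigma01_iff[OF metric_omega] by blast
qed

section \<open>Codes\<close>

lemma good_parametrizationD:
  assumes "good_parametrization G" "recursively_presented X"
  shows "G X \<in> Sigma01 (baire \<otimes> X)"
    and "\<And>P. P \<subseteq> points X \<Longrightarrow> P \<in> Sigma01 X \<Longrightarrow> \<exists>\<gamma>. recursive_seq \<gamma> \<and> P = sect G X \<gamma>"
proof -
  have *: "G X \<in> Sigma01 (baire \<otimes> X) \<and>
    (\<forall>P \<subseteq> points X. openin (top_of X) P \<longleftrightarrow> (\<exists>\<gamma>. P = sect G X \<gamma>)) \<and>
    (\<forall>P \<subseteq> points X. P \<in> Sigma01 X \<longleftrightarrow> (\<exists>\<gamma>. recursive_seq \<gamma> \<and> P = sect G X \<gamma>))"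
    using assms unfolding good_parametrization_def by simp
  from * show "G X \<in> Sigma01 (baire \<otimes> X)" by (elim conjE)
  from * have **: "\<forall>P \<subseteq> points X. P \<in> Sigma01 X \<longleftrightarrow> (\<exists>\<gamma>. recursive_seq \<gamma> \<and> P = sect G X \<gamma>)"
    by (elim conjE)
  show "\<exists>\<gamma>. recursive_seq \<gamma> \<and> P = sect G X \<gamma>" if "P \<subseteq> points X" "P \<in> Sigma01 X" for P
    using **[rule_format, OF that(1)] that(2) by simp
qed

lemma good_parametrization_smn:
  assumes "good_parametrization G" "type_le1 X" "recursively_presented Y"
  shows "\<exists>S. recursive_on (baire \<otimes> X) baire S (points (baire \<otimes> X)) \<and>
           (\<forall>\<gamma>. \<forall>x \<in> points X. \<forall>y \<in> points Y.
              Pt_pair (Pt_seq \<gamma>) (Pt_pair x y) \<in> G (X \<otimes> Y) \<longleftrightarrow>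
              Pt_pair (the (S (Pt_pair (Pt_seq \<gamma>) x))) y \<in> G Y)"
  using assms unfolding good_parametrization_def by (elim conjE) simp

lemma eopen_parametrization:
  assumes "good_parametrization G"
  shows "eopen (\<lambda>a p. Pt_pair (Pt_seq a) (Pt_pair (Pt_nat (fst p)) (Pt_nat (snd p))) \<in> G (omega \<otimes> omega))"
proof (rule eopen_Sigma01)
  show "G (omega \<otimes> omega) \<in> Sigma01 (baire \<otimes> (omega \<otimes> omega))"
    by (intro good_parametrizationD(1)[OF assms] recursively_presented_prod recursively_presented_omega)
  show "met_space (baire \<otimes> (omega \<otimes> omega))" by (intro met_intros)
  show "eopen (\<lambda>a p. Pt_pair (Pt_seq a) (Pt_pair (Pt_nat (fst (fst p))) (Pt_nat (snd (fst p))))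
      \<in> nbhd (baire \<otimes> (omega \<otimes> omega)) (snd p))"
    unfolding nbhd_rball mem_rball_prod[OF metric_baire metric_prod[OF metric_omega metric_omega]]
      mem_rball_prod[OF metric_omega metric_omega]
    by (intro edec_eopen edec_intros edec_decidable comp_intros)
qed

text \<open>Points of \<open>baire\<close> are determined by their neighbourhoods, so at most one
  \<beta> fits and the descriptions in \<open>named_fun\<close> can be eliminated.\<close>

lemma code_at_iff:
  "code_at G \<gamma> j \<beta> \<longleftrightarrow> (\<forall>k. Pt_seq \<beta> \<in> nbhd baire k \<longleftrightarrow>
     Pt_pair (Pt_seq (star \<gamma>)) (Pt_pair (Pt_nat j) (Pt_nat k)) \<in> G (omega \<otimes> omega))"
proof -
  let ?Q = "\<lambda>y. y \<in> points baire \<and> (\<forall>k. y \<in> nbhd baire k \<longleftrightarrow>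
     Pt_pair (Pt_seq (star \<gamma>)) (Pt_pair (Pt_nat j) (Pt_nat k)) \<in> G (omega \<otimes> omega))"
  have uniq: "y = y'" if "?Q y" "?Q y'" for y y'
  proof -
    obtain a a' where "y = Pt_seq a" "y' = Pt_seq a'" using \<open>?Q y\<close> \<open>?Q y'\<close> by auto
    then show ?thesis using \<open>?Q y\<close> \<open>?Q y'\<close> nbhd_baire_unique[of a a'] by simp
  qed
  have "code_at G \<gamma> j \<beta> \<longleftrightarrow> (\<exists>!y. ?Q y) \<and> (THE y. ?Q y) = Pt_seq \<beta>"
    unfolding code_at_def named_fun_def Let_def by auto
  also have "\<dots> \<longleftrightarrow> ?Q (Pt_seq \<beta>)"
  proof
    assume "(\<exists>!y. ?Q y) \<and> (THE y. ?Q y) = Pt_seq \<beta>"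
    then show "?Q (Pt_seq \<beta>)" using theI'[of ?Q] by (elim conjE) simp
  next
    assume Q: "?Q (Pt_seq \<beta>)"
    then have "(THE y. ?Q y) = Pt_seq \<beta>" by (intro the_equality uniq)
    moreover have "\<exists>!y. ?Q y" using Q by (intro ex1I[of ?Q] uniq)
    ultimately show "(\<exists>!y. ?Q y) \<and> (THE y. ?Q y) = Pt_seq \<beta>" by blast
  qed
  finally show ?thesis by simp
qed


subsection \<open>Tree codes\<close>

text \<open>The recursion theorem for codes: a code may refer to the codes of the children of a node of a
  computable tree, which need not be well-founded.\<close>

lemma tree_codes:
  fixes leaf :: "'n::coded \<Rightarrow> bool" and child :: "'n \<Rightarrow> nat \<Rightarrow> 'n" and lc :: "'n \<Rightarrow> nat \<Rightarrow> nat"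
  assumes G: "good_parametrization G" and leaf: "decidable leaf"
    and child: "computable (\<lambda>p. child (fst p) (snd p))" and lc: "computable (\<lambda>p. lc (fst p) (snd p))"
  obtains e :: "'n \<Rightarrow> nat \<Rightarrow> nat" where "computable (\<lambda>p. e (fst p) (snd p))"
    "\<And>t. leaf t \<Longrightarrow> e t 0 = 0" "\<And>t i. leaf t \<Longrightarrow> e t (Suc i) = lc t i"
    "\<And>t. \<not> leaf t \<Longrightarrow> e t 0 = 1" "\<And>t j. \<not> leaf t \<Longrightarrow> code_at G (e t) j (e (child t j))"
proof -
  let ?X = "baire \<otimes> omega" and ?Y = "omega \<otimes> omega"
  have rp: "recursively_presented ?Y" "recursively_presented (?X \<otimes> ?Y)"
    by (intro recursively_presented_prod recursively_presented_baire recursively_presented_omega)+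
  have met: "met_space ?X" "met_space ?Y" "met_space (baire \<otimes> ?X)"
    by (intro met_intros)+
  have "type_le1 ?X" by (intro type_le1.intros)
  from good_parametrization_smn[OF G this rp(1)]
  obtain S where S: "recursive_on (baire \<otimes> ?X) baire S (points (baire \<otimes> ?X))"
    and smn: "\<forall>\<gamma>. \<forall>x \<in> points ?X. \<forall>y \<in> points ?Y.
       Pt_pair (Pt_seq \<gamma>) (Pt_pair x y) \<in> G (?X \<otimes> ?Y) \<longleftrightarrow>
       Pt_pair (the (S (Pt_pair (Pt_seq \<gamma>) x))) y \<in> G ?Y"
    by (elim exE conjE)
  \<comment> \<open>The diagonal of the recursion theorem: \<sigma> is both an index and an argument
    of the relation that it indexes.\<close>
  let ?d = "\<lambda>\<sigma> t. Pt_pair (Pt_seq \<sigma>) (Pt_pair (Pt_seq \<sigma>) (Pt_nat t))"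
  have "dom S \<subseteq> points (baire \<otimes> ?X)" "ran S \<subseteq> points baire"
    using S unfolding recursive_on_wrt_def partial_fun_def by auto
  obtain P where P: "P \<in> Sigma01 ((baire \<otimes> ?X) \<otimes> omega)"
    and comp: "computes (baire \<otimes> ?X) baire S (points (baire \<otimes> ?X)) P"
    using S unfolding recursive_on_wrt_def by blast
  have d: "?d \<sigma> t \<in> points (baire \<otimes> ?X)" for \<sigma> t by auto
  have "\<exists>b. the (S (?d \<sigma> t)) = Pt_seq b" for \<sigma> t
  proof -
    have "?d \<sigma> t \<in> dom S" using comp d unfolding computes_def by blast
    then have "the (S (?d \<sigma> t)) \<in> ran S" by (auto simp: ran_def)
    then show ?thesis using \<open>ran S \<subseteq> points baire\<close> by auto
  qed
  then obtain s where s: "\<And>\<sigma> t. the (S (?d \<sigma> t)) = Pt_seq (s \<sigma> t)"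
    by metis
  have "Pt_seq (s \<sigma> t) \<in> nbhd baire k \<longleftrightarrow> Pt_pair (?d \<sigma> t) (Pt_nat k) \<in> P" for \<sigma> t k
    using comp d[of \<sigma> t] unfolding computes_def s[symmetric] by blast
  moreover have "eopen (\<lambda>\<sigma> p. Pt_pair (?d \<sigma> (fst p)) (Pt_nat (snd p)) \<in> P)"
  proof (rule eopen_Sigma01[OF P])
    show "met_space ((baire \<otimes> ?X) \<otimes> omega)" by (intro met_intros)
    show "eopen (\<lambda>\<sigma> p. Pt_pair (?d \<sigma> (fst (fst p))) (Pt_nat (snd (fst p)))
        \<in> nbhd ((baire \<otimes> ?X) \<otimes> omega) (snd p))"
      unfolding nbhd_rball mem_rball_prod[OF met(3) metric_omega] mem_rball_prod[OF metric_baire met(1)]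
        mem_rball_prod[OF metric_baire metric_omega]
      by (intro edec_eopen edec_intros edec_decidable comp_intros)
  qed
  ultimately have "eopen (\<lambda>\<sigma> p. Pt_seq (s \<sigma> (fst p)) \<in> nbhd baire (snd p))"
    by simp
  then have s_val: "eopen (\<lambda>\<sigma> p. s \<sigma> (fst p) (fst (snd p)) = snd (snd p))"
    by (rule eopen_value_of_nbhd)
  have s_val': "eopen (\<lambda>\<sigma> x. s \<sigma> (f x) (g x) = h x)"
    if "computable f" "computable g" "computable h" for f g and h :: "'x::coded \<Rightarrow> nat"
    using eopen_compose[OF s_val computable_Pair[OF that(1) computable_Pair[OF that(2,3)]]] by simp
  \<comment> \<open>The intended code of t on the assumption that \<sigma> indexes the relation
    \<open>?HS\<close> below. At an inner node its tail is the index that \<open>smn\<close> gives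
    for the section of that relation at \<sigma> and t.\<close>
  define E where "E \<sigma> t n = (if leaf t then (if n = 0 then 0 else lc t (n - 1))
      else if n = 0 then 1 else s \<sigma> (enc t) (n - 1))" for \<sigma> t n
  have "eopen (\<lambda>\<sigma> (p :: 'n \<times> nat \<times> nat).
      leaf (fst p) \<and> fst (snd p) = 0 \<and> snd (snd p) = 0 \<or>
      leaf (fst p) \<and> fst (snd p) \<noteq> 0 \<and> lc (fst p) (fst (snd p) - 1) = snd (snd p) \<or>
      \<not> leaf (fst p) \<and> fst (snd p) = 0 \<and> snd (snd p) = 1 \<or>
      \<not> leaf (fst p) \<and> fst (snd p) \<noteq> 0 \<and> s \<sigma> (enc (fst p)) (fst (snd p) - 1) = snd (snd p))"
    by (intro eopen_disj eopen_conj s_val' eopen_decidable decidable_not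
        decidable_compose[OF leaf] computable_compose2[OF lc] comp_intros)
  then have E_val: "eopen (\<lambda>\<sigma> p. E \<sigma> (fst p) (fst (snd p)) = snd (snd p))"
    by (rule eopen_cong) (auto simp: E_def)
  have E_val': "eopen (\<lambda>\<sigma> x. E \<sigma> (f x) (g x) = h x)"
    if "computable f" "computable g" "computable h" for f g and h :: "'x::coded \<Rightarrow> nat"
    using eopen_compose[OF E_val computable_Pair[OF that(1) computable_Pair[OF that(2,3)]]] by simp
  let ?H = "\<lambda>\<sigma> x. Pt_seq (E \<sigma> (child (dec (fst x)) (fst (snd x)))) \<in> nbhd baire (snd (snd x))"
  have H: "eopen ?H"
    by (rule eopen_subst[of "\<lambda>y x. Pt_seq y \<in> nbhd baire (snd (snd x))"
          "\<lambda>\<sigma> x. E \<sigma> (child (dec (fst x)) (fst (snd x)))"])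
      (intro eopen_nbhd_baire comp_intros, intro E_val' computable_compose2[OF child] comp_intros)
  let ?\<phi> = "\<lambda>\<sigma> x. Pt_pair (Pt_pair (Pt_seq \<sigma>) (Pt_nat (fst x)))
      (Pt_pair (Pt_nat (fst (snd x))) (Pt_nat (snd (snd x))))"
  let ?HS = "{?\<phi> \<sigma> x | \<sigma> x. ?H \<sigma> x}"
  have HS: "?HS \<in> Sigma01 (?X \<otimes> ?Y)"
  proof (rule Sigma01_cylinders[OF _ H])
    \<comment> \<open>The radius \<open>1 / (L + 1)\<close> is at most 1, so the ball fixes the
      three numbers exactly, together with \<open>Suc L\<close> values of \<sigma>.\<close>
    let ?code = "\<lambda>p. tuple3 (tuple2 (tuple2 (fst p) (fst (snd (snd p))))
        (tuple2 (fst (snd (snd (snd p)))) (snd (snd (snd (snd p)))))) 1 (fst (snd p))"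
    show "met_space (?X \<otimes> ?Y)" by (intro met_intros)
    show "computable ?code" by (intro comp_intros)
    show "nbhd (?X \<otimes> ?Y) (?code (c, L, x)) = {?\<phi> y x | y. agrees y c (Suc L)}" for c L x
      by (auto simp: nbhd_rball rball_prod[OF met(1,2)] rball_prod[OF metric_baire metric_omega]
          rball_prod[OF metric_omega metric_omega] rball_baire rball_omega agrees_def)
  qed
  have "?HS \<subseteq> points (?X \<otimes> ?Y)" by auto
  from good_parametrizationD(2)[OF G rp(2) this HS]
  obtain \<epsilon> where \<epsilon>: "recursive_seq \<epsilon>" "?HS = sect G (?X \<otimes> ?Y) \<epsilon>"
    by (elim exE conjE)
  \<comment> \<open>The fixed point: \<sigma> becomes the index \<epsilon> of \<open>?HS\<close>, so
    that the section of \<open>?HS\<close> at \<epsilon> speaks about the codes \<open>e\<close>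
    themselves.\<close>
  define e where "e = E \<epsilon>"
  have "code_at G (e t) j (e (child t j))" if "\<not> leaf t" for t j
    unfolding code_at_iff
  proof
    fix k
    have "star (e t) = s \<epsilon> (enc t)"
      using that by (auto simp: e_def E_def star_def)
    then have "Pt_pair (Pt_seq (star (e t))) (Pt_pair (Pt_nat j) (Pt_nat k)) \<in> G ?Y \<longleftrightarrow>
        Pt_pair (the (S (?d \<epsilon> (enc t)))) (Pt_pair (Pt_nat j) (Pt_nat k)) \<in> G ?Y"
      by (simp only: s)
    also have "\<dots> \<longleftrightarrow> Pt_pair (Pt_seq \<epsilon>) (?\<phi> \<epsilon> (enc t, j, k)) \<in> G (?X \<otimes> ?Y)"
      using smn[rule_format, of "Pt_pair (Pt_seq \<epsilon>) (Pt_nat (enc t))" "Pt_pair (Pt_nat j) (Pt_nat k)" \<epsilon>] by simp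
    also have "\<dots> \<longleftrightarrow> ?\<phi> \<epsilon> (enc t, j, k) \<in> ?HS"
      unfolding \<epsilon>(2) sect_def by simp
    also have "\<dots> \<longleftrightarrow> Pt_seq (e (child t j)) \<in> nbhd baire k"
      by (auto simp: e_def)
    finally show "Pt_seq (e (child t j)) \<in> nbhd baire k \<longleftrightarrow>
        Pt_pair (Pt_seq (star (e t))) (Pt_pair (Pt_nat j) (Pt_nat k)) \<in> G ?Y" by simp
  qed
  moreover have "computable (\<lambda>p. e (fst p) (snd p))"
  proof (rule computable_graph)
    have "eopen (\<lambda>\<sigma> p. E \<sigma> (fst (fst p)) (snd (fst p)) = snd p)"
      by (intro E_val' comp_intros)
    then show "semirec (\<lambda>p. e (fst (fst p)) (snd (fst p)) = snd p)"
      unfolding e_def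
      by (rule semirec_subst[of _ "\<lambda>_. \<epsilon>"])
        (use \<epsilon>(1) in \<open>simp add: recursive_seq_iff computable_compose computable_snd computable_ident\<close>)
  qed
  moreover have "e t 0 = 0" "e t (Suc i) = lc t i" if "leaf t" for t i
    using that by (simp_all add: e_def E_def)
  moreover have "e t 0 = 1" if "\<not> leaf t" for t
    using that by (simp add: e_def E_def)
  ultimately show thesis
    using that[of e] by blast
qed

text \<open>Each \<open>b s\<close> is an infinite sequence, so the iteration is run on its finite
  segments, given by pairs (c, L). The hypothesis \<open>step\<close> makes a segment of the next
  sequence an open condition on the present one.\<close>

lemma computable_iterated:
  fixes b :: "nat list \<Rightarrow> nat \<Rightarrow> nat"
  assumes "computable (b [])" and \<Psi>: "eopen \<Psi>"
    and step: "\<And>j s c L. agrees (b (j # s)) c L \<longleftrightarrow> \<Psi> (b s) (j, c, L)"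
  shows "computable (\<lambda>p. b (fst p) (snd p))"
proof -
  obtain T where T: "semirec T" "\<And>y x. \<Psi> y x \<longleftrightarrow> (\<exists>c L. agrees y c L \<and> T (c, L, x))"
    using \<Psi> unfolding eopen_def by blast
  let ?K = "\<lambda>s u. agrees (b s) (fst u) (snd u)"
  have K: "semirec (\<lambda>p. ?K (fst p) (snd p))"
  proof (rule semirec_list_iteration)
    show "semirec (?K [])"
      by (intro decidable_semirec comp_intros computable_compose[OF assms(1)])
    show "semirec (\<lambda>p. T (fst (fst p), snd (fst p), fst (snd p), fst (snd (snd p)), snd (snd (snd p))))"
      by (intro semirec_compose[OF T(1)] comp_intros)
    show "?K (j # s) u \<longleftrightarrow> (\<exists>v. ?K s v \<and>
       (\<lambda>p. T (fst (fst p), snd (fst p), fst (snd p), fst (snd (snd p)), snd (snd (snd p)))) (v, j, u))"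
      for j s u
      by (cases u) (simp add: step T(2))
  qed
  have "semirec (\<lambda>p. \<exists>c. entry c (snd (fst p)) = snd p \<and>
      ?K (fst (fst p)) (c, Suc (snd (fst p))))"
    by (intro semirec_intros decidable_semirec comp_intros semirec_compose2[OF K])
  then have "semirec (\<lambda>p. b (fst (fst p)) (snd (fst p)) = snd p)"
    unfolding fst_conv snd_conv
    by (rule semirec_cong) (rule value_iff_nbhd[unfolded mem_nbhd_cylinder, symmetric])
  then show ?thesis by (rule computable_graph)
qed

subsection \<open>The tree of subcodes of a Borel code\<close>

text \<open>Paths are listed from the node to the root.  The path is continued below a leaf by the code
  of the empty set, since \<open>nbhd X 0 = {}\<close>.\<close>

fun subcode :: "parametrization \<Rightarrow> (nat \<Rightarrow> nat) \<Rightarrow> nat list \<Rightarrow> nat \<Rightarrow> nat" where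
  "subcode G \<gamma> [] = \<gamma>"
| "subcode G \<gamma> (j # s) =
    (if subcode G \<gamma> s 0 = 0 then (\<lambda>_. 0) else (THE \<beta>. code_at G (subcode G \<gamma> s) j \<beta>))"

lemma subcode_step:
  assumes "subcode G \<gamma> s \<in> BC_at G \<xi>"
  shows "subcode G \<gamma> s 0 = 0 \<and> \<xi> = 1 \<or>
    subcode G \<gamma> s 0 = 1 \<and> osuc 1 \<le> \<xi> \<and>
    (\<forall>j. code_at G (subcode G \<gamma> s) j (subcode G \<gamma> (j # s)) \<and>
         (\<exists>\<eta>. 1 \<le> \<eta> \<and> \<eta> < \<xi> \<and> subcode G \<gamma> (j # s) \<in> BC_at G \<eta>))"
proof -
  have "(\<xi>, subcode G \<gamma> s) \<in> BC_level G" using assms by (simp add: BC_at_def)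
  then show ?thesis
  proof cases
    case 2
    have "code_at G (subcode G \<gamma> s) j (subcode G \<gamma> (j # s)) \<and>
         (\<exists>\<eta>. 1 \<le> \<eta> \<and> \<eta> < \<xi> \<and> subcode G \<gamma> (j # s) \<in> BC_at G \<eta>)" for j
    proof -
      obtain \<beta> \<eta> where \<beta>: "code_at G (subcode G \<gamma> s) j \<beta>" "1 \<le> \<eta>" "\<eta> < \<xi>" "(\<eta>, \<beta>) \<in> BC_level G"
        using 2 by meson
      moreover have "subcode G \<gamma> (j # s) = \<beta>"
        using 2 \<beta>(1) by (auto intro!: the_equality dest: code_at_unique)
      ultimately show ?thesis by (auto simp: BC_at_def)
    qed
    with 2 show ?thesis by simp
  qed simp
qed

text \<open>Below a leaf the path continues with the zero sequence, which is a code of level 1; so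
  every node carries a genuine code.\<close>

lemma subcode_BC:
  assumes "\<gamma> \<in> BC_at G \<xi>"
  shows "\<exists>\<eta>\<ge>1. subcode G \<gamma> s \<in> BC_at G \<eta>"
proof (induction s)
  case Nil
  have "1 \<le> \<xi>"
    using assms osuc_greater[of 1] unfolding BC_at_def by (auto elim!: BC_level.cases)
  with assms show ?case by auto
next
  case (Cons j s)
  then obtain \<eta> where \<eta>: "subcode G \<gamma> s \<in> BC_at G \<eta>" by blast
  show ?case
  proof (cases "subcode G \<gamma> s 0 = 0")
    case True
    then show ?thesis by (intro exI[of _ 1]) (simp add: BC_at_one)
  next
    case False
    with subcode_step[OF \<eta>] show ?thesis by blast
  qed
qed

lemma computable_subcode:
  assumes G: "good_parametrization G" and \<gamma>: "computable \<gamma>" "\<gamma> \<in> BC_at G \<xi>"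
  shows "computable (\<lambda>p. subcode G \<gamma> (fst p) (snd p))"
proof (rule computable_iterated)
  let ?g = "\<lambda>a j k. Pt_pair (Pt_seq a) (Pt_pair (Pt_nat j) (Pt_nat k)) \<in> G (omega \<otimes> omega)"
  \<comment> \<open>At an inner node a segment of the next code is found by guessing a segment d
    that is longer by one and asking the parametrization whether the next code lies in the cylinder
    of d. The extra value makes the length positive, as cylinders that are balls require.\<close>
  let ?\<Psi> = "\<lambda>a x. a 0 = 0 \<and> agrees (\<lambda>_. 0) (fst (snd x)) (snd (snd x)) \<or>
     (\<not> a 0 = 0) \<and> (\<exists>d. agrees (entry d) (fst (snd x)) (snd (snd x)) \<and>
        ?g (star a) (fst x) (tuple3 d 1 (snd (snd x))))"
  show "computable (subcode G \<gamma> [])" using \<gamma>(1) by simp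
  have star: "eopen (\<lambda>a p. P (star a) p)" if "eopen P" for P :: "_ \<Rightarrow> 'x::coded \<Rightarrow> bool"
    by (rule eopen_subst[OF that]) (unfold star_def, intro eopen_intros comp_intros)
  show "eopen ?\<Psi>"
    by (intro eopen_intros eopen_decidable comp_intros edec_eopen[OF edec_not] edec_intros
        eopen_compose2[OF star[OF eopen_parametrization[OF G]]])
  show "agrees (subcode G \<gamma> (j # s)) c L \<longleftrightarrow> ?\<Psi> (subcode G \<gamma> s) (j, c, L)" for j s c L
  proof (cases "subcode G \<gamma> s 0 = 0")
    case False
    obtain \<eta> where "subcode G \<gamma> s \<in> BC_at G \<eta>" using subcode_BC[OF \<gamma>(2)] by blast
    from subcode_step[OF this] False
    have "code_at G (subcode G \<gamma> s) j (subcode G \<gamma> (j # s))" by simp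
    then have g: "?g (star (subcode G \<gamma> s)) j (tuple3 d 1 L) \<longleftrightarrow>
        agrees (subcode G \<gamma> (j # s)) d (Suc L)" for d
      unfolding code_at_iff using mem_nbhd_cylinder[of _ d L] by blast
    have eq: "agrees (subcode G \<gamma> (j # s)) c L \<longleftrightarrow>
        (\<exists>d. agrees (entry d) c L \<and> agrees (subcode G \<gamma> (j # s)) d (Suc L))"
    proof
      assume c: "agrees (subcode G \<gamma> (j # s)) c L"
      obtain d where d: "agrees (subcode G \<gamma> (j # s)) d (Suc L)" using exists_agrees by blast
      have "agrees (entry d) c L"
        by (rule agrees_weaken[OF d, THEN iffD2]) (use c in simp_all)
      with d show "\<exists>d. agrees (entry d) c L \<and> agrees (subcode G \<gamma> (j # s)) d (Suc L)" by blast
    next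
      assume "\<exists>d. agrees (entry d) c L \<and> agrees (subcode G \<gamma> (j # s)) d (Suc L)"
      then obtain d where d: "agrees (entry d) c L" "agrees (subcode G \<gamma> (j # s)) d (Suc L)" by blast
      show "agrees (subcode G \<gamma> (j # s)) c L"
        by (rule agrees_weaken[OF d(2), THEN iffD1]) (use d(1) in simp_all)
    qed
    show ?thesis
      unfolding fst_conv snd_conv g eq by (simp only: False simp_thms)
  qed simp
qed


section \<open>The canonical witnesses for membership\<close>

definition binary_seq :: "(nat \<Rightarrow> nat) \<Rightarrow> bool" where
  "binary_seq a \<longleftrightarrow> (\<forall>n. a n \<in> {0, 1})"

text \<open>Membership in a basic neighbourhood of \<open>cantor\<close>, with the demand that a be
  binary split off. What remains concerns finitely many values and is effectively clopen on all of
  \<open>baire\<close>.\<close>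

definition in_cyl :: "(nat \<Rightarrow> nat) \<Rightarrow> nat \<Rightarrow> bool" where
  "in_cyl a k \<longleftrightarrow> 0 < entry k 1 \<and>
     (\<forall>n<(entry k 2 + 1) div entry k 1. a n = min 1 (entry (entry k 0) n))"

lemma mem_nbhd_cantor: "Pt_seq a \<in> nbhd cantor k \<longleftrightarrow> binary_seq a \<and> in_cyl a k"
  by (simp add: nbhd_rball mem_rball binary_seq_def in_cyl_def)

lemma points_cantor: "Pt_seq a \<in> points cantor \<longleftrightarrow> binary_seq a"
  by (auto simp: binary_seq_def)

lemma computable_min [comp_intros]:
  assumes "computable f" "computable g"
  shows "computable (\<lambda>x. min (f x) (g x :: nat))"
  unfolding min_def by (intro comp_intros assms)

lemma edec_in_cyl:
  assumes "computable f"
  shows "edec (\<lambda>y x. in_cyl y (f x))"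
  unfolding in_cyl_def
  by (intro edec_intros edec_decidable comp_intros assms computable_compose[OF assms])

section \<open>A sequence as a pair of a point and a labelling of paths\<close>

definition left :: "(nat \<Rightarrow> nat) \<Rightarrow> nat \<Rightarrow> nat" where
  "left y n = y (2 * n)"

definition right :: "(nat \<Rightarrow> nat) \<Rightarrow> nat list \<Rightarrow> nat" where
  "right y s = y (2 * enc s + 1)"

definition join :: "(nat \<Rightarrow> nat) \<Rightarrow> (nat list \<Rightarrow> nat) \<Rightarrow> nat \<Rightarrow> nat" where
  "join a w n = (if even n then a (n div 2) else w (dec (n div 2)))"

lemma left_join [simp]: "left (join a w) = a"
  by (auto simp: left_def join_def)

lemma right_join [simp]: "right (join a w) = w"
  by (auto simp: right_def join_def)

lemma join_left_right [simp]: "join (left y) (right y) = y"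
proof
  show "join (left y) (right y) n = y n" for n
    using odd_two_times_div_two_succ[of n] by (simp add: left_def right_def join_def)
qed

lemma edec_in_cyl_left:
  assumes "computable f"
  shows "edec (\<lambda>y x. in_cyl (left y) (f x))"
  unfolding in_cyl_def left_def
  by (intro edec_intros edec_decidable comp_intros assms computable_compose[OF assms])

lemma edec_if:
  assumes "decidable D" "edec P" "edec Q"
  shows "edec (\<lambda>y x. if D x then P y x else Q y x)"
proof -
  have "edec (\<lambda>y x. D x \<and> P y x \<or> \<not> D x \<and> Q y x)"
    by (intro edec_intros edec_decidable assms)
  moreover have "(if D x then P y x else Q y x) \<longleftrightarrow> D x \<and> P y x \<or> \<not> D x \<and> Q y x" for x y
    by simp
  ultimately show ?thesis by simp
qed

lemma Sigma01_subset_Sigma0: "A \<in> Sigma01 X \<Longrightarrow> A \<in> Sigma0 G 1 X"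
proof -
  assume "A \<in> Sigma01 X"
  then obtain \<epsilon> :: "nat \<Rightarrow> nat" where \<epsilon>: "computable \<epsilon>" "A = (\<Union>i. nbhd X (\<epsilon> i))"
    unfolding Sigma01_def computable_nat_iff by blast
  let ?\<gamma> = "\<lambda>n. if n = 0 then 0 else \<epsilon> (n - 1)"
  have "computable ?\<gamma>"
    by (intro comp_intros computable_compose[OF \<epsilon>(1)])
  moreover have "?\<gamma> \<in> BC_at G 1" by (simp add: BC_at_one)
  moreover have "rho G X ?\<gamma> = A"
    using rho_base[of ?\<gamma> G X] by (simp add: BC_at_one \<epsilon>(2) star_def)
  ultimately show ?thesis
    unfolding Sigma0_def recursive_seq_iff by blast
qed

section \<open>The tree of a fixed code and its canonical witnesses\<close>

locale borel_tree =
  fixes G :: parametrization and \<xi> :: omega1 and \<gamma> :: "nat \<Rightarrow> nat"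
  assumes G: "good_parametrization G" and one_le: "1 \<le> \<xi>"
    and computable_root: "computable \<gamma>" and BC_root: "\<gamma> \<in> BC_at G (osuc \<xi>)"
begin

abbreviation b :: "nat list \<Rightarrow> nat \<Rightarrow> nat" where "b \<equiv> subcode G \<gamma>"

definition leaf :: "nat list \<Rightarrow> bool" where "leaf s \<longleftrightarrow> b s 0 = 0"

definition holds :: "(nat \<Rightarrow> nat) \<Rightarrow> nat list \<Rightarrow> bool" where
  "holds a s \<longleftrightarrow> Pt_seq a \<in> rho G cantor (b s)"

definition wit :: "(nat \<Rightarrow> nat) \<Rightarrow> nat list \<Rightarrow> nat \<Rightarrow> bool" where
  "wit a s i \<longleftrightarrow> (if leaf s then in_cyl a (b s (Suc i)) else \<not> holds a (i # s))"

lemma level_ex: "\<exists>\<eta>\<ge>1. b s \<in> BC_at G \<eta>"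
  using subcode_BC[OF BC_root] .

lemma nonleaf_level:
  assumes "\<not> leaf s" "b s \<in> BC_at G \<eta>"
  shows "b s 0 = 1" "osuc 1 \<le> \<eta>" "code_at G (b s) j (b (j # s))"
    "\<exists>\<theta>. 1 \<le> \<theta> \<and> \<theta> < \<eta> \<and> b (j # s) \<in> BC_at G \<theta>"
  using subcode_step[OF assms(2)] assms(1) unfolding leaf_def by blast+

lemma leaf_level: "leaf s \<Longrightarrow> b s \<in> BC_at G 1"
  by (simp add: leaf_def BC_at_one)

lemma level_one_leaf: "b s \<in> BC_at G 1 \<Longrightarrow> leaf s"
  by (simp add: leaf_def BC_at_one)

lemma leaf_child: "leaf s \<Longrightarrow> b (j # s) = (\<lambda>_. 0)"
  by (simp add: leaf_def)

lemma nonleaf_root: "\<not> leaf []"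
  using subcode_step[of G \<gamma> "[]" "osuc \<xi>"] BC_root osuc_greater[of \<xi>] one_le
  by (auto simp: leaf_def)

text \<open>A sequence that is not binary can satisfy conditions \<open>in_cyl\<close> without being
  a point of \<open>cantor\<close>, hence the assumption.\<close>

lemma holds_iff:
  assumes "binary_seq a"
  shows "holds a s \<longleftrightarrow> (\<exists>i. wit a s i)"
proof (cases "leaf s")
  case True
  then have "holds a s \<longleftrightarrow> (\<exists>i. Pt_seq a \<in> nbhd cantor (b s (Suc i)))"
    unfolding holds_def by (simp add: rho_base[OF leaf_level] star_def)
  then show ?thesis using True assms by (simp add: mem_nbhd_cantor wit_def)
next
  case False
  obtain \<eta> where \<eta>: "1 \<le> \<eta>" "b s \<in> BC_at G \<eta>" using level_ex by blast
  then have "b s \<in> BC G" by (auto simp: BC_def)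
  moreover have "b s \<notin> BC_at G 1" using False level_one_leaf by blast
  moreover have "code_at G (b s) j (b (j # s))" for j by (rule nonleaf_level[OF False \<eta>(2)])
  ultimately have "rho G cantor (b s) = (\<Union>j. points cantor - rho G cantor (b (j # s)))"
    by (rule rho_step)
  then show ?thesis
    using False assms points_cantor[of a] unfolding holds_def wit_def by auto
qed

definition witness :: "(nat \<Rightarrow> nat) \<Rightarrow> nat list \<Rightarrow> nat" where
  "witness a s = (if holds a s then Suc (LEAST i. wit a s i) else 0)"

definition wit_by :: "(nat \<Rightarrow> nat) \<Rightarrow> (nat list \<Rightarrow> nat) \<Rightarrow> nat list \<Rightarrow> nat \<Rightarrow> bool" where
  "wit_by a w s i \<longleftrightarrow> (if leaf s then in_cyl a (b s (Suc i)) else w (i # s) = 0)"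

text \<open>Only w at s and at its children is consulted. The first conjunct is universal in i, and
  the second is a finite check once the value of \<open>w s\<close> is known, so the whole condition
  is closed.\<close>

definition correct :: "(nat \<Rightarrow> nat) \<Rightarrow> (nat list \<Rightarrow> nat) \<Rightarrow> nat list \<Rightarrow> bool" where
  "correct a w s \<longleftrightarrow> (w s = 0 \<longrightarrow> (\<forall>i. \<not> wit_by a w s i)) \<and>
     (\<forall>n. w s = Suc n \<longrightarrow> wit_by a w s n \<and> (\<forall>m<n. \<not> wit_by a w s m))"

lemma witness_eq_0: "witness a s = 0 \<longleftrightarrow> \<not> holds a s"
  by (simp add: witness_def)

lemma witness_eq_Suc:
  assumes "binary_seq a"
  shows "witness a s = Suc n \<longleftrightarrow> wit a s n \<and> (\<forall>m<n. \<not> wit a s m)"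
proof
  assume w: "witness a s = Suc n"
  then have "holds a s" by (metis witness_eq_0 nat.distinct(1))
  then have "\<exists>i. wit a s i" using holds_iff[OF assms] by blast
  then have "wit a s (LEAST i. wit a s i)" by (rule LeastI_ex)
  moreover have "n = (LEAST i. wit a s i)" using w \<open>holds a s\<close> by (simp add: witness_def)
  ultimately show "wit a s n \<and> (\<forall>m<n. \<not> wit a s m)" using not_less_Least by blast
next
  assume *: "wit a s n \<and> (\<forall>m<n. \<not> wit a s m)"
  then have "(LEAST i. wit a s i) = n" by (intro Least_equality) (auto simp: not_less[symmetric])
  moreover have "holds a s" using * holds_iff[OF assms] by blast
  ultimately show "witness a s = Suc n" by (simp add: witness_def)
qed

lemma correct_witness:
  assumes "binary_seq a"
  shows "correct a (witness a) s"
proof -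
  have "wit_by a (witness a) s i \<longleftrightarrow> wit a s i" for i
    by (simp add: wit_by_def wit_def witness_eq_0)
  then show ?thesis
    unfolding correct_def witness_eq_Suc[OF assms] witness_eq_0 using holds_iff[OF assms] by blast
qed

lemma correct_unique:
  assumes "binary_seq a" "\<And>s. correct a w s"
  shows "w s = witness a s"
proof -
  have "b s \<in> BC_at G \<eta> \<Longrightarrow> w s = witness a s" for \<eta>
  proof (induction \<eta> arbitrary: s rule: less_induct)
    case (less \<eta>)
    \<comment> \<open>At a leaf no child is consulted; at an inner node the children have smaller
      level, where the induction hypothesis applies.\<close>
    have "wit_by a w s i \<longleftrightarrow> wit a s i" for i
    proof (cases "leaf s")
      case False
      then obtain \<theta> where "\<theta> < \<eta>" "b (i # s) \<in> BC_at G \<theta>"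
        using nonleaf_level(4)[OF False less.prems] by blast
      then have "w (i # s) = witness a (i # s)" by (rule less.IH)
      with False show ?thesis by (simp add: wit_by_def wit_def witness_eq_0)
    qed (simp add: wit_by_def wit_def)
    then have *: "w s = 0 \<Longrightarrow> \<not> wit a s i" "w s = Suc n \<Longrightarrow> wit a s n \<and> (\<forall>m<n. \<not> wit a s m)" for i n
      using assms(2)[of s] unfolding correct_def by blast+
    show ?case
    proof (cases "w s")
      case 0
      then have "\<not> holds a s" using *(1) holds_iff[OF assms(1)] by blast
      with 0 show ?thesis by (simp add: witness_def)
    next
      case (Suc n)
      then have "witness a s = Suc n" using *(2) witness_eq_Suc[OF assms(1)] by blast
      with Suc show ?thesis by simp
    qed
  qed
  then show ?thesis using level_ex by blast
qed

lemma computable_b [comp_intros]: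
  assumes "computable f" "computable g"
  shows "computable (\<lambda>x. b (f x) (g x))"
  by (rule computable_compose2[OF computable_subcode[OF G computable_root BC_root] assms])

lemma decidable_leaf [comp_intros]: "computable f \<Longrightarrow> decidable (\<lambda>x. leaf (f x))"
  unfolding leaf_def by (intro comp_intros)

section \<open>The closed set, its projection onto B and the inverse\<close>

definition base :: "pt set" where
  "base = points cantor - rho G cantor \<gamma>"

definition cover :: "pt set" where
  "cover = {Pt_seq y | y. binary_seq (left y) \<and> (\<forall>s. correct (left y) (right y) s) \<and> right y [] = 0}"

definition proj :: "pt \<rightharpoonup> pt" where
  "proj x = (if x \<in> cover then Some (Pt_seq (left (THE y. x = Pt_seq y))) else None)"

definition lift :: "pt \<rightharpoonup> pt" where
  "lift x = (if x \<in> base then let a = (THE a. x = Pt_seq a) in Some (Pt_seq (join a (witness a))) else None)"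

lemma base_iff: "Pt_seq a \<in> base \<longleftrightarrow> binary_seq a \<and> \<not> holds a []"
  unfolding base_def holds_def subcode.simps Diff_iff points_cantor ..

lemma base_E: "x \<in> base \<Longrightarrow> \<exists>a. x = Pt_seq a \<and> binary_seq a \<and> \<not> holds a []"
proof -
  assume x: "x \<in> base"
  then have "x \<in> points cantor" unfolding base_def by (rule DiffD1)
  then obtain a where "x = Pt_seq a" by auto
  with x show ?thesis using base_iff[of a] by blast
qed

lemma cover_iff: "Pt_seq y \<in> cover \<longleftrightarrow> (\<exists>a. Pt_seq a \<in> base \<and> y = join a (witness a))"
proof
  assume "Pt_seq y \<in> cover"
  then have y: "binary_seq (left y)" "\<And>s. correct (left y) (right y) s" "right y [] = 0"
    by (auto simp: cover_def)
  have r: "right y = witness (left y)" by (rule HOL.ext) (rule correct_unique[OF y(1,2)])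
  have "y = join (left y) (witness (left y))"
    using join_left_right[of y, symmetric] unfolding r .
  moreover have "Pt_seq (left y) \<in> base"
    using y(1,3) unfolding base_iff r by (simp add: witness_eq_0)
  ultimately show "\<exists>a. Pt_seq a \<in> base \<and> y = join a (witness a)" by blast
next
  assume "\<exists>a. Pt_seq a \<in> base \<and> y = join a (witness a)"
  then obtain a where a: "binary_seq a" "\<not> holds a []" "y = join a (witness a)"
    unfolding base_iff by blast
  have "\<forall>s. correct a (witness a) s" using correct_witness[OF a(1)] by blast
  then show "Pt_seq y \<in> cover"
    using a by (simp add: cover_def witness_eq_0)
qed

lemma cover_E: "x \<in> cover \<Longrightarrow> \<exists>a. Pt_seq a \<in> base \<and> x = Pt_seq (join a (witness a))"
proof -
  assume x: "x \<in> cover"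
  then obtain y where "x = Pt_seq y" by (auto simp: cover_def)
  with x show ?thesis using cover_iff by blast
qed

lemma proj_join: "Pt_seq a \<in> base \<Longrightarrow> proj (Pt_seq (join a (witness a))) = Some (Pt_seq a)"
  using cover_iff by (auto simp: proj_def)

lemma lift_base: "Pt_seq a \<in> base \<Longrightarrow> lift (Pt_seq a) = Some (Pt_seq (join a (witness a)))"
  by (simp add: lift_def)

lemma bij_proj: "bij_betw (\<lambda>x. the (proj x)) cover base"
proof (rule bij_betw_byWitness[where f' = "\<lambda>x. the (lift x)"])
  show "\<forall>x\<in>cover. the (lift (the (proj x))) = x"
    by (auto dest!: cover_E simp: proj_join lift_base)
  show "\<forall>x\<in>base. the (proj (the (lift x))) = x"
  proof
    fix x assume x: "x \<in> base"
    then obtain a where "x = Pt_seq a" using base_E by blast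
    with x show "the (proj (the (lift x))) = x" by (simp add: proj_join lift_base)
  qed
  show "(\<lambda>x. the (proj x)) ` cover \<subseteq> base"
    by (auto dest!: cover_E simp: proj_join)
  show "(\<lambda>x. the (lift x)) ` base \<subseteq> cover"
  proof
    fix z assume "z \<in> (\<lambda>x. the (lift x)) ` base"
    then obtain x where x: "x \<in> base" "z = the (lift x)" by blast
    then obtain a where "x = Pt_seq a" using base_E by blast
    with x show "z \<in> cover" using cover_iff by (auto simp: lift_base)
  qed
qed

lemma lift_inverse:
  assumes "y \<in> base"
  shows "the (lift y) = the_inv_into cover (\<lambda>x. the (proj x)) y"
proof -
  obtain a where a: "y = Pt_seq a" using assms base_E by blast
  have "Pt_seq (join a (witness a)) \<in> cover" "the (proj (Pt_seq (join a (witness a)))) = y"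
    using assms cover_iff by (auto simp: a proj_join)
  then show ?thesis
    using the_inv_into_f_eq[OF bij_betw_imp_inj_on[OF bij_proj], of "Pt_seq (join a (witness a))" y]
      assms by (simp add: a lift_base)
qed

lemma cover_Pi0: "cover \<in> Pi0 G 1 baire"
proof -
  \<comment> \<open>The complement of the closed set, with negations pushed inwards until only
    existential quantifiers over clopen conditions remain.\<close>
  define V where "V y \<longleftrightarrow> (\<exists>n. \<not> (left y n = 0 \<or> left y n = 1)) \<or> \<not> right y [] = 0 \<or>
    (\<exists>s. (right y s = 0 \<and> (\<exists>i. wit_by (left y) (right y) s i)) \<or>
      (\<exists>n. right y s = Suc n \<and> (\<not> wit_by (left y) (right y) s n \<or>
         (\<exists>m<n. wit_by (left y) (right y) s m))))" for y
  have W: "edec (\<lambda>y x. wit_by (left y) (right y) (f x) (g x))"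
    if "computable f" "computable g" for f and g :: "'x::coded \<Rightarrow> nat"
    unfolding wit_by_def right_def
    by (intro edec_if edec_in_cyl_left edec_intros comp_intros that)
  \<comment> \<open>The argument x is a dummy, because \<open>eopen\<close> relations have a
    discrete argument.\<close>
  have "eopen (\<lambda>y (x :: nat). V y)"
    unfolding V_def right_def left_def
    by (intro eopen_intros edec_eopen W[unfolded left_def right_def] edec_intros edec_decidable comp_intros)
  then have "{Pt_seq y | y (x :: nat). V y} \<in> Sigma01 baire"
    by (rule Sigma01_cylinders[OF metric_baire, where code = "\<lambda>p. tuple3 (fst p) 1 (fst (snd p))"])
      (intro comp_intros, auto simp: nbhd_rball rball_baire agrees_def)
  then have "{Pt_seq y | y (x :: nat). V y} \<in> Sigma0 G 1 baire"
    by (rule Sigma01_subset_Sigma0)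
  moreover have "cover = points baire - {Pt_seq y | y (x :: nat). V y}"
  proof -
    have "(binary_seq (left y) \<and> (\<forall>s. correct (left y) (right y) s) \<and> right y [] = 0) \<longleftrightarrow> \<not> V y" for y
      unfolding V_def binary_seq_def correct_def by auto (metis less_irrefl)
    then show ?thesis unfolding cover_def by (simp only:) auto
  qed
  ultimately show ?thesis unfolding Pi0_def by blast
qed

lemma recursive_on_proj: "recursive_on baire cantor proj cover"
proof -
  \<comment> \<open>The set does not ask \<open>left y\<close> to be binary. On the closed set it
    is, so there \<open>in_cyl\<close> agrees with membership in the neighbourhood.\<close>
  let ?P = "{Pt_pair (Pt_seq y) (Pt_nat k) | y k. in_cyl (left y) k}"
  have "?P \<in> Sigma01 (baire \<otimes> omega)"
    by (rule Sigma01_cylinders[where code = "\<lambda>p. tuple3 (tuple2 (fst p) (snd (snd p))) 1 (fst (snd p))"])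
      (intro met_intros, intro edec_eopen edec_in_cyl_left comp_intros, intro comp_intros,
       auto simp: nbhd_rball rball_prod[OF metric_baire metric_omega] rball_baire rball_omega agrees_def)
  moreover have "computes baire cantor proj cover ?P"
    unfolding computes_def
  proof (intro conjI ballI allI)
    show "cover \<subseteq> dom proj" by (auto simp: proj_def)
    show "?P \<subseteq> points (baire \<otimes> omega)" by auto
    show "the (proj x) \<in> nbhd cantor k \<longleftrightarrow> Pt_pair x (Pt_nat k) \<in> ?P" if "x \<in> cover" for x k
    proof -
      obtain a where a: "Pt_seq a \<in> base" "x = Pt_seq (join a (witness a))"
        using cover_E[OF \<open>x \<in> cover\<close>] by blast
      then show ?thesis
        using base_iff by (simp add: proj_join mem_nbhd_cantor)
    qed
  qed
  moreover have "partial_fun baire cantor proj"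
  proof -
    have "dom proj \<subseteq> points baire" by (auto simp: proj_def split: if_splits dest!: cover_E)
    moreover have "ran proj \<subseteq> points cantor"
    proof
      fix z assume "z \<in> ran proj"
      then obtain x where x: "proj x = Some z" by (auto simp: ran_def)
      then have "x \<in> cover" by (simp add: proj_def split: if_splits)
      then obtain a where a: "Pt_seq a \<in> base" "x = Pt_seq (join a (witness a))" using cover_E by blast
      then have "z = Pt_seq a" using x proj_join by simp
      then show "z \<in> points cantor" using a(1) by (simp add: base_def)
    qed
    ultimately show ?thesis by (simp add: partial_fun_def)
  qed
  ultimately show ?thesis unfolding recursive_on_wrt_def by blast
qed

end


section \<open>The complexity of the inverse\<close>

text \<open>Subsets of \<open>cantor \<otimes> omega\<close> are handled as relations between
  sequences and numbers, of which only the binary sequences matter. Unions and complements become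
  quantifiers and negations.\<close>

definition slab :: "((nat \<Rightarrow> nat) \<Rightarrow> nat \<Rightarrow> bool) \<Rightarrow> pt set" where
  "slab Q = {Pt_pair (Pt_seq a) (Pt_nat k) | a k. binary_seq a \<and> Q a k}"

definition in_box :: "(nat \<Rightarrow> nat) \<Rightarrow> nat \<Rightarrow> nat \<Rightarrow> bool" where
  "in_box a k q \<longleftrightarrow> 0 < entry q 1 \<and>
     (\<forall>n<(entry q 2 + 1) div entry q 1. a n = min 1 (entry (entry (entry q 0) 0) n)) \<and>
     (entry q 1 \<le> entry q 2 + 1 \<longrightarrow> k = entry (entry q 0) 1)"

lemma mem_slab: "Pt_pair (Pt_seq a) (Pt_nat k) \<in> slab Q \<longleftrightarrow> binary_seq a \<and> Q a k"
  by (simp add: slab_def)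

lemma slab_cong: "(\<And>a k. binary_seq a \<Longrightarrow> Q a k \<longleftrightarrow> Q' a k) \<Longrightarrow> slab Q = slab Q'"
  by (auto simp: slab_def)

lemma slab_UN: "(\<Union>i. slab (Q i)) = slab (\<lambda>a k. \<exists>i. Q i a k)"
  by (auto simp: slab_def)

lemma points_slab: "points (cantor \<otimes> omega) = slab (\<lambda>_ _. True)"
  by (auto simp: slab_def binary_seq_def)

lemma slab_complement: "points (cantor \<otimes> omega) - slab Q = slab (\<lambda>a k. \<not> Q a k)"
  unfolding points_slab by (auto simp: slab_def)

lemma nbhd_slab: "nbhd (cantor \<otimes> omega) q = slab (\<lambda>a k. in_box a k q)"
  unfolding nbhd_rball rball_prod[OF metric_cantor metric_omega] rball_cantor rball_omega
    slab_def in_box_def binary_seq_def by auto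

lemma edec_in_box:
  assumes "computable f" "computable g"
  shows "edec (\<lambda>y x. in_box y (f x) (g x))"
  unfolding in_box_def
  by (intro edec_intros edec_decidable comp_intros assms computable_compose[OF assms(2)])

lemma in_box_0: "\<not> in_box a k 0"
  by (simp add: in_box_def)

lemma in_box_tuple:
  "in_box a k (tuple3 (tuple2 c k') 1 L) \<longleftrightarrow> (\<forall>n<Suc L. a n = min 1 (entry c n)) \<and> k = k'"
  by (simp add: in_box_def)

text \<open>The parameter z lets one computable function list the boxes of a whole family of open
  sets, as is needed when codes for infinitely many sets are built at once.\<close>

lemma slab_enumeration:
  fixes P :: "(nat \<Rightarrow> nat) \<Rightarrow> nat \<Rightarrow> 'z::coded \<Rightarrow> bool"
  assumes "eopen (\<lambda>a p. P a (fst p) (snd p))"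
  shows "\<exists>h :: 'z \<Rightarrow> nat \<Rightarrow> nat. computable (\<lambda>p. h (fst p) (snd p)) \<and>
    (\<forall>a k z. binary_seq a \<longrightarrow> (P a k z \<longleftrightarrow> (\<exists>i. in_box a k (h z i))))"
proof -
  obtain T where T: "semirec T"
    "\<And>a p. P a (fst p) (snd p) \<longleftrightarrow> (\<exists>c L. agrees a c (Suc L) \<and> T (c, L, p))"
    using eopenE_Suc[OF assms] by blast
  obtain Q where Q: "decidable Q" "\<And>x. T x \<longleftrightarrow> (\<exists>n :: nat. Q (x, n))"
    using T(1) unfolding semirec_def by blast
  define D where "D i = (dec i :: (nat \<times> nat \<times> nat) \<times> nat)" for i :: nat
  \<comment> \<open>Centres in \<open>cantor\<close> are truncated by \<open>min 1\<close>, so a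
    segment with an entry above 1 would name a box unrelated to it. Such segments are replaced by
    the index 0 of the empty box.\<close>
  define h where "h z i = (if Q ((fst (fst (D i)), fst (snd (fst (D i))), snd (snd (fst (D i))), z), snd (D i)) \<and>
      (\<forall>n<Suc (fst (snd (fst (D i)))). entry (fst (fst (D i))) n \<le> 1)
    then tuple3 (tuple2 (fst (fst (D i))) (snd (snd (fst (D i))))) 1 (fst (snd (fst (D i)))) else 0)"
    for z and i :: nat
  have "computable (\<lambda>p. h (fst p) (snd p))"
    unfolding h_def D_def by (intro comp_intros decidable_compose[OF Q(1)])
  moreover have "P a k z \<longleftrightarrow> (\<exists>i. in_box a k (h z i))" if a: "binary_seq a" for a k z
  proof
    assume "P a k z"
    then obtain c L n where c: "agrees a c (Suc L)" "Q ((c, L, k, z), n)"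
      using T(2)[of a "(k, z)"] Q(2) by auto
    have "entry c m \<le> 1 \<and> a m = min 1 (entry c m)" if "m < Suc L" for m
    proof -
      have "a m \<in> {0, 1}" using a unfolding binary_seq_def by blast
      moreover have "entry c m = a m" using c(1) that by (simp add: agrees_def)
      ultimately show ?thesis by auto
    qed
    then have m: "\<forall>m<Suc L. entry c m \<le> 1" "\<forall>m<Suc L. a m = min 1 (entry c m)"
      by blast+
    have "h z (enc ((c, L, k), n)) = tuple3 (tuple2 c k) 1 L"
      using c(2) m(1) unfolding h_def D_def dec_enc by simp
    then have "in_box a k (h z (enc ((c, L, k), n)))"
      using m(2) in_box_tuple by simp
    then show "\<exists>i. in_box a k (h z i)" by blast
  next
    assume "\<exists>i. in_box a k (h z i)"
    then obtain i where i: "in_box a k (h z i)" by blast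
    obtain c L k' n where d: "D i = ((c, L, k'), n)" by (metis surj_pair)
    have "Q ((c, L, k', z), n)" "\<forall>m<Suc L. entry c m \<le> 1" "in_box a k (tuple3 (tuple2 c k') 1 L)"
      using i in_box_0 unfolding h_def d by (auto split: if_splits)
    then have "Q ((c, L, k, z), n)" "agrees a c (Suc L)"
      unfolding in_box_tuple agrees_def by (auto simp: min_def)
    then show "P a k z" using T(2)[of a "(k, z)"] Q(2) by auto
  qed
  ultimately show ?thesis by (intro exI[of _ h]) simp
qed

lemma eopen_if:
  assumes "decidable D" "eopen P" "eopen Q"
  shows "eopen (\<lambda>y x. if D x then P y x else Q y x)"
proof -
  have "eopen (\<lambda>y x. D x \<and> P y x \<or> \<not> D x \<and> Q y x)"
    by (intro eopen_disj eopen_conj eopen_decidable decidable_not assms)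
  then show ?thesis by (rule eopen_cong) simp
qed

lemma rho_graph_nonleaf:
  assumes "\<beta> 0 = 1" "\<And>i. code_at G \<beta> i (\<delta> i)" "\<And>i. rho_graph G X (\<delta> i) (A i)"
    "S = (\<Union>i. points X - A i)"
  shows "rho_graph G X \<beta> S"
  unfolding assms(4) using assms(1-3) by (intro rho_graph.intros(2)) auto

text \<open>These are the Scott-open properties of sets. A certificate drawn from the infinite set
  of all true facts can be cut down to a finite one.\<close>

definition finitary :: "('a set \<Rightarrow> bool) \<Rightarrow> bool" where
  "finitary P \<longleftrightarrow> (\<forall>S. P S \<longrightarrow> (\<exists>T\<subseteq>S. finite T \<and> (\<forall>U. T \<subseteq> U \<longrightarrow> P U)))"

lemma finitaryD: "finitary P \<Longrightarrow> P S \<Longrightarrow> \<exists>T\<subseteq>S. finite T \<and> (\<forall>U. T \<subseteq> U \<longrightarrow> P U)"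
  by (simp add: finitary_def)

named_theorems finitary_intros

lemma finitary_const [finitary_intros]: "finitary (\<lambda>S. c)"
  unfolding finitary_def by auto

lemma finitary_mem [finitary_intros]: "finitary (\<lambda>S. x \<in> S)"
  unfolding finitary_def by (intro allI impI exI[of _ "{x}"]) auto

lemma finitary_ex [finitary_intros]:
  assumes "\<And>x. finitary (P x)"
  shows "finitary (\<lambda>S. \<exists>x. P x S)"
  unfolding finitary_def
proof (intro allI impI)
  fix S assume "\<exists>x. P x S"
  then obtain x where "P x S" by blast
  from finitaryD[OF assms this] obtain T where T: "T \<subseteq> S" "finite T" "\<forall>U. T \<subseteq> U \<longrightarrow> P x U"
    by (elim exE conjE)
  have "\<exists>x. P x U" if "T \<subseteq> U" for U
    using T(3) that by (intro exI[of _ x]) simp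
  with T(1,2) show "\<exists>T\<subseteq>S. finite T \<and> (\<forall>U. T \<subseteq> U \<longrightarrow> (\<exists>x. P x U))"
    by (intro exI[of _ T]) simp
qed

lemma finitary_disj [finitary_intros]:
  assumes "finitary P" "finitary Q"
  shows "finitary (\<lambda>S. P S \<or> Q S)"
proof -
  have "finitary (\<lambda>S. if c then P S else Q S)" for c
    using assms by (cases c) simp_all
  then have "finitary (\<lambda>S. \<exists>c. if c then P S else Q S)"
    by (rule finitary_ex)
  then show ?thesis by (simp add: ex_bool_eq)
qed

lemma finitary_conj [finitary_intros]:
  assumes "finitary P" "finitary Q"
  shows "finitary (\<lambda>S. P S \<and> Q S)"
  unfolding finitary_def
proof (intro allI impI)
  fix S assume S: "P S \<and> Q S"
  from finitaryD[OF assms(1) conjunct1[OF S]]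
  obtain T where T: "T \<subseteq> S" "finite T" "\<forall>U. T \<subseteq> U \<longrightarrow> P U"
    by (elim exE conjE)
  from finitaryD[OF assms(2) conjunct2[OF S]]
  obtain T' where T': "T' \<subseteq> S" "finite T'" "\<forall>U. T' \<subseteq> U \<longrightarrow> Q U"
    by (elim exE conjE)
  have "P U \<and> Q U" if "T \<union> T' \<subseteq> U" for U
    using T(3)[rule_format, of U] T'(3)[rule_format, of U] that by simp
  then show "\<exists>T\<subseteq>S. finite T \<and> (\<forall>U. T \<subseteq> U \<longrightarrow> P U \<and> Q U)"
    using T(1,2) T'(1,2) by (intro exI[of _ "T \<union> T'"]) simp
qed

lemma finitary_ball [finitary_intros]:
  fixes n :: nat
  assumes "\<And>m. finitary (P m)"
  shows "finitary (\<lambda>S. \<forall>m<n. P m S)"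
proof (induction n)
  case (Suc n)
  have eq: "(\<lambda>S. \<forall>m<Suc n. P m S) = (\<lambda>S. (\<forall>m<n. P m S) \<and> P n S)"
    by (rule HOL.ext) (auto simp: less_Suc_eq)
  show ?case
    unfolding eq by (rule finitary_conj[OF Suc assms])
qed (simp add: finitary_const)

lemma finitary_if [finitary_intros]:
  "finitary P \<Longrightarrow> finitary Q \<Longrightarrow> finitary (\<lambda>S. if c then P S else Q S)"
  by (cases c) simp_all

text \<open>The condition \<open>tl s \<noteq> []\<close> says that the path has length at least
  two. Shorter entries of the list are dropped, so every pair F names an admissible finite set of
  nodes.\<close>

definition deep_set :: "nat \<times> nat \<Rightarrow> nat list set" where
  "deep_set F = {s. tl s \<noteq> [] \<and> (\<exists>n<snd F. dec (entry (fst F) n) = s)}"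

lemma finite_deep_set: "finite (deep_set F)"
proof (rule finite_subset)
  show "deep_set F \<subseteq> (\<lambda>n. dec (entry (fst F) n)) ` {..<snd F}"
    by (auto simp: deep_set_def)
qed simp

lemma deep_set_onto:
  assumes "finite S" "\<And>s. s \<in> S \<Longrightarrow> tl s \<noteq> []"
  shows "\<exists>F. deep_set F = S"
proof -
  obtain f and n :: nat where S: "S = f ` {i. i < n}"
    using assms(1) finite_imp_nat_seg_image_inj_on by metis
  obtain c where c: "\<forall>i<n. entry c i = enc (f i)"
    using exists_entry_prefix[of n "\<lambda>i. enc (f i)"] by blast
  have "deep_set (c, n) = S"
    using assms(2) c unfolding deep_set_def S by force
  then show ?thesis by blast
qed

lemma decidable_deep_set:
  assumes "computable f" "computable g"
  shows "decidable (\<lambda>x. f x \<in> deep_set (g x))"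
  unfolding deep_set_def mem_Collect_eq
  by (intro comp_intros assms computable_compose[OF assms(1)] computable_compose[OF assms(2)])

declare subcode.simps(2) [simp del]

context borel_tree
begin

text \<open>The first step from the root takes the level from \<open>osuc \<xi>\<close> to at most
  \<xi>, further steps do not raise this bound, and the continuation below a leaf has level
  1.\<close>

lemma level_nonempty: "s \<noteq> [] \<Longrightarrow> \<exists>\<eta>. 1 \<le> \<eta> \<and> \<eta> \<le> \<xi> \<and> b s \<in> BC_at G \<eta>"
proof (induction s)
  case (Cons j s)
  show ?case
  proof (cases "leaf s")
    case True
    then have "b (j # s) \<in> BC_at G 1" unfolding leaf_child[OF True] by (simp add: BC_at_one)
    then show ?thesis using one_le by blast
  next
    case False
    have "\<exists>\<eta>. \<eta> \<le> osuc \<xi> \<and> b s \<in> BC_at G \<eta> \<and> (s \<noteq> [] \<longrightarrow> \<eta> \<le> \<xi>)"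
    proof (cases "s = []")
      case True
      then show ?thesis using BC_root by auto
    next
      case False
      then obtain \<eta> where \<eta>: "\<eta> \<le> \<xi>" "b s \<in> BC_at G \<eta>" using Cons.IH by blast
      have "\<eta> \<le> osuc \<xi>" using \<eta>(1) osuc_greater[of \<xi>] by (meson less_imp_le order.trans)
      with \<eta> show ?thesis by blast
    qed
    then obtain \<eta> where \<eta>: "\<eta> \<le> osuc \<xi>" "b s \<in> BC_at G \<eta>" by blast
    obtain \<theta> where "1 \<le> \<theta>" "\<theta> < \<eta>" "b (j # s) \<in> BC_at G \<theta>"
      using nonleaf_level(4)[OF False \<eta>(2)] by blast
    moreover have "\<theta> \<le> \<xi>"
      using less_le_trans[OF \<open>\<theta> < \<eta>\<close> \<eta>(1)] unfolding less_osuc_iff .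
    ultimately show ?thesis by blast
  qed
qed simp

text \<open>The second step from the root makes the level strictly smaller than \<xi>. Below a leaf
  it is 1, which is less than \<xi> by the second assumption.\<close>

lemma level_deep:
  assumes "tl s \<noteq> []" "osuc 1 \<le> \<xi>"
  shows "\<exists>\<eta>. 1 \<le> \<eta> \<and> \<eta> < \<xi> \<and> b s \<in> BC_at G \<eta>"
proof -
  obtain j t where s: "s = j # t" "t \<noteq> []" using assms(1) by (cases s) auto
  show ?thesis
  proof (cases "leaf t")
    case True
    have "b s \<in> BC_at G 1" unfolding s(1) leaf_child[OF True] by (simp add: BC_at_one)
    moreover have "1 < \<xi>" using osuc_greater[of 1] assms(2) by (rule less_le_trans)
    ultimately show ?thesis by blast
  next
    case False
    obtain \<eta> where \<eta>: "\<eta> \<le> \<xi>" "b t \<in> BC_at G \<eta>" using level_nonempty[OF s(2)] by blast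
    then show ?thesis
      using nonleaf_level(4)[OF False \<eta>(2), of j] less_le_trans[OF _ \<eta>(1)] unfolding s(1) by blast
  qed
qed

text \<open>For \<xi> = 1 every node other than the root is a leaf, so a path of length two or more
  belongs to the continuation by codes of the empty set.\<close>

lemma holds_deep_level_one:
  assumes "tl s \<noteq> []" "\<xi> = 1" "binary_seq a"
  shows "\<not> holds a s"
proof -
  obtain j t where s: "s = j # t" "t \<noteq> []" using assms(1) by (cases s) auto
  obtain \<eta> where "1 \<le> \<eta>" "\<eta> \<le> 1" "b t \<in> BC_at G \<eta>" using level_nonempty[OF s(2)] assms(2) by blast
  then have "b t \<in> BC_at G 1" using order.antisym by blast
  then have "leaf t" by (rule level_one_leaf)
  then have bs: "b s = (\<lambda>_. 0)" unfolding s(1) by (rule leaf_child)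
  then have "leaf s" by (simp add: leaf_def)
  then have "\<not> wit a s i" for i by (simp add: wit_def bs in_cyl_def)
  then show ?thesis using holds_iff[OF assms(3)] by blast
qed

text \<open>Suppose that \<open>a\<close> lies in none of the sets coded by the nodes in \<open>S\<close>. Then \<open>cert S a s i\<close> certifies
  \<open>wit a s i\<close>, \<open>ncert S a s i\<close> its negation, \<open>vcert S a s v\<close> that \<open>witness a s = v\<close>, and \<open>pcert S a k\<close>
  that \<open>join a (witness a)\<close> is in \<open>nbhd baire k\<close>. Only nodes with paths of length at least two are
  consulted: their codes have level below \<open>\<xi>\<close>, or code the empty set if
  \<open>\<xi> = 1\<close>.\<close>

definition cert :: "nat list set \<Rightarrow> (nat \<Rightarrow> nat) \<Rightarrow> nat list \<Rightarrow> nat \<Rightarrow> bool" where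
  "cert S a s i \<longleftrightarrow> (if leaf s then in_cyl a (b s (Suc i)) else i # s \<in> S)"

definition ncert :: "nat list set \<Rightarrow> (nat \<Rightarrow> nat) \<Rightarrow> nat list \<Rightarrow> nat \<Rightarrow> bool" where
  "ncert S a s i \<longleftrightarrow> (if leaf s then \<not> in_cyl a (b s (Suc i)) else (\<exists>u. cert S a (i # s) u))"

definition vcert :: "nat list set \<Rightarrow> (nat \<Rightarrow> nat) \<Rightarrow> nat list \<Rightarrow> nat \<Rightarrow> bool" where
  "vcert S a s v \<longleftrightarrow> s = [] \<and> v = 0 \<or> (tl s \<noteq> [] \<and> v = 0) \<and> s \<in> S \<or>
     (s \<noteq> [] \<and> v \<noteq> 0) \<and> cert S a s (v - 1) \<and> (\<forall>m<v - 1. ncert S a s m)"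

definition pcert :: "nat list set \<Rightarrow> (nat \<Rightarrow> nat) \<Rightarrow> nat \<Rightarrow> bool" where
  "pcert S a k \<longleftrightarrow> 0 < entry k 1 \<and> (\<forall>n<(entry k 2 + 1) div entry k 1.
     if 2 dvd n then a (n div 2) = entry (entry k 0) n
     else vcert S a (dec (n div 2)) (entry (entry k 0) n))"

text \<open>S occurs only positively, under existential and bounded quantifiers.\<close>

lemma finitary_pcert: "finitary (\<lambda>S. pcert S a k)"
  unfolding pcert_def vcert_def ncert_def cert_def by (intro finitary_intros)

lemma eopen_pcert: "eopen (\<lambda>a p. pcert (deep_set (snd p)) a (fst p))"
proof -
  have cert: "eopen (\<lambda>a x. cert (deep_set (f x)) a (g x) (h x))"
    if "computable f" "computable g" "computable h" for f g and h :: "'x::coded \<Rightarrow> nat"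
    unfolding cert_def
    by (intro eopen_if edec_eopen[OF edec_in_cyl] eopen_decidable decidable_deep_set comp_intros that)
  have ncert: "eopen (\<lambda>a x. ncert (deep_set (f x)) a (g x) (h x))"
    if "computable f" "computable g" "computable h" for f g and h :: "'x::coded \<Rightarrow> nat"
    unfolding ncert_def
    by (intro eopen_if eopen_ex edec_eopen[OF edec_not] edec_in_cyl cert comp_intros that
        computable_compose[OF that(1)] computable_compose[OF that(2)] computable_compose[OF that(3)])
  have vcert: "eopen (\<lambda>a x. vcert (deep_set (f x)) a (g x) (h x))"
    if "computable f" "computable g" "computable h" for f g and h :: "'x::coded \<Rightarrow> nat"
    unfolding vcert_def
    by (intro eopen_disj eopen_conj eopen_ball cert ncert eopen_decidable decidable_deep_set comp_intros that
        computable_compose[OF that(1)] computable_compose[OF that(2)] computable_compose[OF that(3)])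
  show ?thesis
    unfolding pcert_def
    by (intro eopen_conj eopen_ball eopen_if eopen_value vcert eopen_decidable comp_intros)
qed

lemma cert_sound: "\<forall>s\<in>S. \<not> holds a s \<Longrightarrow> cert S a s i \<Longrightarrow> wit a s i"
  by (auto simp: cert_def wit_def split: if_splits)

text \<open>At an inner node the negation says that a lies in the set of the child
  \<open>i # s\<close>, and one certified witness there is enough.\<close>

lemma ncert_sound:
  assumes "binary_seq a" "\<forall>s\<in>S. \<not> holds a s" "ncert S a s i"
  shows "\<not> wit a s i"
proof (cases "leaf s")
  case True
  then show ?thesis using assms(3) by (simp add: ncert_def wit_def)
next
  case False
  then obtain u where "cert S a (i # s) u" using assms(3) by (auto simp: ncert_def)
  then have "wit a (i # s) u" by (rule cert_sound[OF assms(2)])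
  then have "holds a (i # s)" using holds_iff[OF assms(1)] by blast
  then show ?thesis using False by (simp add: wit_def)
qed

lemma vcert_sound:
  assumes "binary_seq a" "\<forall>s\<in>S. \<not> holds a s" "\<not> holds a []" "vcert S a s v"
  shows "witness a s = v"
proof (cases v)
  case 0
  then show ?thesis using assms(2-4) by (auto simp: vcert_def witness_eq_0)
next
  case (Suc n)
  then have "cert S a s n" "\<forall>m<n. ncert S a s m" using assms(4) by (auto simp: vcert_def)
  then show ?thesis
    unfolding Suc witness_eq_Suc[OF assms(1)] using cert_sound[OF assms(2)] ncert_sound[OF assms(1,2)]
    by blast
qed

lemma pcert_sound:
  assumes "binary_seq a" "\<forall>s\<in>S. \<not> holds a s" "\<not> holds a []" "pcert S a k"
  shows "Pt_seq (join a (witness a)) \<in> nbhd baire k"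
  using assms(4) vcert_sound[OF assms(1-3)] unfolding pcert_def nbhd_rball mem_rball join_def by auto

text \<open>For nonempty s the child \<open>i # s\<close> has depth at least two, so its
  non-membership may be consulted. At the root it may not, which is why \<open>vcert\<close> treats
  the root apart.\<close>

lemma cert_complete: "s \<noteq> [] \<Longrightarrow> wit a s i \<Longrightarrow> cert {s. tl s \<noteq> [] \<and> \<not> holds a s} a s i"
  by (auto simp: cert_def wit_def split: if_splits)

lemma ncert_complete:
  assumes "binary_seq a" "s \<noteq> []" "\<not> wit a s i"
  shows "ncert {s. tl s \<noteq> [] \<and> \<not> holds a s} a s i"
proof (cases "leaf s")
  case True
  then show ?thesis using assms(3) by (simp add: ncert_def wit_def)
next
  case False
  then have "holds a (i # s)" using assms(3) by (simp add: wit_def)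
  then obtain u where "wit a (i # s) u" using holds_iff[OF assms(1)] by blast
  then have "cert {s. tl s \<noteq> [] \<and> \<not> holds a s} a (i # s) u" by (intro cert_complete) simp
  then show ?thesis using False by (auto simp: ncert_def)
qed

lemma vcert_complete:
  assumes "binary_seq a" "\<not> holds a []"
  shows "vcert {s. tl s \<noteq> [] \<and> \<not> holds a s} a s (witness a s)"
proof (cases "witness a s")
  case 0
  then have s: "\<not> holds a s" by (simp add: witness_eq_0)
  \<comment> \<open>As a is outside the set at the root, no child of the root omits it. Hence the
    value 0 does not occur at depth one, where it could not be certified.\<close>
  have "holds a [j]" for j
    using assms(2) nonleaf_root holds_iff[OF assms(1), of "[]"] by (auto simp: wit_def)
  then have "s = [] \<or> tl s \<noteq> []" using s by (cases s; cases "tl s") auto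
  then show ?thesis using 0 s by (auto simp: vcert_def)
next
  case (Suc n)
  then have "s \<noteq> []" using assms(2) by (auto simp: witness_def)
  moreover have "wit a s n" "\<forall>m<n. \<not> wit a s m"
    using Suc witness_eq_Suc[OF assms(1)] by blast+
  ultimately show ?thesis
    unfolding Suc vcert_def using cert_complete ncert_complete[OF assms(1)] by simp
qed

lemma pcert_complete:
  assumes "binary_seq a" "\<not> holds a []" "Pt_seq (join a (witness a)) \<in> nbhd baire k"
  shows "pcert {s. tl s \<noteq> [] \<and> \<not> holds a s} a k"
proof -
  have *: "0 < entry k 1" "\<forall>n<(entry k 2 + 1) div entry k 1. join a (witness a) n = entry (entry k 0) n"
    using assms(3) unfolding nbhd_rball mem_rball by blast+
  have "if 2 dvd n then a (n div 2) = entry (entry k 0) n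
     else vcert {s. tl s \<noteq> [] \<and> \<not> holds a s} a (dec (n div 2)) (entry (entry k 0) n)"
    if "n < (entry k 2 + 1) div entry k 1" for n
    using *(2)[rule_format, OF that, symmetric] vcert_complete[OF assms(1,2), of "dec (n div 2)"]
    by (simp add: join_def)
  with *(1) show ?thesis unfolding pcert_def by blast
qed

text \<open>Completeness is obtained for the infinite set of all true facts at depth two or more;
  \<open>finitary_pcert\<close> leaves finitely many of them, and these form a
  \<open>deep_set\<close>.\<close>

lemma mem_nbhd_iff_certificate:
  assumes "binary_seq a" "\<not> holds a []"
  shows "Pt_seq (join a (witness a)) \<in> nbhd baire k \<longleftrightarrow>
    (\<exists>F. pcert (deep_set F) a k \<and> (\<forall>s\<in>deep_set F. \<not> holds a s))"
proof
  assume "Pt_seq (join a (witness a)) \<in> nbhd baire k"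
  then have "pcert {s. tl s \<noteq> [] \<and> \<not> holds a s} a k" by (rule pcert_complete[OF assms])
  from finitaryD[OF finitary_pcert this]
  obtain T where T: "T \<subseteq> {s. tl s \<noteq> [] \<and> \<not> holds a s}" "finite T" "pcert T a k"
    by blast
  obtain F where "deep_set F = T" using deep_set_onto[OF T(2)] T(1) by blast
  with T show "\<exists>F. pcert (deep_set F) a k \<and> (\<forall>s\<in>deep_set F. \<not> holds a s)" by blast
qed (use pcert_sound assms in blast)

end


context borel_tree
begin

definition certified :: "(nat \<Rightarrow> nat) \<Rightarrow> nat \<Rightarrow> bool" where
  "certified a k \<longleftrightarrow> (\<exists>F. pcert (deep_set F) a k \<and> (\<forall>s\<in>deep_set F. \<not> holds a s))"

text \<open>The facts at depth two or more hold automatically here, so the condition on them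
  disappears and an open set remains.\<close>

lemma certified_level_one:
  assumes "\<xi> = 1"
  shows "slab certified \<in> Sigma0 G \<xi> (cantor \<otimes> omega)"
proof -
  \<comment> \<open>The parameter z is a dummy for \<open>slab_enumeration\<close>, set to 0
    below.\<close>
  have "eopen (\<lambda>a p. (\<lambda>a k (z :: nat). \<exists>F. pcert (deep_set F) a k) a (fst p) (snd p))"
    by (intro eopen_ex eopen_compose2[OF eopen_pcert] comp_intros)
  from slab_enumeration[OF this] obtain h where h: "computable (\<lambda>p. h (fst p :: nat) (snd p))"
    "\<forall>a k z. binary_seq a \<longrightarrow> ((\<exists>F. pcert (deep_set F) a k) \<longleftrightarrow> (\<exists>i :: nat. in_box a k (h z i)))"
    by blast
  have "slab certified = (\<Union>i. nbhd (cantor \<otimes> omega) (h 0 i))"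
    unfolding nbhd_slab slab_UN
  proof (rule slab_cong)
    fix a k assume a: "binary_seq a"
    have "\<not> holds a s" if "s \<in> deep_set F" for s F
      using holds_deep_level_one[OF _ assms a] that by (simp add: deep_set_def)
    then have "certified a k \<longleftrightarrow> (\<exists>F. pcert (deep_set F) a k)" unfolding certified_def by blast
    then show "certified a k \<longleftrightarrow> (\<exists>i. in_box a k (h 0 i))" using h(2) a by blast
  qed
  moreover have "computable (h 0)"
    using computable_compose[OF h(1) computable_Pair[OF computable_const computable_ident], of 0] by simp
  ultimately have "slab certified \<in> Sigma01 (cantor \<otimes> omega)"
    unfolding Sigma01_def computable_nat_iff by blast
  then show ?thesis unfolding assms by (rule Sigma01_subset_Sigma0)
qed

text \<open>A node of the code tree of \<open>certified\<close> is a tuple \<open>(tag, q, F, s)\<close>: tag \<open>0\<close> is the root, tag \<open>1\<close> names the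
  set of points that are outside the box \<open>q\<close> or in some \<open>A\<^sub>t\<close> with \<open>t\<close> in \<open>F\<close>, tag \<open>2\<close> names \<open>A\<^sub>s\<close>, and tag \<open>3\<close>
  names the complement of the box \<open>q\<close>, where \<open>A\<^sub>s\<close> is the set coded by \<open>b s\<close>.\<close>

type_synonym node = "nat \<times> nat \<times> (nat \<times> nat) \<times> nat list"

definition item :: "nat \<times> nat \<Rightarrow> nat \<Rightarrow> nat list" where
  "item F n = dec (entry (fst F) n)"

lemma computable_item [comp_intros]:
  "computable f \<Longrightarrow> computable g \<Longrightarrow> computable (\<lambda>x. item (f x) (g x))"
  unfolding item_def by (intro comp_intros)

lemma deep_set_item: "deep_set F = {s. tl s \<noteq> [] \<and> (\<exists>n<snd F. item F n = s)}"
  by (simp add: deep_set_def item_def)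

text \<open>At a leaf node this is the whole set. At an inner node of tag 1 it is the open share,
  made up of the complement of the box and the listed leaves; the listed inner nodes contribute
  through their children.\<close>

definition open_part :: "(nat \<Rightarrow> nat) \<Rightarrow> nat \<Rightarrow> node \<Rightarrow> bool" where
  "open_part a k t \<longleftrightarrow>
     fst t = 2 \<and> (\<exists>i. in_cyl a (b (snd (snd (snd t))) (Suc i))) \<or>
     fst t \<noteq> 2 \<and> \<not> in_box a k (fst (snd t)) \<or>
     fst t = 1 \<and> (\<exists>n<snd (fst (snd (snd t))).
       (tl (item (fst (snd (snd t))) n) \<noteq> [] \<and> leaf (item (fst (snd (snd t))) n)) \<and>
       (\<exists>i. in_cyl a (b (item (fst (snd (snd t))) n) (Suc i))))"

lemma eopen_open_part: "eopen (\<lambda>a p. open_part a (fst p) (snd p))"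
  unfolding open_part_def
  by (intro eopen_intros edec_eopen[OF edec_in_cyl] edec_eopen[OF edec_not[OF edec_in_box]]
      eopen_decidable comp_intros)

text \<open>A node of tag 1 that lists only leaves must itself get level 1: as an inner node it
  would have level at least 2, too high for a child of the root when \<xi> is
  \<open>osuc 1\<close>.\<close>

definition leaf_node :: "node \<Rightarrow> bool" where
  "leaf_node t \<longleftrightarrow> fst t = 2 \<and> leaf (snd (snd (snd t))) \<or>
     fst t = 1 \<and> (\<forall>n<snd (fst (snd (snd t))).
       tl (item (fst (snd (snd t))) n) \<noteq> [] \<longrightarrow> leaf (item (fst (snd (snd t))) n)) \<or>
     2 < fst t"

lemma decidable_leaf_node: "decidable leaf_node"
  unfolding leaf_node_def by (intro comp_intros)

text \<open>Each inner node is the union of the complements of its children. For tag 1 the even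
  children are complements of the boxes that make up the open part, and the odd ones run through the
  children of all listed inner nodes. The filler (3, 0, ...) names the whole space, so its
  complement adds nothing.\<close>

definition child_node :: "(nat \<times> nat \<Rightarrow> nat \<Rightarrow> nat) \<Rightarrow> (node \<Rightarrow> nat \<Rightarrow> nat) \<Rightarrow> node \<Rightarrow> nat \<Rightarrow> node" where
  "child_node h lc t i =
    (if fst t = 0 then (1, h (fst (dec i :: (nat \<times> nat) \<times> nat)) (snd (dec i :: (nat \<times> nat) \<times> nat)), fst (dec i :: (nat \<times> nat) \<times> nat), [])
     else if fst t = 1 then
       if 2 dvd i then (3, lc t (i div 2), (0, 0), [])
       else if fst (dec (i div 2) :: nat \<times> nat) < snd (fst (snd (snd t))) \<and>
           tl (item (fst (snd (snd t))) (fst (dec (i div 2) :: nat \<times> nat))) \<noteq> [] \<and>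
           \<not> leaf (item (fst (snd (snd t))) (fst (dec (i div 2) :: nat \<times> nat)))
         then (2, 0, (0, 0), snd (dec (i div 2) :: nat \<times> nat) # item (fst (snd (snd t))) (fst (dec (i div 2) :: nat \<times> nat)))
         else (3, 0, (0, 0), [])
     else (2, 0, (0, 0), i # snd (snd (snd t))))"

lemma computable_child_node:
  assumes "computable (\<lambda>p. h (fst p) (snd p))" "computable (\<lambda>p. lc (fst p) (snd p))"
  shows "computable (\<lambda>p. child_node h lc (fst p) (snd p))"
  unfolding child_node_def
  by (intro computable_if computable_compose2[OF assms(1)] computable_compose2[OF assms(2)] comp_intros)

text \<open>The codes from \<open>tree_codes\<close> exist for all nodes at once, without levels.
  Levels are established afterwards where they are needed, for tags 3, 2, 1 and then the root, each
  from what is known of the children.\<close>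

lemma certified_level_ge_two:
  assumes xi: "osuc 1 \<le> \<xi>"
  shows "slab certified \<in> Sigma0 G \<xi> (cantor \<otimes> omega)"
proof -
  let ?Z = "cantor \<otimes> omega"
  have "eopen (\<lambda>a p. (\<lambda>a k F. pcert (deep_set F) a k) a (fst p) (snd p))"
    using eopen_pcert by simp
  from slab_enumeration[OF this] obtain h :: "nat \<times> nat \<Rightarrow> nat \<Rightarrow> nat"
    where h: "computable (\<lambda>p. h (fst p) (snd p))"
    "\<forall>a k F. binary_seq a \<longrightarrow> (pcert (deep_set F) a k \<longleftrightarrow> (\<exists>i. in_box a k (h F i)))"
    by blast
  from slab_enumeration[OF eopen_open_part] obtain lc :: "node \<Rightarrow> nat \<Rightarrow> nat"
    where lc: "computable (\<lambda>p. lc (fst p) (snd p))"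
    "\<forall>a k t. binary_seq a \<longrightarrow> (open_part a k t \<longleftrightarrow> (\<exists>i. in_box a k (lc t i)))"
    by blast
  let ?ch = "child_node h lc"
  obtain e :: "node \<Rightarrow> nat \<Rightarrow> nat" where e: "computable (\<lambda>p. e (fst p) (snd p))"
    "\<And>t. leaf_node t \<Longrightarrow> e t 0 = 0" "\<And>t i. leaf_node t \<Longrightarrow> e t (Suc i) = lc t i"
    "\<And>t. \<not> leaf_node t \<Longrightarrow> e t 0 = 1" "\<And>t j. \<not> leaf_node t \<Longrightarrow> code_at G (e t) j (e (?ch t j))"
    using tree_codes[OF G decidable_leaf_node computable_child_node[OF h(1) lc(1)] lc(1)] by blast
  have leaf: "(1, e t) \<in> BC_level G \<and> rho_graph G ?Z (e t) (slab (\<lambda>a k. open_part a k t))"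
    if "leaf_node t" for t
  proof
    show "(1, e t) \<in> BC_level G" using e(2)[OF that] by (rule BC_level.intros(1))
    have "slab (\<lambda>a k. open_part a k t) = (\<Union>i. nbhd ?Z (star (e t) i))"
    proof -
      have "star (e t) = lc t" using e(3)[OF that] by (intro HOL.ext) (simp add: star_def)
      then show ?thesis unfolding nbhd_slab slab_UN using lc(2) by (intro slab_cong) (simp only:)
    qed
    then show "rho_graph G ?Z (e t) (slab (\<lambda>a k. open_part a k t))"
      using rho_graph.intros(1)[of "e t" G ?Z, OF e(2)[OF that]] by simp
  qed
  have nonleaf: "(\<eta>, e t) \<in> BC_level G \<and> rho_graph G ?Z (e t) (slab (\<lambda>a k. \<exists>i. \<not> Q i a k))"
    if t: "\<not> leaf_node t" and \<eta>: "osuc 1 \<le> \<eta>"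
      and ch: "\<And>i. \<exists>\<theta>. 1 \<le> \<theta> \<and> \<theta> < \<eta> \<and> (\<theta>, e (?ch t i)) \<in> BC_level G"
        "\<And>i. rho_graph G ?Z (e (?ch t i)) (slab (Q i))" for t \<eta> Q
  proof
    have "\<forall>i. \<exists>\<beta>. code_at G (e t) i \<beta> \<and> (\<exists>\<theta>. 1 \<le> \<theta> \<and> \<theta> < \<eta> \<and> (\<theta>, \<beta>) \<in> BC_level G)"
      using e(5)[OF t] ch(1) by blast
    then show "(\<eta>, e t) \<in> BC_level G"
      using BC_level.intros(2)[of \<eta> "e t" G] \<eta> e(4)[OF t] by simp
    show "rho_graph G ?Z (e t) (slab (\<lambda>a k. \<exists>i. \<not> Q i a k))"
      by (rule rho_graph_nonleaf[OF e(4)[OF t] e(5)[OF t] ch(2)]) (simp only: slab_complement slab_UN)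
  qed
  have tag3: "(1, e (3, q, F, s)) \<in> BC_level G \<and>
      rho_graph G ?Z (e (3, q, F, s)) (slab (\<lambda>a k. \<not> in_box a k q))" for q F s
    using leaf[of "(3, q, F, s)"] by (simp add: leaf_node_def open_part_def)
  \<comment> \<open>The tree of \<open>b s\<close> is repeated over the product space, with the same
    level and with the cylinder over A_s in place of A_s.\<close>
  have tag2: "(\<eta>, e (2, 0, (0, 0), s)) \<in> BC_level G \<and>
      rho_graph G ?Z (e (2, 0, (0, 0), s)) (slab (\<lambda>a k. holds a s))"
    if "b s \<in> BC_at G \<eta>" for \<eta> s
    using that
  proof (induction \<eta> arbitrary: s rule: less_induct)
    case (less \<eta>)
    show ?case
    proof (cases "leaf s")
      case True
      have "slab (\<lambda>a k. open_part a k (2, 0, (0, 0), s)) = slab (\<lambda>a k. holds a s)"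
        by (rule slab_cong) (use True in \<open>simp add: open_part_def holds_iff wit_def\<close>)
      moreover have "\<eta> = 1" using subcode_step[OF less.prems] True by (simp add: leaf_def)
      ultimately show ?thesis
        using leaf[of "(2, 0, (0, 0), s)"] True by (simp add: leaf_node_def)
    next
      case False
      have t: "\<not> leaf_node (2, 0, (0, 0), s)" using False by (simp add: leaf_node_def)
      have ch: "?ch (2, 0, (0, 0), s) j = (2, 0, (0, 0), j # s)" for j
        by (simp add: child_node_def)
      have IH: "\<exists>\<theta>. 1 \<le> \<theta> \<and> \<theta> < \<eta> \<and> (\<theta>, e (2, 0, (0, 0), j # s)) \<in> BC_level G \<and>
          rho_graph G ?Z (e (2, 0, (0, 0), j # s)) (slab (\<lambda>a k. holds a (j # s)))" for j
        using nonleaf_level(4)[OF False less.prems, of j] less.IH by blast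
      have "(\<eta>, e (2, 0, (0, 0), s)) \<in> BC_level G \<and>
         rho_graph G ?Z (e (2, 0, (0, 0), s)) (slab (\<lambda>a k. \<exists>j. \<not> holds a (j # s)))"
        by (rule nonleaf[OF t nonleaf_level(2)[OF False less.prems]]; unfold ch) (use IH in blast)+
      moreover have "slab (\<lambda>a k. \<exists>j. \<not> holds a (j # s)) = slab (\<lambda>a k. holds a s)"
        by (rule slab_cong) (use False in \<open>simp add: holds_iff[of _ s] wit_def\<close>)
      ultimately show ?thesis by simp
    qed
  qed
  have one_less: "1 < \<xi>" using osuc_greater[of 1] xi by (rule less_le_trans)
  have tag1: "(\<exists>\<eta>. 1 \<le> \<eta> \<and> \<eta> < \<xi> \<and> (\<eta>, e (1, q, F, [])) \<in> BC_level G) \<and>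
      rho_graph G ?Z (e (1, q, F, [])) (slab (\<lambda>a k. \<not> in_box a k q \<or> (\<exists>s\<in>deep_set F. holds a s)))"
    for q F
  proof -
    let ?t = "(1, q, F, []) :: node"
    have open_iff: "open_part a k ?t \<longleftrightarrow> \<not> in_box a k q \<or> (\<exists>s\<in>deep_set F. leaf s \<and> holds a s)"
      if "binary_seq a" for a k
      using that by (auto simp: open_part_def deep_set_item holds_iff wit_def)
    show ?thesis
    proof (cases "leaf_node ?t")
      case True
      then have "\<forall>s\<in>deep_set F. leaf s" by (auto simp: leaf_node_def deep_set_item)
      then have "slab (\<lambda>a k. open_part a k ?t) =
          slab (\<lambda>a k. \<not> in_box a k q \<or> (\<exists>s\<in>deep_set F. holds a s))"
        by (intro slab_cong) (simp only: open_iff, blast)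
      then show ?thesis using leaf[OF True] one_less by auto
    next
      case False
      have "\<forall>s\<in>deep_set F. \<exists>\<eta>. 1 \<le> \<eta> \<and> \<eta> < \<xi> \<and> b s \<in> BC_at G \<eta>"
        using level_deep[OF _ xi] by (simp add: deep_set_def)
      then obtain lev where lev: "\<forall>s\<in>deep_set F. 1 \<le> lev s \<and> lev s < \<xi> \<and> b s \<in> BC_at G (lev s)"
        using bchoice[of "deep_set F" "\<lambda>s \<eta>. 1 \<le> \<eta> \<and> \<eta> < \<xi> \<and> b s \<in> BC_at G \<eta>"] by blast
      \<comment> \<open>Not being a leaf, the node lists some inner node, whose level is at least 2;
        so the maximum below is taken over a nonempty set and is at least 2.\<close>
      obtain s0 where s0: "s0 \<in> deep_set F" "\<not> leaf s0"
        using False by (auto simp: leaf_node_def deep_set_item)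
      \<comment> \<open>A level for \<open>?t\<close>: children of a listed inner node lie below the
        level of that node, hence below \<eta>, and the box nodes have level 1. As a maximum of
        finitely many levels below \<xi> it is below \<xi>.\<close>
      define \<eta> where "\<eta> = Max (lev ` deep_set F)"
      have le: "lev s \<le> \<eta>" if "s \<in> deep_set F" for s
        unfolding \<eta>_def using that finite_deep_set by simp
      have "\<eta> \<in> lev ` deep_set F"
        unfolding \<eta>_def using s0(1) finite_deep_set by (intro Max_in) auto
      then have \<eta>_less: "\<eta> < \<xi>" using lev by auto
      have "osuc 1 \<le> lev s0" using nonleaf_level(2)[OF s0(2)] lev s0(1) by blast
      then have \<eta>: "osuc 1 \<le> \<eta>" using le[OF s0(1)] by (rule order.trans)
      then have "1 < \<eta>" using osuc_greater[of 1] by (meson less_le_trans)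
      \<comment> \<open>The set named by child i, clause by clause as in
        \<open>child_node\<close>.\<close>
      define Q where "Q i a k = (if 2 dvd i then \<not> in_box a k (lc ?t (i div 2))
         else if fst (dec (i div 2) :: nat \<times> nat) < snd F \<and>
           tl (item F (fst (dec (i div 2) :: nat \<times> nat))) \<noteq> [] \<and>
           \<not> leaf (item F (fst (dec (i div 2) :: nat \<times> nat)))
         then holds a (snd (dec (i div 2) :: nat \<times> nat) # item F (fst (dec (i div 2) :: nat \<times> nat)))
         else \<not> in_box a k 0)" for i :: nat and a k
      have child: "(\<exists>\<theta>. 1 \<le> \<theta> \<and> \<theta> < \<eta> \<and> (\<theta>, e (?ch ?t i)) \<in> BC_level G) \<and>
          rho_graph G ?Z (e (?ch ?t i)) (slab (Q i))" for i
      proof (cases "2 dvd i")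
        case True
        then have "?ch ?t i = (3, lc ?t (i div 2), (0, 0), [])" "Q i = (\<lambda>a k. \<not> in_box a k (lc ?t (i div 2)))"
          by (simp_all add: child_node_def Q_def fun_eq_iff)
        then show ?thesis using tag3 \<open>1 < \<eta>\<close> by auto
      next
        case odd: False
        obtain n j where nj: "(dec (i div 2) :: nat \<times> nat) = (n, j)" by fastforce
        show ?thesis
        proof (cases "n < snd F \<and> tl (item F n) \<noteq> [] \<and> \<not> leaf (item F n)")
          case True
          then have ch: "?ch ?t i = (2, 0, (0, 0), j # item F n)" "Q i = (\<lambda>a k. holds a (j # item F n))"
            using odd by (simp_all add: child_node_def Q_def nj fun_eq_iff)
          have mem: "item F n \<in> deep_set F" using True by (auto simp: deep_set_item)
          then have "b (item F n) \<in> BC_at G (lev (item F n))" using lev by blast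
          with True obtain \<theta> where "1 \<le> \<theta>" "\<theta> < lev (item F n)" "b (j # item F n) \<in> BC_at G \<theta>"
            using nonleaf_level(4) by blast
          then show ?thesis
            unfolding ch using tag2[of "j # item F n" \<theta>] le[OF mem] by (meson less_le_trans)
        next
          case False
          then have "?ch ?t i = (3, 0, (0, 0), [])" "Q i = (\<lambda>a k. \<not> in_box a k 0)"
            using odd by (auto simp: child_node_def Q_def nj fun_eq_iff)
          then show ?thesis using tag3 \<open>1 < \<eta>\<close> by auto
        qed
      qed
      have "(\<eta>, e ?t) \<in> BC_level G \<and> rho_graph G ?Z (e ?t) (slab (\<lambda>a k. \<exists>i. \<not> Q i a k))"
        by (rule nonleaf[OF False \<eta>]) (use child in blast)+
      moreover have "slab (\<lambda>a k. \<exists>i. \<not> Q i a k) =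
          slab (\<lambda>a k. \<not> in_box a k q \<or> (\<exists>s\<in>deep_set F. holds a s))"
      proof (rule slab_cong)
        fix a k assume a: "binary_seq a"
        \<comment> \<open>Even indices recover the open part, odd ones the listed inner nodes, each
          as the union of the complements of its children.\<close>
        have even: "\<not> Q (2 * i) a k \<longleftrightarrow> in_box a k (lc ?t i)" for i
          by (simp add: Q_def)
        have odd: "\<not> Q (2 * enc (n, j) + 1) a k \<longleftrightarrow>
            n < snd F \<and> tl (item F n) \<noteq> [] \<and> \<not> leaf (item F n) \<and> \<not> holds a (j # item F n)" for n j
          using in_box_0[of a k] by (auto simp: Q_def)
        have "(\<exists>i. \<not> Q i a k) \<longleftrightarrow> (\<exists>i. \<not> Q (2 * i) a k) \<or> (\<exists>(n :: nat) (j :: nat). \<not> Q (2 * enc (n, j) + 1) a k)"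
        proof
          assume "\<exists>i. \<not> Q i a k"
          then obtain i where i: "\<not> Q i a k" by blast
          show "(\<exists>i. \<not> Q (2 * i) a k) \<or> (\<exists>(n :: nat) (j :: nat). \<not> Q (2 * enc (n, j) + 1) a k)"
          proof (cases "2 dvd i")
            case True
            then obtain i' where "i = 2 * i'" by (rule dvdE)
            with i show ?thesis by blast
          next
            case False
            then obtain i' where i': "i = 2 * i' + 1" by (rule oddE)
            obtain n j where "(dec i' :: nat \<times> nat) = (n, j)" by fastforce
            then have "i' = enc (n, j)" by (metis enc_dec)
            with i i' show ?thesis by blast
          qed
        qed blast
        also have "\<dots> \<longleftrightarrow> open_part a k ?t \<or> (\<exists>n<snd F. tl (item F n) \<noteq> [] \<and> \<not> leaf (item F n) \<and> holds a (item F n))"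
        proof -
          have "open_part a k ?t \<longleftrightarrow> (\<exists>i. in_box a k (lc ?t i))" using lc(2) a by blast
          moreover have "holds a (item F n) \<longleftrightarrow> (\<exists>j. \<not> holds a (j # item F n))" if "\<not> leaf (item F n)" for n
            using holds_iff[OF a, of "item F n"] that by (simp add: wit_def)
          ultimately show ?thesis unfolding even odd by blast
        qed
        also have "\<dots> \<longleftrightarrow> \<not> in_box a k q \<or> (\<exists>s\<in>deep_set F. holds a s)"
          unfolding open_iff[OF a] by (auto simp: deep_set_item)
        finally show "(\<exists>i. \<not> Q i a k) \<longleftrightarrow> \<not> in_box a k q \<or> (\<exists>s\<in>deep_set F. holds a s)" .
      qed
      ultimately show ?thesis
        using \<eta>_less less_imp_le[OF \<open>1 < \<eta>\<close>] by (intro conjI exI[of _ \<eta>]) simp_all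
    qed
  qed
  let ?r = "(0, 0, (0, 0), []) :: node"
  let ?D = "\<lambda>i :: nat. dec i :: (nat \<times> nat) \<times> nat"
  have root: "\<not> leaf_node ?r" by (simp add: leaf_node_def)
  have ch: "?ch ?r i = (1, h (fst (?D i)) (snd (?D i)), fst (?D i), [])" for i
    by (simp add: child_node_def)
  have "(\<xi>, e ?r) \<in> BC_level G \<and> rho_graph G ?Z (e ?r) (slab (\<lambda>a k. \<exists>i.
      \<not> (\<not> in_box a k (h (fst (?D i)) (snd (?D i))) \<or> (\<exists>s\<in>deep_set (fst (?D i)). holds a s))))"
    by (rule nonleaf[OF root xi]; unfold ch) (use tag1 in blast)+
  \<comment> \<open>Complementing a node of tag 1 leaves the points that are in its box and in none
    of the sets listed by F. The union over all F and all boxes enumerated for F is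
    \<open>certified\<close>.\<close>
  moreover have "slab (\<lambda>a k. \<exists>i. \<not> (\<not> in_box a k (h (fst (?D i)) (snd (?D i))) \<or>
      (\<exists>s\<in>deep_set (fst (?D i)). holds a s))) = slab certified"
  proof (rule slab_cong)
    fix a k assume a: "binary_seq a"
    have "(\<exists>i. \<not> (\<not> in_box a k (h (fst (?D i)) (snd (?D i))) \<or> (\<exists>s\<in>deep_set (fst (?D i)). holds a s))) \<longleftrightarrow>
        (\<exists>p :: (nat \<times> nat) \<times> nat. \<not> (\<not> in_box a k (h (fst p) (snd p)) \<or> (\<exists>s\<in>deep_set (fst p). holds a s)))"
      by (rule ex_dec)
    also have "\<dots> \<longleftrightarrow> (\<exists>F. (\<exists>i. in_box a k (h F i)) \<and> (\<forall>s\<in>deep_set F. \<not> holds a s))" by auto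
    also have "\<dots> \<longleftrightarrow> certified a k" unfolding certified_def using h(2) a by blast
    finally show "(\<exists>i. \<not> (\<not> in_box a k (h (fst (?D i)) (snd (?D i))) \<or>
        (\<exists>s\<in>deep_set (fst (?D i)). holds a s))) \<longleftrightarrow> certified a k" .
  qed
  ultimately have "(\<xi>, e ?r) \<in> BC_level G" "rho_graph G ?Z (e ?r) (slab certified)" by simp_all
  moreover have "computable (e ?r)"
    using computable_compose[OF e(1) computable_Pair[OF computable_const computable_ident], of ?r] by simp
  ultimately show ?thesis
    unfolding Sigma0_def using rho_eq[of G ?Z "e ?r" "slab certified"]
    by (auto simp: recursive_seq_iff BC_at_def intro!: exI[of _ "e ?r"])
qed

lemma recursive_on_lift: "recursive_on_wrt (Sigma0 G \<xi>) cantor baire lift base"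
proof -
  \<comment> \<open>These are the two shapes of a code: at level 1 it lists neighbourhoods, from
    level 2 on it lists codes.\<close>
  have "\<xi> = 1 \<or> osuc 1 \<le> \<xi>"
    using one_le less_osuc_iff[of \<xi> 1] by (meson not_le order.antisym)
  then have "slab certified \<in> Sigma0 G \<xi> (cantor \<otimes> omega)"
    using certified_level_one certified_level_ge_two by blast
  moreover have "computes cantor baire lift base (slab certified)"
    unfolding computes_def
  proof (intro conjI ballI allI)
    show "base \<subseteq> dom lift" by (auto simp: lift_def Let_def)
    show "slab certified \<subseteq> points (cantor \<otimes> omega)"
      unfolding points_slab by (auto simp: slab_def)
    show "the (lift x) \<in> nbhd baire k \<longleftrightarrow> Pt_pair x (Pt_nat k) \<in> slab certified" if x: "x \<in> base" for x k
    proof -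
      obtain a where a: "x = Pt_seq a" "binary_seq a" "\<not> holds a []" using base_E[OF x] by blast
      then show ?thesis
        using x lift_base[of a] mem_nbhd_iff_certificate[OF a(2,3), of k]
        by (simp add: mem_slab certified_def)
    qed
  qed
  moreover have "partial_fun cantor baire lift"
    by (auto simp: partial_fun_def lift_def Let_def base_def ran_def split: if_splits)
  ultimately show ?thesis unfolding recursive_on_wrt_def by blast
qed

end

theorem theorem1p5:
  fixes G :: parametrization and \<xi> :: omega1 and B :: "pt set"
  assumes "good_parametrization G"
    and "1 \<le> \<xi>"
    and "B \<in> Pi0 G (osuc \<xi>) cantor"
  shows "\<exists>C f g.
           C \<in> Pi0 G 1 baire \<and>
           recursive_on baire cantor f C \<and>
           recursive_on_wrt (Sigma0 G \<xi>) cantor baire g B \<and>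
           bij_betw (\<lambda>x. the (f x)) C B \<and>
           (\<forall>y \<in> B. the (g y) = the_inv_into C (\<lambda>x. the (f x)) y)"
proof -
  obtain \<gamma> where \<gamma>: "recursive_seq \<gamma>" "\<gamma> \<in> BC_at G (osuc \<xi>)" and B: "B = points cantor - rho G cantor \<gamma>"
    using assms(3) by (auto simp: Pi0_def Sigma0_def)
  interpret borel_tree G \<xi> \<gamma>
    using assms(1,2) \<gamma> by unfold_locales (simp_all add: recursive_seq_iff)
  have B': "B = base" by (simp add: B base_def)
  show ?thesis
    unfolding B'
    using cover_Pi0 recursive_on_proj recursive_on_lift bij_proj lift_inverse by blast
qed

end
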